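(* Let $d\geq 5$ be an integer. The highest volume of an isospectral pair of $d$-dimensional non-isometric spherical orbifolds is $\operatorname{vol}(S^d)/8$. That is, there exist two $d$-dimensional spherical orbifolds $S^d/\Gamma$ and $S^d/\Gamma'$ that are isospectral, non-isometric, and each of volume $\operatorname{vol}(S^d)/8$; and whenever $S^d/\Gamma$ and $S^d/\Gamma'$ are isospectral and non-isometric $d$-dimensional spherical orbifolds, their (common) volume is at most $\operatorname{vol}(S^d)/8$.
   Context: $S^d$ is the $d$-dimensional unit sphere in $\mathbb{R}^{d+1}$ with the round metric of constant sectional curvature $1$, and $\mathrm{O}(d+1)$ is its isometry group. A $d$-dimensional spherical orbifold is a quotient $S^d/\Gamma$ with $\Gamma$ a finite subgroup of $\mathrm{O}(d+1)$ (possibly with fixed points on $S^d$), endowed with the Riemannian (orbifold) metric induced by the round metric; "isometric" means isometric as Riemannian orbifolds. Its volume is $\operatorname{vol}(S^d/\Gamma)=\operatorname{vol}(S^d)/|\Gamma|$. The spectrum $\operatorname{Spec}(S^d/\Gamma)$ is the multiset of eigenvalues of the Laplace--Beltrami operator acting on functions on $S^d/\Gamma$ (i.e. on $\Gamma$-invariant functions on $S^d$). Explicitly, it consists of the numbers $\lambda_k=k(k+d-1)$, $k\geq 0$, each with multiplicity $\dim\mathcal{H}_k^\Gamma$, where $\mathcal{H}_k$ is the space of complex harmonic homogeneous polynomials of degree $k$ in $d+1$ variables, with $\mathrm{O}(d+1)$ acting by $(a\cdot P)(z)=P(a^{-1}z)$, and $\mathcal{H}_k^\Gamma$ is its subspace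 of $\Gamma$-invariant elements. Two spherical orbifolds are isospectral if their spectra coincide as multisets; isospectral spherical orbifolds have the same dimension and the same volume. *)

theory Defs
  imports
    "HOL-Analysis.Analysis"
    "HOL-Library.Function_Algebras"
    "HOL-Algebra.Group"
begin

text \<open>
  Throughout, the ambient space \<open>\<real>\<^sup>d\<^sup>+\<^sup>1\<close> is \<open>real ^ 'n\<close> with \<open>CARD('n) = d + 1\<close>, the sphere \<open>S\<^sup>d\<close> is
  \<open>sphere 0 1\<close>, and the orbifold \<open>S\<^sup>d/\<Gamma>\<close> is represented by the group \<open>\<Gamma>\<close>.
\<close>

definition orthogonal_group :: "(real ^ 'n ^ 'n) monoid" where
  "orthogonal_group = \<lparr>carrier = {A. orthogonal_matrix A}, mult = (**), one = mat 1\<rparr>"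

definition finite_orthogonal_subgroup :: "(real ^ 'n ^ 'n) set \<Rightarrow> bool" where
  "finite_orthogonal_subgroup \<Gamma> \<longleftrightarrow> finite \<Gamma> \<and> subgroup \<Gamma> orthogonal_group"


section \<open>The quotient orbifold and its Riemannian isometries\<close>

definition orbit :: "(real ^ 'n ^ 'n) set \<Rightarrow> real ^ 'n \<Rightarrow> (real ^ 'n) set" where
  "orbit \<Gamma> x = (\<lambda>a. a *v x) ` \<Gamma>"

definition quotient_open :: "(real ^ 'n ^ 'n) set \<Rightarrow> (real ^ 'n) set set \<Rightarrow> bool" where
  "quotient_open \<Gamma> W \<longleftrightarrow> W \<subseteq> orbit \<Gamma> ` sphere 0 1 \<and>
     openin (top_of_set (sphere 0 1)) {x \<in> sphere 0 1. orbit \<Gamma> x \<in> W}"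

definition orbifold_topology :: "(real ^ 'n ^ 'n) set \<Rightarrow> (real ^ 'n) set topology" where
  "orbifold_topology \<Gamma> = topology (quotient_open \<Gamma>)"

lemma openin_orbifold_topology: "openin (orbifold_topology \<Gamma>) = quotient_open \<Gamma>"
proof -
  have "istopology (quotient_open \<Gamma>)"
    unfolding istopology_def
  proof (intro conjI allI impI)
    fix S T
    assume S: "quotient_open \<Gamma> S" and T: "quotient_open \<Gamma> T"
    have eq: "{x \<in> sphere 0 1. orbit \<Gamma> x \<in> S \<inter> T} =
      {x \<in> sphere 0 1. orbit \<Gamma> x \<in> S} \<inter> {x \<in> sphere 0 1. orbit \<Gamma> x \<in> T}"
      by auto
    show "quotient_open \<Gamma> (S \<inter> T)"
      using S T unfolding quotient_open_def eq by (auto intro: openin_Int)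
  next
    fix K
    assume K: "\<forall>S\<in>K. quotient_open \<Gamma> S"
    have eq: "{x \<in> sphere 0 1. orbit \<Gamma> x \<in> \<Union>K} =
      \<Union>((\<lambda>S. {x \<in> sphere 0 1. orbit \<Gamma> x \<in> S}) ` K)"
      by auto
    show "quotient_open \<Gamma> (\<Union>K)"
      using K unfolding quotient_open_def eq by (intro conjI openin_Union) auto
  qed
  then show ?thesis
    unfolding orbifold_topology_def by (rule topology_inverse')
qed

text \<open>\<open>C\<^sup>k\<close> on an open set: differentiable, with all directional derivatives \<open>C\<^sup>k\<^sup>-\<^sup>1\<close>.\<close>

primrec Ck_on ::
  "nat \<Rightarrow> 'a::euclidean_space set \<Rightarrow> ('a \<Rightarrow> 'b::euclidean_space) \<Rightarrow> bool" where
  "Ck_on 0 W g \<longleftrightarrow> continuous_on W g"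
| "Ck_on (Suc k) W g \<longleftrightarrow>
     (\<exists>g'. (\<forall>x\<in>W. (g has_derivative g' x) (at x)) \<and> (\<forall>v. Ck_on k W (\<lambda>x. g' x v)))"

text \<open>Smoothness on a subset of a submanifold: locally the restriction of an ambient smooth map.\<close>

definition smooth_map_on ::
  "'a::euclidean_space set \<Rightarrow> ('a \<Rightarrow> 'b::euclidean_space) \<Rightarrow> bool" where
  "smooth_map_on U f \<longleftrightarrow>
     (\<forall>u\<in>U. \<exists>W g. open W \<and> u \<in> W \<and> (\<forall>k. Ck_on k W g) \<and> (\<forall>x\<in>U \<inter> W. g x = f x))"

text \<open>
  Riemannian isometries between open subsets of the round sphere. The derivative within \<open>U\<close> is
  unique only on the tangent space \<open>u\<^sup>\<bottom>\<close>, and only its values there are constrained.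
\<close>

definition riemannian_isometry ::
  "(real ^ 'n) set \<Rightarrow> (real ^ 'n) set \<Rightarrow> (real ^ 'n \<Rightarrow> real ^ 'n) \<Rightarrow> bool" where
  "riemannian_isometry U V f \<longleftrightarrow>
     openin (top_of_set (sphere 0 1)) U \<and> openin (top_of_set (sphere 0 1)) V \<and>
     bij_betw f U V \<and> smooth_map_on U f \<and> smooth_map_on V (inv_into U f) \<and>
     (\<forall>u\<in>U. \<exists>D. (f has_derivative D) (at u within U) \<and>
        (\<forall>v w. u \<bullet> v = 0 \<and> u \<bullet> w = 0 \<longrightarrow> D v \<bullet> D w = v \<bullet> w))"

text \<open>
  An isometry of Riemannian orbifolds is a homeomorphism of the underlying spaces which near every
  point lifts to a Riemannian isometry between orbifold charts; here the charts are open subsets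
  of \<open>S\<^sup>d\<close>.
\<close>

definition orbifold_isometry ::
  "(real ^ 'n ^ 'n) set \<Rightarrow> (real ^ 'n ^ 'n) set \<Rightarrow> ((real ^ 'n) set \<Rightarrow> (real ^ 'n) set) \<Rightarrow> bool"
  where
  "orbifold_isometry \<Gamma> \<Gamma>' \<phi> \<longleftrightarrow>
     homeomorphic_map (orbifold_topology \<Gamma>) (orbifold_topology \<Gamma>') \<phi> \<and>
     (\<forall>x\<in>sphere 0 1. \<exists>U V f. x \<in> U \<and> riemannian_isometry U V f \<and>
        (\<forall>u\<in>U. \<phi> (orbit \<Gamma> u) = orbit \<Gamma>' (f u)))"

definition isometric_orbifolds :: "(real ^ 'n ^ 'n) set \<Rightarrow> (real ^ 'n ^ 'n) set \<Rightarrow> bool" where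
  "isometric_orbifolds \<Gamma> \<Gamma>' \<longleftrightarrow> (\<exists>\<phi>. orbifold_isometry \<Gamma> \<Gamma>' \<phi>)"


section \<open>Volume\<close>

text \<open>Surface measure of a subset \<open>E\<close> of the unit sphere, via the Lebesgue measure of the cone over \<open>E\<close>.\<close>

definition surface_measure :: "(real ^ 'n) set \<Rightarrow> real" where
  "surface_measure E =
     real CARD('n) * measure lebesgue {r *\<^sub>R x | r x. 0 \<le> r \<and> r \<le> 1 \<and> x \<in> E}"

definition orbifold_volume :: "(real ^ 'n ^ 'n) set \<Rightarrow> real" where
  "orbifold_volume \<Gamma> = surface_measure (sphere 0 1 :: (real ^ 'n) set) / real (card \<Gamma>)"


section \<open>Spectrum\<close>

text \<open>Polynomials are identified with the functions they induce on \<open>\<real>\<^sup>d\<^sup>+\<^sup>1\<close>.\<close>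

definition homogeneous_polynomial :: "nat \<Rightarrow> (real ^ 'n \<Rightarrow> complex) \<Rightarrow> bool" where
  "homogeneous_polynomial k P \<longleftrightarrow>
     (\<exists>c :: ('n \<Rightarrow> nat) \<Rightarrow> complex. \<forall>z. P z =
        (\<Sum>m | (\<Sum>i\<in>UNIV. m i) = k. c m * (\<Prod>i\<in>UNIV. complex_of_real (z $ i) ^ m i)))"

definition partial_deriv :: "'n \<Rightarrow> (real ^ 'n \<Rightarrow> complex) \<Rightarrow> real ^ 'n \<Rightarrow> complex" where
  "partial_deriv i P z = vector_derivative (\<lambda>t. P (z + t *\<^sub>R axis i 1)) (at 0)"

definition laplacian :: "(real ^ 'n \<Rightarrow> complex) \<Rightarrow> real ^ 'n \<Rightarrow> complex" where
  "laplacian P z = (\<Sum>i\<in>UNIV. partial_deriv i (partial_deriv i P) z)"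

definition harmonic_polynomials :: "nat \<Rightarrow> (real ^ 'n \<Rightarrow> complex) set" where
  "harmonic_polynomials k = {P. homogeneous_polynomial k P \<and> (\<forall>z. laplacian P z = 0)}"

definition act :: "real ^ 'n ^ 'n \<Rightarrow> (real ^ 'n \<Rightarrow> complex) \<Rightarrow> real ^ 'n \<Rightarrow> complex" where
  "act a P = (\<lambda>z. P (matrix_inv a *v z))"

definition invariant_harmonics ::
  "(real ^ 'n ^ 'n) set \<Rightarrow> nat \<Rightarrow> (real ^ 'n \<Rightarrow> complex) set" where
  "invariant_harmonics \<Gamma> k = {P \<in> harmonic_polynomials k. \<forall>a\<in>\<Gamma>. act a P = P}"

definition complex_dim :: "('a \<Rightarrow> complex) set \<Rightarrow> nat" where
  "complex_dim = vector_space.dim (\<lambda>(c::complex) f z. c * f z)"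

text \<open>\<open>k(k + d - 1)\<close>, where \<open>d + 1 = CARD('n)\<close>.\<close>

definition sphere_eigenvalue :: "'n itself \<Rightarrow> nat \<Rightarrow> real" where
  "sphere_eigenvalue _ k = real k * (real k + real CARD('n) - 2)"

text \<open>The spectrum is an infinite multiset, encoded by its multiplicity function.\<close>

definition orbifold_spectrum :: "(real ^ 'n ^ 'n) set \<Rightarrow> real \<Rightarrow> nat" where
  "orbifold_spectrum \<Gamma> l =
     (\<Sum>k | sphere_eigenvalue TYPE('n) k = l. complex_dim (invariant_harmonics \<Gamma> k))"

definition isospectral :: "(real ^ 'n ^ 'n) set \<Rightarrow> (real ^ 'n ^ 'n) set \<Rightarrow> bool" where
  "isospectral \<Gamma> \<Gamma>' \<longleftrightarrow> orbifold_spectrum \<Gamma> = orbifold_spectrum \<Gamma>'"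

end

theory Submission
  imports Defs "HOL-Algebra.Multiplicative_Group" "HOL-Algebra.Sylow"
begin

text \<open>
  Averaging over \<open>\<Gamma>\<close> and the Fischer decomposition show that the spectrum of \<open>S\<^sup>d/\<Gamma>\<close> is equivalent to
  the Molien series \<open>|\<Gamma>|\<^sup>-\<^sup>1 \<Sum> 1 / det (1 - t g)\<close>, summed over \<open>g \<in> \<Gamma>\<close>. Its behaviour at \<open>t = 1\<close>
  determines \<open>|\<Gamma>|\<close>. If \<open>|\<Gamma>| \<le> 7\<close>, then the first four coefficients and the poles at \<open>t = 1\<close> and
  \<open>t = -1\<close> determine \<open>\<Gamma>\<close> as an abstract group together with the traces of its elements up to an
  automorphism, and real orthogonal representations with equal traces are orthogonally conjugate.

  For \<open>|\<Gamma>| = 8\<close> two inequivalent binary codes of length 6 and dimension 3 with the same weight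
  enumerator give groups of diagonal sign matrices with equal Molien series. An orbifold isometry
  would be induced near each point by a linear isometry conjugating the isotropy group into the
  other group, which the traces forbid.
\<close>

subsection \<open>Orthogonal conjugation induces isometries\<close>

text \<open>The series never says which trace belongs to which group element; it only carries
  symmetric information about all of them. The bound 8 is where this ambiguity first exceeds what
  automorphisms can repair. The three involutions of the Klein group can be permuted at will. For
  orders 5 and 7 the automorphisms act on the traces, taken up to inversion, as cyclic groups of
  order 2 and 3, so order 7 needs a cyclic invariant of degree 4 besides power sums. For order 6 the
  pole orders single out the elements of order 2 and 3. In the elementary abelian group of order 8
  the automorphisms no longer realise all permutations of the seven involutions, and six
  coordinates, that is \<open>d \<ge> 5\<close>, leave room for two assignments of traces that
  differ by a permutation which is not an automorphism.

  No matrix is diagonalised: \<open>det (1 - t g)\<close> enters only through the power sums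
  \<open>trace (mpow g j)\<close>, and eigenvalue multiplicities appear as means of these or as
  values of a Gram form.\<close>

lemma Ck_on_const: "Ck_on k W (\<lambda>x. c)"
  by (induction k arbitrary: c) (auto intro!: exI[of _ "\<lambda>x v. 0"])

text \<open>A linear map is its own derivative at every point, so all directional derivatives are
  constants and the recursion of \<open>Ck_on\<close> ends after one step.\<close>

lemma Ck_on_bounded_linear: "bounded_linear f \<Longrightarrow> Ck_on k W f"
  by (cases k) (auto intro!: exI[of _ "\<lambda>x. f"] Ck_on_const bounded_linear_imp_has_derivative
      linear_continuous_on)

lemma smooth_map_on_bounded_linear: "bounded_linear f \<Longrightarrow> smooth_map_on U f"
  unfolding smooth_map_on_def by (metis Ck_on_bounded_linear UNIV_I open_UNIV)

declare transpose_matrix_vector [simp del]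

lemma orthogonal_matrix_inner:
  fixes U :: "real^'n^'n"
  assumes "orthogonal_matrix U"
  shows "(U *v x) \<bullet> (U *v y) = x \<bullet> y"
proof -
  have "(U *v x) \<bullet> (U *v y) = ((U *v x) v* U) \<bullet> y" by (rule dot_lmul_matrix[symmetric])
  also have "(U *v x) v* U = (transpose U ** U) *v x"
    by (simp add: matrix_vector_mul_assoc[symmetric] transpose_matrix_vector)
  finally show ?thesis using assms by (simp add: orthogonal_matrix_def)
qed

lemma orthogonal_matrix_norm [simp]:
  fixes U :: "real^'n^'n"
  shows "orthogonal_matrix U \<Longrightarrow> norm (U *v x) = norm x"
  by (simp add: norm_eq_sqrt_inner orthogonal_matrix_inner)

lemma orthogonal_matrix_cancel:
  fixes U :: "real^'n^'n"
  assumes "orthogonal_matrix U"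
  shows "transpose U *v (U *v x) = x" "U *v (transpose U *v x) = x"
  using assms by (simp_all add: orthogonal_matrix_def matrix_vector_mul_assoc)

lemma topspace_orbifold_topology: "topspace (orbifold_topology \<Gamma>) = orbit \<Gamma> ` sphere 0 1"
proof -
  have "quotient_open \<Gamma> (orbit \<Gamma> ` sphere 0 1)"
  proof -
    have "{x \<in> sphere 0 1. orbit \<Gamma> x \<in> orbit \<Gamma> ` sphere 0 1} = sphere 0 1" by auto
    then show ?thesis by (simp add: quotient_open_def)
  qed
  then show ?thesis
    unfolding topspace_def openin_orbifold_topology by (auto simp: quotient_open_def)
qed

text \<open>One direction only: applied to \<open>U\<close> and then to \<open>transpose U\<close>
  with the groups exchanged, it yields the homeomorphism.\<close>

lemma continuous_map_orbifold_topology: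
  fixes U :: "real^'n^'n"
  assumes U: "orthogonal_matrix U" and orb: "\<And>x. orbit \<Gamma>' (U *v x) = (*v) U ` orbit \<Gamma> x"
  shows "continuous_map (orbifold_topology \<Gamma>) (orbifold_topology \<Gamma>') (image ((*v) U))"
  unfolding continuous_map topspace_orbifold_topology openin_orbifold_topology
proof (intro conjI allI impI)
  show "image ((*v) U) ` orbit \<Gamma> ` sphere 0 1 \<subseteq> orbit \<Gamma>' ` sphere 0 1"
  proof clarify
    fix x :: "real^'n" assume "x \<in> sphere 0 1"
    then show "(*v) U ` orbit \<Gamma> x \<in> orbit \<Gamma>' ` sphere 0 1"
      using U by (intro image_eqI[of _ _ "U *v x"]) (auto simp: orb)
  qed
  fix W assume W: "quotient_open \<Gamma>' W"
  have eq: "{x \<in> sphere 0 1. orbit \<Gamma> x \<in> {y \<in> orbit \<Gamma> ` sphere 0 1. (*v) U ` y \<in> W}}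
      = sphere 0 1 \<inter> (*v) U -` {x \<in> sphere 0 1. orbit \<Gamma>' x \<in> W}"
    using U by (auto simp: orb)
  show "quotient_open \<Gamma> {y \<in> orbit \<Gamma> ` sphere 0 1. (*v) U ` y \<in> W}"
    unfolding quotient_open_def eq
  proof (intro conjI)
    show "openin (top_of_set (sphere 0 1)) (sphere 0 1 \<inter> (*v) U -` {x \<in> sphere 0 1. orbit \<Gamma>' x \<in>
        W})"
      by (rule continuous_openin_preimage[of _ _ "sphere 0 1"])
        (use W U in \<open>auto simp: quotient_open_def intro: linear_continuous_on\<close>)
  qed auto
qed

proposition isometric_orbifolds_conjugate:
  fixes U :: "real^'n^'n"
  assumes U: "orthogonal_matrix U" and \<Gamma>': "\<Gamma>' = (\<lambda>a. U ** a ** transpose U) ` \<Gamma>"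
  shows "isometric_orbifolds \<Gamma> \<Gamma>'"
proof -
  have orb: "orbit \<Gamma>' (U *v x) = (*v) U ` orbit \<Gamma> x" for x
  proof -
    have "(U ** a ** transpose U) *v (U *v x) = U *v (a *v x)" for a
      by (simp only: matrix_vector_mul_assoc[symmetric] orthogonal_matrix_cancel[OF U])
    then show ?thesis unfolding orbit_def \<Gamma>' image_image by simp
  qed
  have U': "orthogonal_matrix (transpose U)" using U by (simp add: orthogonal_matrix_transpose)
  have orb': "orbit \<Gamma> (transpose U *v x) = (*v) (transpose U) ` orbit \<Gamma>' x" for x
    using orb[of "transpose U *v x"] by (simp add: orthogonal_matrix_cancel[OF U] image_image)
  have "homeomorphic_maps (orbifold_topology \<Gamma>) (orbifold_topology \<Gamma>')
      (image ((*v) U)) (image ((*v) (transpose U)))"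
    unfolding homeomorphic_maps_def
    using continuous_map_orbifold_topology[OF U orb] continuous_map_orbifold_topology[OF U' orb']
    by (auto simp: image_image orthogonal_matrix_cancel[OF U])
  then have hom: "homeomorphic_map (orbifold_topology \<Gamma>) (orbifold_topology \<Gamma>') (image ((*v) U))"
    using homeomorphic_map_maps by blast
  have bij: "bij_betw ((*v) U) (sphere 0 1) (sphere 0 1)"
    by (rule bij_betw_byWitness[of _ "(*v) (transpose U)"])
      (use U U' in \<open>auto simp: orthogonal_matrix_cancel[OF U]\<close>)
  have inv: "inv_into (sphere 0 1) ((*v) U) y = transpose U *v y" if "y \<in> sphere 0 1" for y
  proof (rule inv_into_f_eq)
    show "inj_on ((*v) U) (sphere 0 1)" using bij by (rule bij_betw_imp_inj_on)
  qed (use that U' in \<open>auto simp: orthogonal_matrix_cancel[OF U]\<close>)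
  \<comment> \<open>\<open>inv_into\<close> is controlled only on the sphere, so the ambient smooth
    extension is the linear map given by \<open>transpose U\<close>.\<close>
  have "smooth_map_on (sphere 0 1) (inv_into (sphere 0 1) ((*v) U))"
    unfolding smooth_map_on_def
    by (intro ballI exI[of _ UNIV] exI[of _ "(*v) (transpose U)"])
      (auto intro: Ck_on_bounded_linear simp: inv)
  then have "riemannian_isometry (sphere 0 1) (sphere 0 1) ((*v) U)"
    unfolding riemannian_isometry_def
    using bij smooth_map_on_bounded_linear[OF matrix_vector_mul_bounded_linear]
    by (auto intro!: exI[of _ "(*v) U"] bounded_linear_imp_has_derivative simp:
        orthogonal_matrix_inner[OF U])
  with hom show ?thesis
    unfolding isometric_orbifolds_def orbifold_isometry_def
    by (intro exI[of _ "image ((*v) U)"] conjI ballI exI[of _ "sphere 0 1"] exI[of _ "(*v) U"])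
        (auto simp: orb)
qed

subsection \<open>Homogeneous polynomials\<close>

definition monomial :: "('n::finite \<Rightarrow> nat) \<Rightarrow> real^'n \<Rightarrow> complex" where
  "monomial m z = (\<Prod>i\<in>UNIV. complex_of_real (z $ i) ^ m i)"

definition exponents :: "nat \<Rightarrow> ('n::finite \<Rightarrow> nat) set" where
  "exponents k = {m. (\<Sum>i\<in>UNIV. m i) = k}"

definition polys :: "nat \<Rightarrow> (real^'n \<Rightarrow> complex) set" where
  "polys k = Collect (homogeneous_polynomial k)"

lemma finite_exponents [simp]: "finite (exponents k :: ('n::finite \<Rightarrow> nat) set)"
proof (rule finite_subset)
  show "exponents k \<subseteq> (UNIV :: 'n set) \<rightarrow>\<^sub>E {..k}"
    unfolding exponents_def by (auto simp: member_le_sum)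
  show "finite ((UNIV :: 'n set) \<rightarrow>\<^sub>E {..k})" by (rule finite_PiE) auto
qed

lemma homogeneous_polynomial_iff:
  "homogeneous_polynomial k P \<longleftrightarrow> (\<exists>c. P = (\<lambda>z. \<Sum>m\<in>exponents k. c m * monomial m z))"
  unfolding homogeneous_polynomial_def exponents_def monomial_def by (auto simp: fun_eq_iff)

lemma polysI: "(\<And>z. P z = (\<Sum>m\<in>exponents k. c m * monomial m z)) \<Longrightarrow> P \<in> polys k"
  by (auto simp: polys_def homogeneous_polynomial_iff)

lemma polysE:
  assumes "P \<in> polys k"
  obtains c where "P = (\<lambda>z. \<Sum>m\<in>exponents k. c m * monomial m z)"
  using assms by (auto simp: polys_def homogeneous_polynomial_iff)

lemma monomial_in_polys [simp, intro]: "m \<in> exponents k \<Longrightarrow> monomial m \<in> polys k"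
  by (rule polysI[where c = "\<lambda>m'. if m' = m then 1 else 0"]) (simp add: if_distrib[of "\<lambda>x. x * _"]
      cong: if_cong)

lemma polys_add: "P \<in> polys k \<Longrightarrow> Q \<in> polys k \<Longrightarrow> (\<lambda>z. P z + Q z) \<in> polys k"
proof -
  assume "P \<in> polys k" "Q \<in> polys k"
  then obtain c d where "P = (\<lambda>z. \<Sum>m\<in>exponents k. c m * monomial m z)" "Q = (\<lambda>z. \<Sum>m\<in>exponents k. d
      m * monomial m z)"
    by (elim polysE)
  then show ?thesis
    by (intro polysI[where c = "\<lambda>m. c m + d m"]) (simp add: sum.distrib algebra_simps)
qed

lemma polys_scale: "P \<in> polys k \<Longrightarrow> (\<lambda>z. c * P z) \<in> polys k"
proof -
  assume "P \<in> polys k"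
  then obtain d where "P = (\<lambda>z. \<Sum>m\<in>exponents k. d m * monomial m z)" by (elim polysE)
  then show ?thesis by (intro polysI[where c = "\<lambda>m. c * d m"]) (simp add: sum_distrib_left mult_ac)
qed

lemma polys_zero [simp]: "(\<lambda>z. 0) \<in> polys k"
  by (rule polysI[where c = "\<lambda>_. 0"]) simp

lemma polys_sum: "(\<And>i. i \<in> I \<Longrightarrow> P i \<in> polys k) \<Longrightarrow> (\<lambda>z. \<Sum>i\<in>I. P i z) \<in> polys k"
  by (induction I rule: infinite_finite_induct) (simp_all add: polys_add)

lemma monomial_split: "monomial m z = complex_of_real (z $ i) ^ m i * (\<Prod>j\<in>UNIV-{i}.
    complex_of_real (z $ j) ^ m j)"
  unfolding monomial_def by (subst prod.remove[of _ i]) auto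

lemma monomial_Suc: "monomial (m(i := Suc (m i))) z = complex_of_real (z $ i) * monomial m z"
proof -
  have "(\<Prod>j\<in>UNIV-{i}. complex_of_real (z $ j) ^ (m(i := Suc (m i))) j) = (\<Prod>j\<in>UNIV-{i}.
      complex_of_real (z $ j) ^ m j)"
    by (rule prod.cong) auto
  then show ?thesis unfolding monomial_split[of _ z i] by simp
qed

lemma monomial_pred: "m i > 0 \<Longrightarrow> monomial m z = complex_of_real (z $ i) * monomial (m(i := m i -
    1)) z"
  using monomial_Suc[of "m(i := m i - 1)" i z] by simp

lemma exponents_Suc: "m(i := Suc (m i)) \<in> exponents (Suc k) \<longleftrightarrow> m \<in> exponents k"
proof -
  have "(\<Sum>j\<in>UNIV. (m(i := Suc (m i))) j) = Suc (\<Sum>j\<in>UNIV. m j)"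
    by (subst (1 2) sum.remove[of _ i]) auto
  then show ?thesis by (simp add: exponents_def)
qed

lemma exponents_pred: "m i > 0 \<Longrightarrow> m(i := m i - 1) \<in> exponents k \<longleftrightarrow> m \<in> exponents (Suc k)"
  using exponents_Suc[of "m(i := m i - 1)" i k] by simp

lemma exponents_predI: "m \<in> exponents (Suc k) \<Longrightarrow> m i > 0 \<Longrightarrow> m(i := m i - Suc 0) \<in> exponents k"
  using exponents_pred[of m i k] by simp

subsection \<open>Partial derivatives\<close>

lemma bounded_linear_coord: "bounded_linear (\<lambda>z :: real^'n. complex_of_real (z $ i))"
  by (rule bounded_linear_compose[OF bounded_linear_of_real bounded_linear_vec_nth])

lemma differentiable_monomial: "monomial m differentiable (at z)"
proof -
  have "(\<lambda>z. \<Prod>i\<in>I. complex_of_real (z $ i) ^ m i) differentiable (at z)" for I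
  proof (induction I rule: infinite_finite_induct)
    case (insert x F)
    have "(\<lambda>z. complex_of_real (z $ x)) differentiable (at z)"
      unfolding differentiable_def
      using bounded_linear_imp_has_derivative[OF bounded_linear_coord] by blast
    then show ?case using insert by (simp add: differentiable_mult)
  qed auto
  then show ?thesis unfolding monomial_def[abs_def] .
qed

lemma differentiable_polys: "P \<in> polys k \<Longrightarrow> P differentiable (at z)"
proof (elim polysE)
  fix c assume P: "P = (\<lambda>z. \<Sum>m\<in>exponents k. c m * monomial m z)"
  show "P differentiable (at z)" unfolding P
    by (intro differentiable_sum differentiable_mult differentiable_const
        differentiable_monomial[unfolded eta_contract_eq] finite_exponents ballI)
qed

lemma has_vector_derivative_along:
  assumes "(P has_derivative D) (at z)"
  shows "((\<lambda>t. P (z + t *\<^sub>R v)) has_vector_derivative D v) (at 0)"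
proof -
  have "((\<lambda>t. z + t *\<^sub>R v) has_derivative (\<lambda>t. t *\<^sub>R v)) (at 0)"
    by (auto intro!: derivative_eq_intros)
  then have "((\<lambda>t. P (z + t *\<^sub>R v)) has_derivative (\<lambda>t. D (t *\<^sub>R v))) (at 0)"
    by (rule has_derivative_compose) (use assms in simp)
  moreover have "D (t *\<^sub>R v) = t *\<^sub>R D v" for t
    using assms has_derivative_linear linear_scale by blast
  ultimately show ?thesis by (simp add: has_vector_derivative_def)
qed

lemma partial_deriv_eq: "(P has_derivative D) (at z) \<Longrightarrow> partial_deriv i P z = D (axis i 1)"
  unfolding partial_deriv_def by (intro vector_derivative_at has_vector_derivative_along)

lemma partial_deriv_monomial:
  "partial_deriv i (monomial m) = (\<lambda>z. of_nat (m i) * monomial (m(i := m i - 1)) z)"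
proof
  fix z :: "real^'a"
  define R where "R = (\<Prod>j\<in>UNIV-{i}. complex_of_real (z $ j) ^ m j)"
  have "monomial m (z + t *\<^sub>R axis i 1) = complex_of_real (z $ i + t) ^ m i * R" for t
    unfolding R_def monomial_split[of _ _ i]
    by (intro arg_cong2[of _ _ _ _ "(*)"] prod.cong) (auto simp: axis_def)
  then have "partial_deriv i (monomial m) z = vector_derivative (\<lambda>t. complex_of_real (z $ i + t) ^
      m i * R) (at 0)"
    by (simp add: partial_deriv_def)
  also have "\<dots> = of_nat (m i) * complex_of_real (z $ i) ^ (m i - 1) * R"
  proof (rule vector_derivative_at)
    have "((\<lambda>x. (complex_of_real (z $ i) + x) ^ m i * R) has_field_derivative of_nat (m i) *
        complex_of_real (z $ i) ^ (m i - 1) * R) (at (complex_of_real 0))"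
      by (auto intro!: derivative_eq_intros)
    then have "((\<lambda>t. (complex_of_real (z $ i) + complex_of_real t) ^ m i * R)
        has_vector_derivative of_nat (m i) * complex_of_real (z $ i) ^ (m i - 1) * R) (at 0)"
      by (rule has_vector_derivative_real_field)
    then show "((\<lambda>t. complex_of_real (z $ i + t) ^ m i * R) has_vector_derivative of_nat (m i) *
        complex_of_real (z $ i) ^ (m i - 1) * R) (at 0)"
      by simp
  qed
  also have "\<dots> = of_nat (m i) * monomial (m(i := m i - 1)) z"
    unfolding R_def monomial_split[of _ z i] by (simp cong: prod.cong_simp)
  finally show "partial_deriv i (monomial m) z = of_nat (m i) * monomial (m(i := m i - 1)) z" .
qed

lemma partial_deriv_add:
  assumes "P differentiable (at z)" "Q differentiable (at z)"
  shows "partial_deriv i (\<lambda>z. P z + Q z) z = partial_deriv i P z + partial_deriv i Q z"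
proof -
  obtain D E where D: "(P has_derivative D) (at z)" and E: "(Q has_derivative E) (at z)"
    using assms by (auto simp: differentiable_def)
  show ?thesis
    using partial_deriv_eq[OF has_derivative_add[OF D E]] partial_deriv_eq[OF D]
        partial_deriv_eq[OF E] by simp
qed

lemma partial_deriv_scale:
  assumes "P differentiable (at z)"
  shows "partial_deriv i (\<lambda>z. c * P z) z = c * partial_deriv i P z"
proof -
  obtain D where D: "(P has_derivative D) (at z)"
    using assms by (auto simp: differentiable_def)
  show ?thesis
    using partial_deriv_eq[OF has_derivative_mult_right[OF D]] partial_deriv_eq[OF D] by simp
qed

lemma partial_deriv_const [simp]: "partial_deriv i (\<lambda>z. c) = (\<lambda>z. 0)"
  using partial_deriv_eq[OF has_derivative_const] by (auto simp: fun_eq_iff)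

lemma partial_deriv_sum:
  assumes "finite I" "\<And>j. j \<in> I \<Longrightarrow> P j differentiable (at z)"
  shows "partial_deriv i (\<lambda>z. \<Sum>j\<in>I. P j z) z = (\<Sum>j\<in>I. partial_deriv i (P j) z)"
  using assms
proof (induction I rule: finite_induct)
  case (insert x F)
  then show ?case
    by (simp add: partial_deriv_add differentiable_sum)
qed simp

lemma partial_deriv_poly:
  "partial_deriv i (\<lambda>z. \<Sum>m\<in>S. c m * monomial m z)
     = (\<lambda>z. \<Sum>m\<in>S. c m * of_nat (m i) * monomial (m(i := m i - 1)) z)" if "finite S"
proof
  fix z
  show "partial_deriv i (\<lambda>z. \<Sum>m\<in>S. c m * monomial m z) z = (\<Sum>m\<in>S. c m * of_nat (m i) * monomial
      (m(i := m i - 1)) z)"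
    using that
    by (simp add: partial_deriv_sum differentiable_mult differentiable_monomial partial_deriv_scale
       partial_deriv_monomial mult.assoc)
qed

lemma partial_deriv_in_polys: "P \<in> polys k \<Longrightarrow> partial_deriv i P \<in> polys (k - 1)"
proof (elim polysE)
  fix c assume P: "P = (\<lambda>z. \<Sum>m\<in>exponents k. c m * monomial m z)"
  have "(\<lambda>z. c m * of_nat (m i) * monomial (m(i := m i - 1)) z) \<in> polys (k - 1)" if m: "m \<in>
      exponents k" for m
  proof (cases "m i")
    case 0 then show ?thesis by simp
  next
    case (Suc j)
    then have "k > 0" using m member_le_sum[of i UNIV m] by (auto simp: exponents_def)
    then have "m(i := m i - 1) \<in> exponents (k - 1)" using exponents_pred[of m i "k - 1"] Suc m by
        simp
    then show ?thesis by (intro polys_scale monomial_in_polys)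
  qed
  then show "partial_deriv i P \<in> polys (k - 1)"
    unfolding P partial_deriv_poly[OF finite_exponents] by (rule polys_sum)
qed

text \<open>Differentiating in a variable that occurs in \<open>m\<close> lowers the degree and
  multiplies the coefficient of \<open>m\<close> by a nonzero integer, so induction on the degree
  applies.\<close>

lemma monomials_independent:
  assumes "\<And>z :: real^'n. (\<Sum>m\<in>exponents k. c m * monomial m z) = 0" and "m \<in> exponents k"
  shows "c m = 0"
  using assms
proof (induction k arbitrary: c m)
  case 0
  have E: "exponents 0 = {\<lambda>i::'n. 0}" by (auto simp: exponents_def)
  show ?case using 0(1)[of 0] 0(2) by (simp add: E monomial_def)
next
  case (Suc k)
  obtain i where i: "m i > 0" using Suc.prems(2) by (auto simp: exponents_def) (metis neq0_conv
      sum.neutral Zero_not_Suc)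
  have pI: "m(i := m i - Suc 0) \<in> exponents k" if "m \<in> exponents (Suc k)" "0 < m i" for m
    using that by (rule exponents_predI)
  have "(\<Sum>m\<in>exponents k. (c (m(i := Suc (m i))) * of_nat (Suc (m i))) * monomial m z) = 0" for z
      :: "real^'n"
  proof -
    have "0 = partial_deriv i (\<lambda>z. \<Sum>m\<in>exponents (Suc k). c m * monomial m z) z"
      using Suc.prems(1) by simp
    also have "\<dots> = (\<Sum>m\<in>exponents (Suc k). c m * of_nat (m i) * monomial (m(i := m i - 1)) z)"
      by (simp add: partial_deriv_poly)
    also have "\<dots> = (\<Sum>m\<in>{m\<in>exponents (Suc k). m i > 0}. c m * of_nat (m i) * monomial (m(i := m i -
        1)) z)"
      by (rule sum.mono_neutral_right) auto
    \<comment> \<open>The monomials free of \<open>z $ i\<close> have dropped out; the remaining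
      ones are indexed by their derivatives.\<close>
    also have "\<dots> = (\<Sum>m\<in>exponents k. (c (m(i := Suc (m i))) * of_nat (Suc (m i))) * monomial m z)"
      by (rule sum.reindex_bij_witness[of _ "\<lambda>m. m(i := Suc (m i))" "\<lambda>m. m(i := m i - 1)"])
        (simp_all add: exponents_Suc pI)
    finally show ?thesis by simp
  qed
  moreover have "m(i := m i - 1) \<in> exponents k" unfolding One_nat_def using Suc.prems(2) i by
      (rule exponents_predI)
  ultimately have "c ((m(i := m i - 1))(i := Suc ((m(i := m i - 1)) i))) * of_nat (Suc ((m(i := m
      i - 1)) i)) = 0"
    by (rule Suc.IH)
  then show ?case using i by (simp del: of_nat_Suc)
qed

text \<open>Determined only for \<open>P\<close> in \<open>polys k\<close> and exponent vectors in
  \<open>exponents k\<close>; elsewhere \<open>SOME\<close> may return anything, hence the side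
  conditions in the rules below.\<close>

definition pcoeff :: "nat \<Rightarrow> (real^'n \<Rightarrow> complex) \<Rightarrow> ('n \<Rightarrow> nat) \<Rightarrow> complex" where
  "pcoeff k P = (SOME c. P = (\<lambda>z. \<Sum>m\<in>exponents k. c m * monomial m z))"

lemma poly_expand:
  assumes "P \<in> polys k"
  shows "P = (\<lambda>z. \<Sum>m\<in>exponents k. pcoeff k P m * monomial m z)"
proof -
  have "\<exists>c. P = (\<lambda>z. \<Sum>m\<in>exponents k. c m * monomial m z)" using assms by (auto elim: polysE)
  then show ?thesis unfolding pcoeff_def by (rule someI_ex)
qed

lemma pcoeff_unique:
  assumes "\<And>z. P z = (\<Sum>m\<in>exponents k. c m * monomial m z)" "m \<in> exponents k"
  shows "pcoeff k P m = c m"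
proof -
  have P: "P \<in> polys k" by (rule polysI[OF assms(1)])
  have "P z = (\<Sum>m\<in>exponents k. pcoeff k P m * monomial m z)" for z by (rule fun_cong[OF
      poly_expand[OF P]])
  then have "(\<Sum>m\<in>exponents k. (pcoeff k P m - c m) * monomial m z) = 0" for z
    using assms(1)[of z] by (simp add: algebra_simps sum_subtractf)
  then have "pcoeff k P m - c m = 0" using assms(2) by (rule monomials_independent)
  then show ?thesis by simp
qed

lemma pcoeff_add:
  assumes "P \<in> polys k" "Q \<in> polys k" "m \<in> exponents k"
  shows "pcoeff k (\<lambda>z. P z + Q z) m = pcoeff k P m + pcoeff k Q m"
proof (rule pcoeff_unique[OF _ assms(3)])
  fix z
  have "P z = (\<Sum>m\<in>exponents k. pcoeff k P m * monomial m z)" "Q z = (\<Sum>m\<in>exponents k. pcoeff k Q m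
      * monomial m z)"
    by (rule fun_cong[OF poly_expand[OF assms(1)]], rule fun_cong[OF poly_expand[OF assms(2)]])
  then show "P z + Q z = (\<Sum>m\<in>exponents k. (pcoeff k P m + pcoeff k Q m) * monomial m z)"
    by (simp add: sum.distrib algebra_simps)
qed

lemma pcoeff_scale:
  assumes "P \<in> polys k" "m \<in> exponents k"
  shows "pcoeff k (\<lambda>z. c * P z) m = c * pcoeff k P m"
proof (rule pcoeff_unique[OF _ assms(2)])
  fix z
  have "P z = (\<Sum>m\<in>exponents k. pcoeff k P m * monomial m z)"
    using poly_expand[OF assms(1)] by (rule fun_cong)
  then show "c * P z = (\<Sum>m\<in>exponents k. (c * pcoeff k P m) * monomial m z)"
    by (simp add: sum_distrib_left mult_ac)
qed

lemma pcoeff_zero [simp]: "m \<in> exponents k \<Longrightarrow> pcoeff k (\<lambda>z. 0) m = 0"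
  by (rule pcoeff_unique[where c = "\<lambda>_. 0"]) auto

lemma pcoeff_sum:
  assumes "\<And>i. i \<in> I \<Longrightarrow> P i \<in> polys k" "m \<in> exponents k"
  shows "pcoeff k (\<lambda>z. \<Sum>i\<in>I. P i z) m = (\<Sum>i\<in>I. pcoeff k (P i) m)"
  using assms(1)
  by (induction I rule: infinite_finite_induct) (simp_all add: pcoeff_add assms(2) polys_sum)

lemma pcoeff_monomial: "m \<in> exponents k \<Longrightarrow> m' \<in> exponents k \<Longrightarrow> pcoeff k (monomial m) m' = (if m' = m
    then 1 else 0)"
  by (rule pcoeff_unique[where c = "\<lambda>m'. if m' = m then 1 else 0"]) (auto simp: if_distrib[of "\<lambda>x.
      x * _"] cong: if_cong)

subsection \<open>Multiplication by a coordinate\<close>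

definition coord_mult :: "'n \<Rightarrow> (real^'n \<Rightarrow> complex) \<Rightarrow> real^'n \<Rightarrow> complex" where
  "coord_mult i P z = complex_of_real (z $ i) * P z"

lemma coord_mult_monomial: "coord_mult i (monomial m) = monomial (m(i := Suc (m i)))"
  by (simp add: fun_eq_iff coord_mult_def monomial_Suc)

lemma coord_mult_expand:
  assumes "P = (\<lambda>z. \<Sum>m\<in>exponents k. c m * monomial m z)"
  shows "coord_mult i P z = (\<Sum>m\<in>exponents (Suc k). (if m i = 0 then 0 else c (m(i := m i - 1))) *
      monomial m z)"
proof -
  have "(\<Sum>m\<in>exponents (Suc k). (if m i = 0 then 0 else c (m(i := m i - 1))) * monomial m z)
     = (\<Sum>m\<in>{m\<in>exponents (Suc k). m i > 0}. c (m(i := m i - 1)) * monomial m z)"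
    by (rule sum.mono_neutral_cong_right) auto
  also have "\<dots> = (\<Sum>m\<in>exponents k. c m * monomial (m(i := Suc (m i))) z)"
    by (rule sum.reindex_bij_witness[of _ "\<lambda>m. m(i := Suc (m i))" "\<lambda>m. m(i := m i - 1)"])
        (auto simp: exponents_Suc intro!: exponents_predI)
  also have "\<dots> = coord_mult i P z"
    unfolding coord_mult_def assms by (simp add: monomial_Suc sum_distrib_left mult_ac)
  finally show ?thesis by simp
qed

lemma coord_mult_in_polys: "P \<in> polys k \<Longrightarrow> coord_mult i P \<in> polys (Suc k)"
  by (rule polysI[OF coord_mult_expand[OF poly_expand]])

lemma pcoeff_coord_mult:
  assumes "P \<in> polys k" "m \<in> exponents (Suc k)"
  shows "pcoeff (Suc k) (coord_mult i P) m = (if m i = 0 then 0 else pcoeff k P (m(i := m i - 1)))"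
  using coord_mult_expand[OF poly_expand[OF assms(1)]] by (rule pcoeff_unique) (rule assms(2))

text \<open>The Leibniz rule as a commutation relation; its Kronecker delta is the source of the
  trace term in \<open>twisted_trace_Suc\<close>.\<close>

lemma partial_deriv_coord_mult:
  assumes "P differentiable (at z)"
  shows "partial_deriv i (coord_mult j P) z = (if i = j then P z else 0) + coord_mult j
      (partial_deriv i P) z"
proof -
  obtain D where D: "(P has_derivative D) (at z)"
    using assms by (auto simp: differentiable_def)
  have "((\<lambda>z. complex_of_real (z $ j)) has_derivative (\<lambda>z. complex_of_real (z $ j))) (at z)"
    by (rule bounded_linear_imp_has_derivative[OF bounded_linear_coord])
  from has_derivative_mult[OF this D] have
    "partial_deriv i (\<lambda>z. complex_of_real (z $ j) * P z) z = complex_of_real (z $ j) * D (axis i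
        1) + complex_of_real (axis i 1 $ j) * P z"
    by (rule partial_deriv_eq)
  moreover have "coord_mult j P = (\<lambda>z. complex_of_real (z $ j) * P z)" by (simp add: fun_eq_iff
      coord_mult_def)
  ultimately show ?thesis using partial_deriv_eq[OF D] by (auto simp: coord_mult_def axis_def)
qed

subsection \<open>Linear substitution\<close>

definition substitute :: "real^'n^'n \<Rightarrow> (real^'n \<Rightarrow> complex) \<Rightarrow> real^'n \<Rightarrow> complex" where
  "substitute A P z = P (A *v z)"

lemma substitute_coord_mult: "substitute A (coord_mult j P) z = (\<Sum>l\<in>UNIV. complex_of_real (A $ j $
    l) * coord_mult l (substitute A P) z)"
  by (simp add: substitute_def coord_mult_def matrix_vector_mult_def sum_distrib_right
      sum_distrib_left mult.assoc)

text \<open>A coordinate becomes a linear combination of coordinates, so a monomial can be treated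
  one factor at a time by induction on the degree.\<close>

lemma substitute_in_polys: "P \<in> polys k \<Longrightarrow> substitute A P \<in> polys k"
proof -
  have mono: "substitute A (monomial m) \<in> polys k" if "m \<in> exponents k" for m k
    using that
  proof (induction k arbitrary: m)
    case 0
    then have "m = (\<lambda>i. 0)" by (auto simp: exponents_def)
    then have "substitute A (monomial m) = monomial m" by (simp add: substitute_def monomial_def
        fun_eq_iff)
    then show ?case using 0 by auto
  next
    case (Suc k)
    obtain i where i: "m i > 0" using Suc.prems by (auto simp: exponents_def) (metis neq0_conv
        sum.neutral Zero_not_Suc)
    have "substitute A (monomial m) = (\<lambda>z. \<Sum>l\<in>UNIV. complex_of_real (A $ i $ l) * coord_mult l
        (substitute A (monomial (m(i := m i - 1)))) z)"
    proof -
      have "monomial m = coord_mult i (monomial (m(i := m i - 1)))"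
        using i by (simp add: coord_mult_monomial)
      moreover have "substitute A (coord_mult i (monomial (m(i := m i - 1)))) = (\<lambda>z. \<Sum>l\<in>UNIV.
          complex_of_real (A $ i $ l) * coord_mult l (substitute A (monomial (m(i := m i - 1))))
          z)"
        by (rule ext) (rule substitute_coord_mult)
      ultimately show ?thesis by simp
    qed
    moreover have "substitute A (monomial (m(i := m i - 1))) \<in> polys k"
      unfolding One_nat_def by (intro Suc.IH exponents_predI Suc.prems i)
    ultimately show ?case by (auto intro!: polys_sum polys_scale coord_mult_in_polys)
  qed
  assume "P \<in> polys k"
  then obtain c where P: "P = (\<lambda>z. \<Sum>m\<in>exponents k. c m * monomial m z)" by (elim polysE)
  have "substitute A P = (\<lambda>z. \<Sum>m\<in>exponents k. c m * substitute A (monomial m) z)"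
    by (simp add: P substitute_def fun_eq_iff)
  then show ?thesis by (auto intro!: polys_sum polys_scale mono)
qed

subsection \<open>Traces of substitution operators\<close>

primrec mpow :: "real^'n^'n \<Rightarrow> nat \<Rightarrow> real^'n^'n" where
  "mpow A 0 = mat 1"
| "mpow A (Suc k) = A ** mpow A k"

text \<open>
  Newton's recursion: if \<open>p\<close> is the sequence of power sums of some numbers, this computes their complete
  homogeneous symmetric polynomials.
\<close>

fun complete_symmetric :: "(nat \<Rightarrow> real) \<Rightarrow> nat \<Rightarrow> real" where
  "complete_symmetric p 0 = 1"
| "complete_symmetric p (Suc k) = (\<Sum>j\<le>k. p (Suc j) * complete_symmetric p (k - j)) / real (Suc k)"

text \<open>The trace of \<open>L\<close> on degree \<open>k\<close> in the monomial basis. Only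
  values on monomials enter, so operator identities need checking on monomials alone
  (\<open>op_trace_cong\<close>).\<close>

definition op_trace :: "nat \<Rightarrow> ((real^'n \<Rightarrow> complex) \<Rightarrow> real^'n \<Rightarrow> complex) \<Rightarrow> complex" where
  "op_trace k L = (\<Sum>m\<in>exponents k. pcoeff k (L (monomial m)) m)"

lemma op_trace_cong:
  "(\<And>m. m \<in> exponents k \<Longrightarrow> L (monomial m) = M (monomial m)) \<Longrightarrow> op_trace k L = op_trace k M"
  by (simp add: op_trace_def)

lemma op_trace_add:
  assumes "\<And>m. m \<in> exponents k \<Longrightarrow> L (monomial m) \<in> polys k"
    and "\<And>m. m \<in> exponents k \<Longrightarrow> M (monomial m) \<in> polys k"
  shows "op_trace k (\<lambda>P z. L P z + M P z) = op_trace k L + op_trace k M"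
  by (simp add: op_trace_def pcoeff_add assms sum.distrib)

lemma op_trace_scale:
  assumes "\<And>m. m \<in> exponents k \<Longrightarrow> L (monomial m) \<in> polys k"
  shows "op_trace k (\<lambda>P z. c * L P z) = c * op_trace k L"
  by (simp add: op_trace_def pcoeff_scale assms sum_distrib_left)

lemma op_trace_sum:
  assumes "\<And>m i. m \<in> exponents k \<Longrightarrow> i \<in> I \<Longrightarrow> L i (monomial m) \<in> polys k"
  shows "op_trace k (\<lambda>P z. \<Sum>i\<in>I. L i P z) = (\<Sum>i\<in>I. op_trace k (L i))"
proof -
  have "op_trace k (\<lambda>P z. \<Sum>i\<in>I. L i P z) = (\<Sum>m\<in>exponents k. \<Sum>i\<in>I. pcoeff k (L i (monomial m)) m)"
    unfolding op_trace_def by (intro sum.cong refl pcoeff_sum assms)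
  also have "\<dots> = (\<Sum>i\<in>I. op_trace k (L i))" unfolding op_trace_def by (rule sum.swap)
  finally show ?thesis .
qed

text \<open>Cyclicity of the trace for maps between degrees \<open>k\<close> and
  \<open>Suc k\<close>: multiplication by a coordinate sends monomials injectively to monomials, so
  the two sums of diagonal coefficients differ by reindexing.\<close>

lemma op_trace_coord_mult:
  assumes "\<And>m. m \<in> exponents (Suc k) \<Longrightarrow> L (monomial m) \<in> polys k"
  shows "op_trace (Suc k) (\<lambda>P. coord_mult l (L P)) = op_trace k (\<lambda>P. L (coord_mult l P))"
proof -
  have "op_trace (Suc k) (\<lambda>P. coord_mult l (L P))
      = (\<Sum>m\<in>exponents (Suc k). if m l = 0 then 0 else pcoeff k (L (monomial m)) (m(l := m l - 1)))"
    unfolding op_trace_def by (intro sum.cong refl pcoeff_coord_mult assms)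
  also have "\<dots> = (\<Sum>m\<in>{m\<in>exponents (Suc k). m l > 0}. pcoeff k (L (monomial m)) (m(l := m l - 1)))"
    by (rule sum.mono_neutral_cong_right) auto
  also have "\<dots> = (\<Sum>m\<in>exponents k. pcoeff k (L (monomial (m(l := Suc (m l))))) m)"
    by (rule sum.reindex_bij_witness[of _ "\<lambda>m. m(l := Suc (m l))" "\<lambda>m. m(l := m l - 1)"])
      (auto simp: exponents_Suc intro!: exponents_predI)
  finally show ?thesis by (simp add: op_trace_def coord_mult_monomial)
qed

lemma euler_monomial:
  assumes "m \<in> exponents k"
  shows "(\<Sum>i\<in>UNIV. coord_mult i (partial_deriv i (monomial m)) z) = of_nat k * monomial m z"
proof -
  have "coord_mult i (partial_deriv i (monomial m)) z = of_nat (m i) * monomial m z" for i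
    by (cases "m i = 0") (auto simp: coord_mult_def partial_deriv_monomial monomial_pred[of m i z])
  then have "(\<Sum>i\<in>UNIV. coord_mult i (partial_deriv i (monomial m)) z) = of_nat (\<Sum>i\<in>UNIV. m i) *
      monomial m z"
    by (simp add: sum_distrib_right)
  then show ?thesis using assms by (simp add: exponents_def del: of_nat_sum)
qed

text \<open>
  Euler's identity turns \<open>k\<close> times the trace of a substitution on polynomials of degree \<open>k\<close> into a
  twisted trace with \<open>B = 1\<close>, and moving one coordinate cyclically under the trace lowers the degree.
\<close>

definition twisted_trace :: "nat \<Rightarrow> real^'n^'n \<Rightarrow> real^'n^'n \<Rightarrow> complex" where
  "twisted_trace k A B = (\<Sum>i\<in>UNIV. \<Sum>j\<in>UNIV. complex_of_real (B $ i $ j) *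
     op_trace k (\<lambda>P. substitute A (coord_mult j (partial_deriv i P))))"

lemma twisted_term_in_polys:
  assumes "m \<in> exponents k"
  shows "substitute A (coord_mult j (partial_deriv i (monomial m))) \<in> polys k"
proof (cases k)
  case 0
  then have "m = (\<lambda>i. 0)" using assms by (auto simp: exponents_def)
  then have "substitute A (coord_mult j (partial_deriv i (monomial m))) = (\<lambda>z. 0)"
    by (simp add: partial_deriv_monomial substitute_def coord_mult_def fun_eq_iff)
  then show ?thesis by simp
next
  case (Suc n)
  then show ?thesis
    using partial_deriv_in_polys[OF monomial_in_polys[OF assms]] coord_mult_in_polys
        substitute_in_polys by fastforce
qed

lemma twisted_trace_mat: "twisted_trace k A (mat 1) = of_nat k * op_trace k (substitute A)"
proof -
  have "twisted_trace k A (mat 1) = (\<Sum>i\<in>UNIV. op_trace k (\<lambda>P. substitute A (coord_mult i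
      (partial_deriv i P))))"
    unfolding twisted_trace_def by (simp add: mat_def if_distrib[of complex_of_real] if_distrib[of
        "\<lambda>x. x * _"] cong: if_cong)
  also have "\<dots> = op_trace k (\<lambda>P z. \<Sum>i\<in>UNIV. substitute A (coord_mult i (partial_deriv i P)) z)"
    by (rule op_trace_sum[symmetric]) (rule twisted_term_in_polys)
  also have "\<dots> = op_trace k (\<lambda>P z. of_nat k * substitute A P z)"
    by (rule op_trace_cong) (simp add: fun_eq_iff substitute_def euler_monomial)
  also have "\<dots> = of_nat k * op_trace k (substitute A)"
    by (rule op_trace_scale) (auto intro: substitute_in_polys)
  finally show ?thesis .
qed

lemma twisted_trace_0: "twisted_trace 0 A B = 0"
proof -
  have "op_trace 0 (\<lambda>P. substitute A (coord_mult j (partial_deriv i P))) = 0" for i j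
  proof -
    have "substitute A (coord_mult j (partial_deriv i (monomial m))) = (\<lambda>z. 0)" if "m \<in> exponents
        0" for m
      using that by (simp add: exponents_def partial_deriv_monomial substitute_def coord_mult_def
          fun_eq_iff)
    then show ?thesis by (simp add: op_trace_def)
  qed
  then show ?thesis by (simp add: twisted_trace_def)
qed

text \<open>Pulling coordinate \<open>j\<close> through the substitution produces row
  \<open>j\<close> of \<open>A\<close>; cyclicity moves the new coordinate to the other end;
  commuting it with the derivative contributes a Kronecker delta, which sums to
  \<open>trace (B ** A)\<close>. What is left is the same expression one degree lower with
  \<open>B ** A\<close> in place of \<open>B\<close>.\<close>

lemma twisted_trace_Suc:
  "twisted_trace (Suc k) A B = complex_of_real (trace (B ** A)) * op_trace k (substitute A) +
      twisted_trace k A (B ** A)"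
proof -
  have pd: "substitute A (partial_deriv i (monomial m)) \<in> polys k" if "m \<in> exponents (Suc k)" for
      m i
    using partial_deriv_in_polys[OF monomial_in_polys[OF that]] by (auto intro: substitute_in_polys)
  have step: "op_trace (Suc k) (\<lambda>P. substitute A (coord_mult j (partial_deriv i P)))
      = (\<Sum>l\<in>UNIV. complex_of_real (A $ j $ l) * ((if i = l then op_trace k (substitute A) else 0)
           + op_trace k (\<lambda>P. substitute A (coord_mult l (partial_deriv i P)))))" for i j
  proof -
    have "op_trace (Suc k) (\<lambda>P. substitute A (coord_mult j (partial_deriv i P)))
      = op_trace (Suc k) (\<lambda>P z. \<Sum>l\<in>UNIV. complex_of_real (A $ j $ l) * coord_mult l (substitute A
          (partial_deriv i P)) z)"
      by (rule op_trace_cong) (simp add: fun_eq_iff substitute_coord_mult)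
    also have "\<dots> = (\<Sum>l\<in>UNIV. complex_of_real (A $ j $ l) * op_trace (Suc k) (\<lambda>P. coord_mult l
        (substitute A (partial_deriv i P))))"
      by (subst op_trace_sum) (auto intro!: sum.cong op_trace_scale polys_scale
          coord_mult_in_polys pd)
    also have "\<dots> = (\<Sum>l\<in>UNIV. complex_of_real (A $ j $ l) * op_trace k (\<lambda>P. substitute A
        (partial_deriv i (coord_mult l P))))"
      by (intro sum.cong refl arg_cong2[of _ _ _ _ "(*)"] op_trace_coord_mult pd)
    finally have 1: "op_trace (Suc k) (\<lambda>P. substitute A (coord_mult j (partial_deriv i P)))
       = (\<Sum>l\<in>UNIV. complex_of_real (A $ j $ l) * op_trace k (\<lambda>P. substitute A (partial_deriv i
           (coord_mult l P))))" .
    have "op_trace k (\<lambda>P. substitute A (partial_deriv i (coord_mult l P)))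
        = (if i = l then op_trace k (substitute A) else 0) + op_trace k (\<lambda>P. substitute A
            (coord_mult l (partial_deriv i P)))" for l
    proof -
      have "op_trace k (\<lambda>P. substitute A (partial_deriv i (coord_mult l P)))
        = op_trace k (\<lambda>P z. (if i = l then 1 else 0) * substitute A P z + substitute A (coord_mult
            l (partial_deriv i P)) z)"
        by (rule op_trace_cong)
          (auto simp: fun_eq_iff substitute_def partial_deriv_coord_mult[OF
              differentiable_monomial])
      also have "\<dots> = op_trace k (\<lambda>P z. (if i = l then 1 else 0) * substitute A P z) + op_trace k
          (\<lambda>P. substitute A (coord_mult l (partial_deriv i P)))"
        by (rule op_trace_add) (auto intro!: polys_scale substitute_in_polys twisted_term_in_polys)
      also have "op_trace k (\<lambda>P z. (if i = l then 1 else 0) * substitute A P z) = (if i = l then 1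
          else 0) * op_trace k (substitute A)"
        by (rule op_trace_scale) (auto intro!: substitute_in_polys)
      finally show ?thesis by simp
    qed
    then show ?thesis unfolding 1 by simp
  qed
  define S where "S = (\<lambda>i l. op_trace k (\<lambda>P. substitute A (coord_mult l (partial_deriv i P))))"
  have "twisted_trace (Suc k) A B = (\<Sum>i\<in>UNIV. \<Sum>j\<in>UNIV. \<Sum>l\<in>UNIV. complex_of_real (B $ i $ j * A $ j
      $ l) *
        ((if i = l then op_trace k (substitute A) else 0) + S i l))"
    unfolding twisted_trace_def step S_def by (simp add: sum_distrib_left mult.assoc)
  also have "\<dots> = (\<Sum>i\<in>UNIV. \<Sum>l\<in>UNIV. \<Sum>j\<in>UNIV. complex_of_real (B $ i $ j * A $ j $ l) *
        ((if i = l then op_trace k (substitute A) else 0) + S i l))"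
    by (intro sum.cong refl sum.swap)
  also have "\<dots> = (\<Sum>i\<in>UNIV. \<Sum>l\<in>UNIV. complex_of_real ((B ** A) $ i $ l) *
        ((if i = l then op_trace k (substitute A) else 0) + S i l))"
    by (simp add: matrix_matrix_mult_def sum_distrib_right)
  also have "\<dots> = complex_of_real (trace (B ** A)) * op_trace k (substitute A) + twisted_trace k A
      (B ** A)"
    unfolding twisted_trace_def S_def
    by (simp add: distrib_left sum.distrib trace_def sum_distrib_right if_distrib[of "\<lambda>x. _ * x"]
        cong: if_cong)
  finally show ?thesis .
qed

lemma mpow_Suc_right: "mpow A (Suc k) = mpow A k ** A"
proof (induction k)
  case (Suc k)
  then have "mpow A (Suc (Suc k)) = A ** (mpow A k ** A)" by simp
  then show ?case by (simp add: matrix_mul_assoc)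
qed simp

lemma twisted_trace_eq:
  "twisted_trace k A B = (\<Sum>j<k. complex_of_real (trace (B ** mpow A (Suc j))) * op_trace (k - Suc
      j) (substitute A))"
proof (induction k arbitrary: B)
  case 0
  then show ?case by (simp add: twisted_trace_0)
next
  case (Suc k)
  have "twisted_trace k A (B ** A) = (\<Sum>j<k. complex_of_real (trace (B ** mpow A (Suc (Suc j)))) *
      op_trace (k - Suc j) (substitute A))"
    unfolding Suc.IH by (simp add: matrix_mul_assoc)
  then show ?case
    unfolding twisted_trace_Suc sum.lessThan_Suc_shift by simp
qed

text \<open>For \<open>B = mat 1\<close> the unrolled recursion is Newton's identity
  \<open>k h_k = \<Sum> p_j h_(k-j)\<close> with \<open>p_j\<close> the trace of the
  \<open>j\<close>-th power of \<open>A\<close>, so the values agree by induction on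
  \<open>k\<close>.\<close>

proposition op_trace_substitute:
  "op_trace k (substitute A) = complex_of_real (complete_symmetric (\<lambda>j. trace (mpow A j)) k)"
proof (induction k rule: less_induct)
  case (less k)
  show ?case
  proof (cases k)
    case 0
    have E: "exponents 0 = {\<lambda>i::'a. 0}" by (auto simp: exponents_def)
    have "substitute A (monomial (\<lambda>i. 0)) = monomial (\<lambda>i. 0)" by (simp add: substitute_def
        monomial_def fun_eq_iff)
    then show ?thesis by (simp add: 0 op_trace_def E pcoeff_monomial)
  next
    case (Suc n)
    have "of_nat (Suc n) * op_trace (Suc n) (substitute A)
      = (\<Sum>j<Suc n. complex_of_real (trace (mpow A (Suc j))) * op_trace (Suc n - Suc j) (substitute
          A))"
      using twisted_trace_mat[of "Suc n" A] twisted_trace_eq[of "Suc n" A "mat 1"]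
      by (metis (no_types, lifting) matrix_mul_lid sum.cong)
    also have "\<dots> = (\<Sum>j<Suc n. complex_of_real (trace (mpow A (Suc j)) * complete_symmetric (\<lambda>j.
        trace (mpow A j)) (n - j)))"
      using less.IH by (intro sum.cong) (auto simp: Suc)
    also have "\<dots> = of_nat (Suc n) * complex_of_real (complete_symmetric (\<lambda>j. trace (mpow A j))
        (Suc n))"
      by (simp add: lessThan_Suc_atMost del: of_nat_Suc)
    finally show ?thesis using Suc by (simp del: of_nat_Suc complete_symmetric.simps)
  qed
qed

subsection \<open>Dimension and trace\<close>

context vector_space
begin

text \<open>The trace of a projection is the dimension of its range, with the trace taken in any
  finite family \<open>b\<close> that has coordinate functionals \<open>\<kappa>\<close>. The second
  expansion of \<open>w\<close> says that \<open>R\<close> extends linearly and fixes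
  \<open>W\<close>.\<close>

lemma trace_of_projection:
  assumes "finite I" and W: "subspace W" and RW: "\<And>i. i \<in> I \<Longrightarrow> R (b i) \<in> W"
    and expand: "\<And>w. w \<in> W \<Longrightarrow> w = (\<Sum>i\<in>I. scale (\<kappa> i w) (b i))"
    and R: "\<And>w. w \<in> W \<Longrightarrow> w = (\<Sum>i\<in>I. scale (\<kappa> i w) (R (b i)))"
    and \<kappa>: "\<And>i c B. i \<in> I \<Longrightarrow> finite B \<Longrightarrow> B \<subseteq> W \<Longrightarrow> \<kappa> i (\<Sum>w\<in>B. scale (c w) w) = (\<Sum>w\<in>B. c w * \<kappa> i w)"
  shows "(\<Sum>i\<in>I. \<kappa> i (R (b i))) = of_nat (dim W)"
proof -
  obtain B where B: "B \<subseteq> W" "independent B" "W \<subseteq> span B" "card B = dim W" using basis_exists by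
      blast
  have "B \<subseteq> span (b ` I)"
  proof
    fix w assume "w \<in> B"
    then have w: "w = (\<Sum>i\<in>I. scale (\<kappa> i w) (b i))" using B(1) expand by blast
    show "w \<in> span (b ` I)" by (subst w) (intro span_sum span_scale span_base imageI)
  qed
  then have finB: "finite B" using independent_span_bound[of "b ` I" B] \<open>finite I\<close> B(2) by auto
  have span: "W = span B" using B(1,3) W span_minimal by blast
  define r where "r = representation B"
  have rsum: "(\<Sum>w\<in>B. scale (r v w) w) = v" if "v \<in> W" for v
    unfolding r_def using B(2) that span finB by (intro sum_representation_eq) auto
  have "(\<Sum>i\<in>I. \<kappa> i (R (b i))) = (\<Sum>i\<in>I. \<Sum>w\<in>B. r (R (b i)) w * \<kappa> i w)"
  proof (rule sum.cong[OF refl])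
    fix i assume i: "i \<in> I"
    have "\<kappa> i (R (b i)) = \<kappa> i (\<Sum>w\<in>B. scale (r (R (b i)) w) w)" using rsum[OF RW[OF i]] by simp
    then show "\<kappa> i (R (b i)) = (\<Sum>w\<in>B. r (R (b i)) w * \<kappa> i w)" using \<kappa>[OF i finB B(1)] by simp
  qed
  also have "\<dots> = (\<Sum>w\<in>B. \<Sum>i\<in>I. \<kappa> i w * r (R (b i)) w)"
    by (subst sum.swap) (simp add: mult.commute)
  \<comment> \<open>Each inner sum is the \<open>w\<close>-coordinate of \<open>w\<close> itself,
    because \<open>R\<close> fixes \<open>W\<close>.\<close>
  also have "\<dots> = (\<Sum>w\<in>B. 1)"
  proof (rule sum.cong[OF refl])
    fix w assume w: "w \<in> B"
    have "r w w = r (\<Sum>i\<in>I. scale (\<kappa> i w) (R (b i))) w" using R[of w] w B(1) by auto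
    also have "\<dots> = (\<Sum>i\<in>I. r (scale (\<kappa> i w) (R (b i))) w)"
      unfolding r_def using RW span
      by (subst representation_sum[OF B(2)]) (auto intro: span_scale)
    also have "\<dots> = (\<Sum>i\<in>I. \<kappa> i w * r (R (b i)) w)"
      unfolding r_def using RW span by (intro sum.cong refl) (simp add: representation_scale[OF
          B(2)])
    finally show "(\<Sum>i\<in>I. \<kappa> i w * r (R (b i)) w) = 1"
      using w by (simp add: r_def representation_basis[OF B(2)])
  qed
  finally show ?thesis using B(4) by simp
qed

text \<open>Rank-nullity for a map that is linear on \<open>W\<close> only. This is the situation of
  \<open>laplacian\<close>, which respects sums of polynomials but not of arbitrary
  functions.\<close>

lemma dim_kernel_plus_dim_image:
  assumes W: "subspace W" and T: "finite T" "W \<subseteq> span T"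
    and add: "\<And>x y. x \<in> W \<Longrightarrow> y \<in> W \<Longrightarrow> f (x + y) = f x + f y"
    and sc: "\<And>c x. x \<in> W \<Longrightarrow> f (scale c x) = scale c (f x)"
  shows "dim W = dim {x \<in> W. f x = 0} + dim (f ` W)"
proof -
  define K where "K = {x \<in> W. f x = 0}"
  have f0: "f 0 = 0" using sc[of 0 0] subspace_0[OF W] by simp
  have K: "subspace K"
    unfolding K_def using W f0 by (auto simp: subspace_def add sc)
  obtain A where A: "A \<subseteq> K" "independent A" "K \<subseteq> span A" "card A = dim K" using basis_exists by
      blast
  have "A \<subseteq> W" using A(1) K_def by auto
  obtain B where B: "A \<subseteq> B" "B \<subseteq> W" "independent B" "W \<subseteq> span B"
    using maximal_independent_subset_extend[OF \<open>A \<subseteq> W\<close> A(2)] by blast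
  have finB: "finite B" using independent_span_bound[OF T(1) B(3)] B(2) T(2) by auto
  have fsum: "f (\<Sum>w\<in>C. scale (c w) w) = (\<Sum>w\<in>C. scale (c w) (f w)) \<and> (\<Sum>w\<in>C. scale (c w) w) \<in> W"
    if "finite C" "C \<subseteq> W" for C c
    using that
  proof (induction C rule: finite_induct)
    case empty then show ?case using f0 W by (simp add: subspace_0)
  next
    case (insert x F)
    then show ?case using W by (auto simp: add sc subspace_scale subspace_add)
  qed
  define C where "C = B - A"
  have C: "finite C" "C \<subseteq> W" using finB B(2) by (auto simp: C_def)
  define r where "r = representation B"
  have rK: "r x w = 0" if "x \<in> K" "w \<in> C" for x w
  proof -
    have "x \<in> span A" using A(3) that by blast
    then have "r x = representation A x" unfolding r_def using representation_extend[OF B(3) _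
        B(1)] by blast
    then show ?thesis using representation_ne_zero[of A x w] that(2) by (auto simp: C_def)
  qed
  have rC: "r (\<Sum>w\<in>C. scale (c w) w) v = c v" if "v \<in> C" for c v
  proof -
    have "r (\<Sum>w\<in>C. scale (c w) w) v = (\<Sum>w\<in>C. r (scale (c w) w) v)"
      unfolding r_def by (subst representation_sum[OF B(3)]) (auto simp: C_def intro: span_scale
          span_base)
    also have "\<dots> = (\<Sum>w\<in>C. if w = v then c v else 0)"
      by (intro sum.cong refl)
        (auto simp: r_def C_def representation_scale[OF B(3)] representation_basis[OF B(3)]
            span_base)
    finally show ?thesis using that C(1) by simp
  qed
  have zero: "c v = 0" if "(\<Sum>w\<in>C. scale (c w) (f w)) = 0" "v \<in> C" for c v
  proof -
    have "(\<Sum>w\<in>C. scale (c w) w) \<in> K" using fsum[OF C, of c] that(1) by (simp add: K_def)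
    then show ?thesis using rK[OF _ that(2)] rC[OF that(2), of c] by simp
  qed
  have inj: "inj_on f C"
  proof (rule inj_onI, rule ccontr)
    fix x y assume xy: "x \<in> C" "y \<in> C" "f x = f y" "x \<noteq> y"
    \<comment> \<open>A collision would give the linear relation \<open>f x - f y = 0\<close>, which
      \<open>zero\<close> excludes.\<close>
    define c where "c = (\<lambda>w. if w = x then 1 else if w = y then -1 else 0 :: 'a)"
    have "(\<Sum>w\<in>C. scale (c w) (f w)) = (\<Sum>w\<in>{x, y}. scale (c w) (f w))"
      using C(1) xy by (intro sum.mono_neutral_right) (auto simp: c_def)
    also have "\<dots> = 0" using xy by (simp add: c_def)
    finally have "c x = 0" using zero xy(1) by blast
    then show False by (simp add: c_def)
  qed
  have "independent (f ` C)"
  proof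
    assume "dependent (f ` C)"
    then obtain u v where u: "v \<in> f ` C" "u v \<noteq> 0" "(\<Sum>v\<in>f ` C. scale (u v) v) = 0"
      using dependent_finite[of "f ` C"] C(1) by auto
    have "(\<Sum>w\<in>C. scale (u (f w)) (f w)) = 0" using u(3) inj by (simp add: sum.reindex)
    then show False using zero[of "\<lambda>w. u (f w)"] u(1,2) by auto
  qed
  moreover have "f ` W \<subseteq> span (f ` C)"
  proof
    fix y assume "y \<in> f ` W"
    then obtain x where x: "x \<in> W" "y = f x" by auto
    have xs: "x = (\<Sum>w\<in>B. scale (r x w) w)"
      unfolding r_def using B(3,4) x(1) finB by (subst sum_representation_eq) auto
    have "y = (\<Sum>w\<in>B. scale (r x w) (f w))"
      using fsum[OF finB B(2), of "r x"] xs x(2) by simp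
    also have "\<dots> = (\<Sum>w\<in>C. scale (r x w) (f w))"
      using finB A(1) by (intro sum.mono_neutral_right) (auto simp: C_def K_def)
    also have "\<dots> \<in> span (f ` C)" by (intro span_sum span_scale span_base imageI)
    finally show "y \<in> span (f ` C)" .
  qed
  moreover have "f ` C \<subseteq> f ` W" using C(2) by blast
  ultimately have "dim (f ` W) = card (f ` C)" using dim_unique by metis
  then have "dim (f ` W) = card C" using card_image[OF inj] by simp
  moreover have "dim W = card B" using dim_unique[OF B(2) B(4) B(3)] by simp
  moreover have "card B = card A + card C"
    unfolding C_def using finB B(1) by (simp add: card_Diff_subset finite_subset card_mono)
  ultimately show ?thesis using A(4) K_def by simp
qed

end

subsection \<open>The Laplacian on polynomials\<close>

lemma laplacian_in_polys: "P \<in> polys k \<Longrightarrow> laplacian P \<in> polys (k - 2)"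
proof -
  assume "P \<in> polys k"
  then have "partial_deriv i (partial_deriv i P) \<in> polys (k - 1 - 1)" for i
    by (intro partial_deriv_in_polys)
  then show ?thesis
    unfolding laplacian_def[abs_def] by (intro polys_sum) (simp add: numeral_2_eq_2)
qed

lemma laplacian_add:
  assumes "P \<in> polys k" "Q \<in> polys k"
  shows "laplacian (\<lambda>z. P z + Q z) = (\<lambda>z. laplacian P z + laplacian Q z)"
proof -
  have "partial_deriv i (\<lambda>z. P z + Q z) = (\<lambda>z. partial_deriv i P z + partial_deriv i Q z)" for i
    using assms by (intro ext partial_deriv_add differentiable_polys)
  moreover have "partial_deriv i (\<lambda>z. partial_deriv i P z + partial_deriv i Q z) z
     = partial_deriv i (partial_deriv i P) z + partial_deriv i (partial_deriv i Q) z" for i z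
    by (intro partial_deriv_add differentiable_polys[OF partial_deriv_in_polys[OF assms(1)]]
        differentiable_polys[OF partial_deriv_in_polys[OF assms(2)]])
  ultimately show ?thesis by (intro ext) (simp add: laplacian_def sum.distrib)
qed

lemma laplacian_scale:
  assumes "P \<in> polys k"
  shows "laplacian (\<lambda>z. c * P z) = (\<lambda>z. c * laplacian P z)"
proof -
  have "partial_deriv i (\<lambda>z. c * P z) = (\<lambda>z. c * partial_deriv i P z)" for i
    using assms by (intro ext partial_deriv_scale differentiable_polys)
  moreover have "partial_deriv i (\<lambda>z. c * partial_deriv i P z) z
     = c * partial_deriv i (partial_deriv i P) z" for i z
    by (intro partial_deriv_scale differentiable_polys[OF partial_deriv_in_polys[OF assms]])
  ultimately show ?thesis by (intro ext) (simp add: laplacian_def sum_distrib_left)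
qed

lemma laplacian_zero [simp]: "laplacian (\<lambda>z. 0) = (\<lambda>z. 0)"
  by (simp add: laplacian_def fun_eq_iff)

lemma laplacian_sum:
  assumes "\<And>i. i \<in> I \<Longrightarrow> P i \<in> polys k"
  shows "laplacian (\<lambda>z. \<Sum>i\<in>I. P i z) = (\<lambda>z. \<Sum>i\<in>I. laplacian (P i) z)"
  using assms
  by (induction I rule: infinite_finite_induct) (simp_all add: laplacian_add[where k = k] polys_sum)

lemma partial_deriv_substitute:
  assumes "P \<in> polys k"
  shows "partial_deriv i (substitute A P) z = (\<Sum>j\<in>UNIV. complex_of_real (A $ j $ i) * substitute A
      (partial_deriv j P) z)"
proof -
  obtain D where D: "(P has_derivative D) (at (A *v z))"
    using differentiable_polys[OF assms] by (auto simp: differentiable_def)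
  have "((\<lambda>z. A *v z) has_derivative (\<lambda>z. A *v z)) (at z)"
    by (rule bounded_linear_imp_has_derivative) simp
  then have "((\<lambda>z. P (A *v z)) has_derivative (\<lambda>v. D (A *v v))) (at z)"
    by (rule has_derivative_compose) (use D in simp)
  then have "partial_deriv i (\<lambda>z. P (A *v z)) z = D (A *v axis i 1)" by (rule partial_deriv_eq)
  moreover have "A *v axis i 1 = (\<Sum>j\<in>UNIV. (A $ j $ i) *\<^sub>R axis j 1)"
    unfolding matrix_vector_mult_basis
    by (simp add: vec_eq_iff column_def axis_def if_distrib[of "\<lambda>x. _ * x"] cong: if_cong)
  moreover have lin: "linear D" using D by (rule has_derivative_linear)
  ultimately have "partial_deriv i (\<lambda>z. P (A *v z)) z = (\<Sum>j\<in>UNIV. (A $ j $ i) *\<^sub>R D (axis j 1))"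
    by (simp add: linear_sum linear_scale)
  moreover have "substitute A P = (\<lambda>z. P (A *v z))" by (simp add: fun_eq_iff substitute_def)
  ultimately show ?thesis
    by (simp add: substitute_def partial_deriv_eq[OF D] scaleR_conv_of_real)
qed

text \<open>Two applications of the chain rule give second derivatives weighted by the entries of
  \<open>A ** transpose A\<close>, which is the identity matrix.\<close>

lemma laplacian_substitute:
  assumes P: "P \<in> polys k" and A: "orthogonal_matrix A"
  shows "laplacian (substitute A P) = substitute A (laplacian P)"
proof
  fix z
  have pd: "partial_deriv j P \<in> polys (k - 1)" for j using P by (rule partial_deriv_in_polys)
  have "partial_deriv i (partial_deriv i (substitute A P)) z
      = (\<Sum>j\<in>UNIV. \<Sum>l\<in>UNIV. complex_of_real (A $ j $ i * A $ l $ i) * substitute A (partial_deriv l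
          (partial_deriv j P)) z)" for i
  proof -
    have "partial_deriv i (substitute A P) = (\<lambda>z. \<Sum>j\<in>UNIV. complex_of_real (A $ j $ i) *
        substitute A (partial_deriv j P) z)"
      using partial_deriv_substitute[OF P] by blast
    then have "partial_deriv i (partial_deriv i (substitute A P)) z
        = (\<Sum>j\<in>UNIV. complex_of_real (A $ j $ i) * partial_deriv i (substitute A (partial_deriv j
            P)) z)"
      by (simp add: partial_deriv_sum partial_deriv_scale differentiable_polys[OF
          substitute_in_polys[OF pd]]
          differentiable_polys[OF polys_scale[OF substitute_in_polys[OF pd]]])
    then show ?thesis
      by (simp add: partial_deriv_substitute[OF pd] sum_distrib_left mult.assoc)
  qed
  then have "laplacian (substitute A P) z = (\<Sum>i\<in>UNIV. \<Sum>j\<in>UNIV. \<Sum>l\<in>UNIV. complex_of_real (A $ j $ i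
      * A $ l $ i) * substitute A (partial_deriv l (partial_deriv j P)) z)"
    by (simp add: laplacian_def)
  also have "\<dots> = (\<Sum>j\<in>UNIV. \<Sum>i\<in>UNIV. \<Sum>l\<in>UNIV. complex_of_real (A $ j $ i * A $ l $ i) * substitute
      A (partial_deriv l (partial_deriv j P)) z)"
    by (rule sum.swap)
  also have "\<dots> = (\<Sum>j\<in>UNIV. \<Sum>l\<in>UNIV. \<Sum>i\<in>UNIV. complex_of_real (A $ j $ i * A $ l $ i) * substitute
      A (partial_deriv l (partial_deriv j P)) z)"
    by (intro sum.cong refl sum.swap)
  also have "\<dots> = (\<Sum>j\<in>UNIV. \<Sum>l\<in>UNIV. complex_of_real ((A ** transpose A) $ j $ l) * substitute A
      (partial_deriv l (partial_deriv j P)) z)"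
    by (simp add: matrix_matrix_mult_def transpose_def sum_distrib_right)
  also have "\<dots> = (\<Sum>j\<in>UNIV. substitute A (partial_deriv j (partial_deriv j P)) z)"
    using A by (simp add: orthogonal_matrix_def mat_def if_distrib[of complex_of_real]
        if_distrib[of "\<lambda>x. x * _"] cong: if_cong)
  finally show "laplacian (substitute A P) z = substitute A (laplacian P) z"
    by (simp add: laplacian_def substitute_def)
qed

lemma laplacian_monomial:
  "laplacian (monomial m) z = (\<Sum>i\<in>UNIV. of_nat (m i * (m i - 1)) * monomial (m(i := m i - 2)) z)"
proof -
  have "partial_deriv i (partial_deriv i (monomial m)) z = of_nat (m i * (m i - 1)) * monomial
      (m(i := m i - 2)) z" for i
  proof -
    have "partial_deriv i (\<lambda>z. of_nat (m i) * monomial (m(i := m i - 1)) z) z = of_nat (m i) *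
        partial_deriv i (monomial (m(i := m i - 1))) z"
      by (rule partial_deriv_scale[OF differentiable_monomial])
    also have "\<dots> = of_nat (m i * (m i - 1)) * monomial (m(i := m i - 2)) z"
      by (simp add: partial_deriv_monomial numeral_2_eq_2)
    finally show ?thesis unfolding partial_deriv_monomial[of i m] .
  qed
  then show ?thesis by (simp add: laplacian_def)
qed

text \<open>
  Solve \<open>\<Delta>P = z\<^sup>m\<close> by integrating twice in one fixed variable \<open>z\<^sub>i\<close>: the error terms have higher
  degree in \<open>z\<^sub>i\<close>, hence the induction on \<open>k - m\<^sub>i\<close>.
\<close>

lemma laplacian_onto_monomials:
  fixes m :: "'n::finite \<Rightarrow> nat"
  assumes "m \<in> exponents k"
  shows "\<exists>P \<in> polys (Suc (Suc k)). laplacian P = monomial m"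
proof -
  \<comment> \<open>Any fixed variable serves for the integration; \<open>undefined\<close> merely
    names one.\<close>
  define i :: 'n where "i = undefined"
  show ?thesis
    using assms
  proof (induction "k - m i" arbitrary: m rule: less_induct)
    case less
    define n where "n = m(i := Suc (Suc (m i)))"
    have n: "n \<in> exponents (Suc (Suc k))"
      using exponents_Suc[of "m(i := Suc (m i))" i "Suc k"] exponents_Suc[of m i k] less.prems by
          (simp add: n_def)
    have "\<exists>P \<in> polys (Suc (Suc k)). laplacian P = (\<lambda>z. of_nat (n j * (n j - 1)) * monomial (n(j :=
        n j - 2)) z)"
      if j: "j \<noteq> i" for j
    proof (cases "n j \<ge> 2")
      case False
      then have e: "n j * (n j - 1) = 0" by auto
      show ?thesis
        unfolding e by (rule bexI[of _ "\<lambda>z. 0"]) simp_all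
    next
      case True
      define n' where "n' = n(j := n j - 2)"
      have "n' = (n(j := n j - 1))(j := (n(j := n j - 1)) j - 1)" by (auto simp: n'_def fun_eq_iff)
      then have n': "n' \<in> exponents k"
        using exponents_pred[of n j "Suc k"] exponents_pred[of "n(j := n j - 1)" j k] n True by simp
      have "n' i \<le> k" using n' member_le_sum[of i UNIV n'] by (auto simp: exponents_def)
      moreover have "n' i = Suc (Suc (m i))" using j by (simp add: n'_def n_def)
      ultimately have "k - n' i < k - m i" by simp
      then obtain P where "P \<in> polys (Suc (Suc k))" "laplacian P = monomial n'" using less.hyps n'
          by blast
      then show ?thesis
        by (intro bexI[of _ "\<lambda>z. of_nat (n j * (n j - 1)) * P z"]) (simp_all add: laplacian_scale
            polys_scale n'_def)
    qed
    then obtain Q where Q: "\<And>j. j \<noteq> i \<Longrightarrow> Q j \<in> polys (Suc (Suc k))"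
      "\<And>j. j \<noteq> i \<Longrightarrow> laplacian (Q j) = (\<lambda>z. of_nat (n j * (n j - 1)) * monomial (n(j := n j - 2)) z)"
      by metis
    define R where "R = (\<lambda>z. \<Sum>j\<in>UNIV-{i}. Q j z)"
    have R: "R \<in> polys (Suc (Suc k))" unfolding R_def using Q(1) by (intro polys_sum) auto
    have lapR: "laplacian R z = (\<Sum>j\<in>UNIV-{i}. of_nat (n j * (n j - 1)) * monomial (n(j := n j -
        2)) z)" for z
      unfolding R_def using Q by (subst laplacian_sum[where k = "Suc (Suc k)"]) (auto intro!:
          sum.cong)
    define c :: complex where "c = of_nat (n i * (n i - 1))"
    have "c \<noteq> 0" by (simp add: c_def n_def del: of_nat_Suc of_nat_mult)
    have ni: "n(i := n i - 2) = m" by (simp add: n_def fun_eq_iff)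
    define P where "P = (\<lambda>z. (1 / c) * (monomial n z + (-1) * R z))"
    have "P \<in> polys (Suc (Suc k))"
      unfolding P_def by (intro polys_scale polys_add monomial_in_polys n R)
    moreover have "laplacian P = monomial m"
    proof
      fix z
      have "laplacian P z = (1 / c) * (laplacian (monomial n) z + (-1) * laplacian R z)"
        unfolding P_def
        by (simp only: laplacian_scale[OF polys_add[OF monomial_in_polys[OF n] polys_scale[OF R]]]
            laplacian_add[OF monomial_in_polys[OF n] polys_scale[OF R]] laplacian_scale[OF R])
      also have "laplacian (monomial n) z = c * monomial m z + laplacian R z"
        unfolding laplacian_monomial lapR c_def by (subst sum.remove[of _ i]) (auto simp: ni)
      finally show "laplacian P z = monomial m z" using \<open>c \<noteq> 0\<close> by simp
    qed
    ultimately show ?case by blast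
  qed
qed

lemma laplacian_onto:
  fixes Q :: "real^'n \<Rightarrow> complex"
  assumes "Q \<in> polys k"
  shows "\<exists>P \<in> polys (Suc (Suc k)). laplacian P = Q"
proof -
  obtain c where Q: "Q = (\<lambda>z. \<Sum>m\<in>exponents k. c m * monomial m z)" using assms by (elim polysE)
  obtain P :: "('n \<Rightarrow> nat) \<Rightarrow> real^'n \<Rightarrow> complex" where P: "\<And>m. m \<in> exponents k \<Longrightarrow> P m \<in> polys (Suc
      (Suc k))"
    "\<And>m. m \<in> exponents k \<Longrightarrow> laplacian (P m) = monomial m"
    using laplacian_onto_monomials by metis
  have "laplacian (\<lambda>z. \<Sum>m\<in>exponents k. c m * P m z) = (\<lambda>z. \<Sum>m\<in>exponents k. laplacian (\<lambda>z. c m * P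
      m z) z)"
    by (rule laplacian_sum) (rule polys_scale[OF P(1)])
  also have "\<dots> = Q" unfolding Q using P by (auto simp: laplacian_scale[OF P(1)] intro!: sum.cong)
  finally show ?thesis using P(1) by (intro bexI[of _ "\<lambda>z. \<Sum>m\<in>exponents k. c m * P m z"] polys_sum
      polys_scale) auto
qed

subsection \<open>Averaging over a finite group\<close>

lemma group_orthogonal_group: "Group.group (orthogonal_group :: (real^'n^'n) monoid)"
proof (rule groupI)
  fix a :: "real^'n^'n" assume "a \<in> carrier orthogonal_group"
  then show "\<exists>b\<in>carrier orthogonal_group. b \<otimes>\<^bsub>orthogonal_group\<^esub> a = \<one>\<^bsub>orthogonal_group\<^esub>"
    by (intro bexI[of _ "transpose a"]) (auto simp: orthogonal_group_def
        orthogonal_matrix_transpose orthogonal_matrix_def)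
qed (auto simp: orthogonal_group_def orthogonal_matrix_mul orthogonal_matrix_id matrix_mul_assoc)

lemma inv_orthogonal_group:
  "orthogonal_matrix a \<Longrightarrow> inv\<^bsub>orthogonal_group\<^esub> a = transpose a"
  by (rule group.inv_equality[OF group_orthogonal_group])
    (auto simp: orthogonal_group_def orthogonal_matrix_transpose orthogonal_matrix_def)

lemma finite_orthogonal_subgroup_facts:
  assumes "finite_orthogonal_subgroup \<Gamma>"
  shows "finite \<Gamma>" and "mat 1 \<in> \<Gamma>" and "\<And>a b. a \<in> \<Gamma> \<Longrightarrow> b \<in> \<Gamma> \<Longrightarrow> a ** b \<in> \<Gamma>"
    and "\<And>a. a \<in> \<Gamma> \<Longrightarrow> orthogonal_matrix a" and "\<And>a. a \<in> \<Gamma> \<Longrightarrow> transpose a \<in> \<Gamma>"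
proof -
  have sg: "subgroup \<Gamma> orthogonal_group" and "finite \<Gamma>" using assms by (auto simp:
      finite_orthogonal_subgroup_def)
  show "finite \<Gamma>" by fact
  show "mat 1 \<in> \<Gamma>" using subgroup.one_closed[OF sg] by (simp add: orthogonal_group_def)
  show mult: "a ** b \<in> \<Gamma>" if "a \<in> \<Gamma>" "b \<in> \<Gamma>" for a b
    using subgroup.m_closed[OF sg that] by (simp add: orthogonal_group_def)
  show orth: "orthogonal_matrix a" if "a \<in> \<Gamma>" for a
    using subgroup.subset[OF sg] that by (auto simp: orthogonal_group_def)
  show "transpose a \<in> \<Gamma>" if a: "a \<in> \<Gamma>" for a
    using subgroup.m_inv_closed[OF sg a] orth[OF a] by (simp add: inv_orthogonal_group)
qed

lemma finite_orthogonal_subgroupI: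
  assumes "finite \<Gamma>" and "mat 1 \<in> \<Gamma>" and "\<And>a b. a \<in> \<Gamma> \<Longrightarrow> b \<in> \<Gamma> \<Longrightarrow> a ** b \<in> \<Gamma>"
    and orth: "\<And>a. a \<in> \<Gamma> \<Longrightarrow> orthogonal_matrix a" and tr: "\<And>a. a \<in> \<Gamma> \<Longrightarrow> transpose a \<in> \<Gamma>"
  shows "finite_orthogonal_subgroup \<Gamma>"
proof -
  have "subgroup \<Gamma> orthogonal_group"
    using assms by unfold_locales (auto simp: inv_orthogonal_group, auto simp: orthogonal_group_def)
  then show ?thesis using assms(1) by (simp add: finite_orthogonal_subgroup_def)
qed

lemma matrix_inv_orthogonal: "orthogonal_matrix a \<Longrightarrow> matrix_inv a = transpose (a :: real^'n^'n)"
  unfolding matrix_inv_def orthogonal_matrix_def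
  by (rule some_equality) (simp, metis matrix_mul_assoc matrix_mul_lid matrix_mul_rid)

lemma act_orthogonal: "orthogonal_matrix a \<Longrightarrow> act a P = substitute (transpose a) P"
  by (simp add: act_def substitute_def fun_eq_iff matrix_inv_orthogonal)

lemma act_act: "orthogonal_matrix a \<Longrightarrow> orthogonal_matrix b \<Longrightarrow> act a (act b P) = act (a ** b) P"
  by (simp add: act_orthogonal orthogonal_matrix_mul substitute_def fun_eq_iff
      matrix_transpose_mul matrix_vector_mul_assoc)

lemma act_in_polys: "orthogonal_matrix a \<Longrightarrow> P \<in> polys k \<Longrightarrow> act a P \<in> polys k"
  by (simp add: act_orthogonal substitute_in_polys)

definition invariant_polys :: "(real^'n^'n) set \<Rightarrow> nat \<Rightarrow> (real^'n \<Rightarrow> complex) set" where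
  "invariant_polys \<Gamma> k = {P \<in> polys k. \<forall>a\<in>\<Gamma>. act a P = P}"

text \<open>The Reynolds operator of \<open>\<Gamma>\<close>.\<close>

definition average :: "(real^'n^'n) set \<Rightarrow> (real^'n \<Rightarrow> complex) \<Rightarrow> real^'n \<Rightarrow> complex" where
  "average \<Gamma> P z = 1 / of_nat (card \<Gamma>) * (\<Sum>a\<in>\<Gamma>. act a P z)"

lemma bij_betw_left_mult:
  assumes "finite \<Gamma>" "b \<in> \<Gamma>" "orthogonal_matrix b" "\<And>a. a \<in> \<Gamma> \<Longrightarrow> b ** a \<in> \<Gamma>"
  shows "bij_betw (\<lambda>a. b ** a) \<Gamma> (\<Gamma> :: (real^'n^'n) set)"
proof -
  have "inj_on (\<lambda>a. b ** a) \<Gamma>"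
  proof (rule inj_onI)
    fix x y assume "b ** x = b ** y"
    then have "(transpose b ** b) ** x = (transpose b ** b) ** y"
      by (simp flip: matrix_mul_assoc)
    then show "x = y" using assms by (simp add: orthogonal_matrix_def)
  qed
  moreover have "(\<lambda>a. b ** a) ` \<Gamma> \<subseteq> \<Gamma>" using assms by auto
  ultimately show ?thesis
    using assms(1) by (simp add: bij_betw_def endo_inj_surj)
qed

context
  fixes \<Gamma> :: "(real^'n^'n) set"
  assumes \<Gamma>: "finite_orthogonal_subgroup \<Gamma>"
begin

private lemmas averaging_facts = finite_orthogonal_subgroup_facts[OF \<Gamma>]

lemma card_pos: "card \<Gamma> > 0"
  using averaging_facts(1,2) by (auto simp: card_gt_0_iff)

lemma average_in_polys: "P \<in> polys k \<Longrightarrow> average \<Gamma> P \<in> polys k"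
  unfolding average_def[abs_def] by (intro polys_scale polys_sum act_in_polys averaging_facts(4))

lemma average_invariant: "b \<in> \<Gamma> \<Longrightarrow> act b (average \<Gamma> P) = average \<Gamma> P"
proof
  fix z assume b: "b \<in> \<Gamma>"
  have "act b (average \<Gamma> P) z = 1 / of_nat (card \<Gamma>) * (\<Sum>a\<in>\<Gamma>. act b (act a P) z)"
    by (simp add: act_def average_def)
  also have "(\<Sum>a\<in>\<Gamma>. act b (act a P) z) = (\<Sum>a\<in>\<Gamma>. act (b ** a) P z)"
    using b by (intro sum.cong) (simp_all add: act_act averaging_facts(4))
  also have "\<dots> = (\<Sum>a\<in>\<Gamma>. act a P z)"
    using bij_betw_left_mult[OF averaging_facts(1) b averaging_facts(4)[OF b]
        averaging_facts(3)[OF b]] by (rule sum.reindex_bij_betw)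
  finally show "act b (average \<Gamma> P) z = average \<Gamma> P z" unfolding average_def[of \<Gamma> P z] .
qed

lemma average_in_invariant_polys: "P \<in> polys k \<Longrightarrow> average \<Gamma> P \<in> invariant_polys \<Gamma> k"
  by (simp add: invariant_polys_def average_in_polys average_invariant)

lemma average_id: "P \<in> invariant_polys \<Gamma> k \<Longrightarrow> average \<Gamma> P = P"
  using card_pos by (simp add: invariant_polys_def average_def fun_eq_iff)

lemma laplacian_act: "P \<in> polys k \<Longrightarrow> a \<in> \<Gamma> \<Longrightarrow> laplacian (act a P) = act a (laplacian P)"
  by (simp add: act_orthogonal averaging_facts(4) laplacian_substitute orthogonal_matrix_transpose)

text \<open>Averaging commutes with the Laplacian and fixes invariants, so averaging any polynomial
  preimage of an invariant gives an invariant preimage.\<close>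

lemma laplacian_image: "laplacian ` invariant_polys \<Gamma> (Suc (Suc k)) = invariant_polys \<Gamma> k"
proof (intro equalityI subsetI)
  fix Q assume "Q \<in> laplacian ` invariant_polys \<Gamma> (Suc (Suc k))"
  then obtain P where P: "P \<in> polys (Suc (Suc k))" "\<And>a. a \<in> \<Gamma> \<Longrightarrow> act a P = P" "Q = laplacian P"
    by (auto simp: invariant_polys_def)
  then have "act a Q = Q" if "a \<in> \<Gamma>" for a using laplacian_act[OF P(1) that] that by simp
  then show "Q \<in> invariant_polys \<Gamma> k"
    using laplacian_in_polys[OF P(1)] P(3) by (simp add: invariant_polys_def)
next
  fix Q assume Q: "Q \<in> invariant_polys \<Gamma> k"
  then have "Q \<in> polys k" by (simp add: invariant_polys_def)
  then obtain P where P: "P \<in> polys (Suc (Suc k))" "laplacian P = Q"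
    using laplacian_onto by blast
  have "laplacian (average \<Gamma> P) = average \<Gamma> Q"
  proof -
    have aP: "act a P \<in> polys (Suc (Suc k))" if "a \<in> \<Gamma>" for a using act_in_polys[OF
        averaging_facts(4)[OF that] P(1)] .
    have "laplacian (average \<Gamma> P) = (\<lambda>z. 1 / of_nat (card \<Gamma>) * laplacian (\<lambda>z. \<Sum>a\<in>\<Gamma>. act a P z) z)"
      unfolding average_def[abs_def] by (rule laplacian_scale) (rule polys_sum[OF aP])
    also have "laplacian (\<lambda>z. \<Sum>a\<in>\<Gamma>. act a P z) = (\<lambda>z. \<Sum>a\<in>\<Gamma>. laplacian (act a P) z)"
      by (rule laplacian_sum) (rule aP)
    finally have L: "laplacian (average \<Gamma> P) = (\<lambda>z. 1 / of_nat (card \<Gamma>) * (\<Sum>a\<in>\<Gamma>. laplacian (act a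
        P) z))" .
    show ?thesis unfolding L by (rule ext) (simp add: average_def laplacian_act[OF P(1)] P(2))
  qed
  then show "Q \<in> laplacian ` invariant_polys \<Gamma> (Suc (Suc k))"
    using average_id[OF Q] average_in_invariant_polys[OF P(1)] by (metis imageI)
qed

end

subsection \<open>Dimensions\<close>

interpretation cfun: vector_space "\<lambda>(c::complex) f (z::'a). c * f z"
  by unfold_locales (auto simp: fun_eq_iff algebra_simps)

lemma sum_fun_eq: "(\<Sum>i\<in>I. f i) = (\<lambda>z. \<Sum>i\<in>I. (f i z :: complex))"
  by (induction I rule: infinite_finite_induct) (auto simp: fun_eq_iff)

lemma pcoeff_linear:
  assumes "B \<subseteq> polys k" "m \<in> exponents k"
  shows "pcoeff k (\<Sum>P\<in>B. (\<lambda>z. c P * P z)) m = (\<Sum>P\<in>B. c P * pcoeff k P m)"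
proof -
  have "pcoeff k (\<lambda>z. \<Sum>P\<in>B. c P * P z) m = (\<Sum>P\<in>B. pcoeff k (\<lambda>z. c P * P z) m)"
    using assms by (intro pcoeff_sum polys_scale) auto
  also have "\<dots> = (\<Sum>P\<in>B. c P * pcoeff k P m)"
    using assms by (intro sum.cong refl pcoeff_scale) auto
  finally show ?thesis by (simp add: sum_fun_eq)
qed

lemma trace_mpow_transpose: "trace (mpow (transpose A) j) = trace (mpow A j)"
proof -
  have "mpow (transpose A) j = transpose (mpow A j)"
  proof (induction j)
    case (Suc j)
    then show ?case using mpow_Suc_right[of A j] by (simp add: matrix_transpose_mul)
  qed simp
  then show ?thesis by (simp add: trace_def transpose_def)
qed

lemma subspace_invariant_polys: "cfun.subspace (invariant_polys \<Gamma> k)"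
  unfolding cfun.subspace_def invariant_polys_def
  by (auto simp: act_def fun_eq_iff plus_fun_def zero_fun_def polys_add polys_scale)

lemma polys_subset_span: "polys k \<subseteq> cfun.span (monomial ` exponents k)"
proof
  fix P :: "real^'n \<Rightarrow> complex" assume "P \<in> polys k"
  then obtain c where "P = (\<lambda>z. \<Sum>m\<in>exponents k. c m * monomial m z)" by (elim polysE)
  then have P: "P = (\<Sum>m\<in>exponents k. (\<lambda>z. c m * monomial m z))" by (simp add: sum_fun_eq)
  show "P \<in> cfun.span (monomial ` exponents k)"
    unfolding P by (intro cfun.span_sum cfun.span_scale cfun.span_base imageI)
qed

text \<open>Molien's formula, one coefficient at a time: the dimension is the trace of the Reynolds
  projection, hence the mean of the traces of the group elements on degree \<open>k\<close>.\<close>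

lemma dim_invariant_polys:
  fixes \<Gamma> :: "(real^'n^'n) set"
  assumes \<Gamma>: "finite_orthogonal_subgroup \<Gamma>"
  shows "real (complex_dim (invariant_polys \<Gamma> k))
    = (\<Sum>a\<in>\<Gamma>. complete_symmetric (\<lambda>j. trace (mpow a j)) k) / real (card \<Gamma>)"
proof -
  note G = finite_orthogonal_subgroup_facts[OF \<Gamma>]
  have "(\<Sum>m\<in>exponents k. pcoeff k (average \<Gamma> (monomial m)) m) = of_nat (cfun.dim (invariant_polys
      \<Gamma> k))"
  proof (rule cfun.trace_of_projection[where \<kappa> = "\<lambda>m P. pcoeff k P m" and b = monomial and R =
      "average \<Gamma>"])
    show "cfun.subspace (invariant_polys \<Gamma> k)" by (rule subspace_invariant_polys)
    show "average \<Gamma> (monomial m) \<in> invariant_polys \<Gamma> k" if "m \<in> exponents k" for m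
      using that by (intro average_in_invariant_polys[OF \<Gamma>]) auto
    fix P assume P: "P \<in> invariant_polys \<Gamma> k"
    then have P': "P \<in> polys k" by (simp add: invariant_polys_def)
    show "P = (\<Sum>m\<in>exponents k. (\<lambda>z. pcoeff k P m * monomial m z))"
      using poly_expand[OF P'] by (simp add: sum_fun_eq)
    have "average \<Gamma> P z = (\<Sum>m\<in>exponents k. pcoeff k P m * average \<Gamma> (monomial m) z)" for z
    proof -
      have "act a P z = (\<Sum>m\<in>exponents k. pcoeff k P m * act a (monomial m) z)" for a
        unfolding act_def by (rule fun_cong[OF poly_expand[OF P']])
      then have "average \<Gamma> P z = 1 / of_nat (card \<Gamma>) * (\<Sum>a\<in>\<Gamma>. \<Sum>m\<in>exponents k. pcoeff k P m * act a
          (monomial m) z)"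
        by (simp add: average_def)
      also have "\<dots> = (\<Sum>m\<in>exponents k. \<Sum>a\<in>\<Gamma>. 1 / of_nat (card \<Gamma>) * (pcoeff k P m * act a (monomial
          m) z))"
        by (subst sum.swap) (simp add: sum_distrib_left)
      also have "\<dots> = (\<Sum>m\<in>exponents k. pcoeff k P m * average \<Gamma> (monomial m) z)"
        by (simp add: average_def sum_distrib_left mult_ac)
      finally show ?thesis .
    qed
    then show "P = (\<Sum>m\<in>exponents k. (\<lambda>z. pcoeff k P m * average \<Gamma> (monomial m) z))"
      using average_id[OF \<Gamma> P] by (simp add: sum_fun_eq fun_eq_iff)
  next
    fix m :: "'n \<Rightarrow> nat" and c and B :: "(real^'n \<Rightarrow> complex) set" assume "m \<in> exponents k" "B \<subseteq>
        invariant_polys \<Gamma> k"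
    then show "pcoeff k (\<Sum>w\<in>B. (\<lambda>z. c w * w z)) m = (\<Sum>w\<in>B. c w * pcoeff k w m)"
      by (intro pcoeff_linear) (auto simp: invariant_polys_def)
  qed auto
  moreover have "(\<Sum>m\<in>exponents k. pcoeff k (average \<Gamma> (monomial m)) m) = op_trace k (average \<Gamma>)"
    by (simp add: op_trace_def)
  moreover have "op_trace k (average \<Gamma>) = 1 / of_nat (card \<Gamma>) * (\<Sum>a\<in>\<Gamma>. op_trace k (act a))"
  proof -
    have "op_trace k (\<lambda>P z. \<Sum>a\<in>\<Gamma>. act a P z) = (\<Sum>a\<in>\<Gamma>. op_trace k (act a))"
      by (rule op_trace_sum) (intro act_in_polys G(4) monomial_in_polys)
    moreover have "op_trace k (\<lambda>P z. 1 / of_nat (card \<Gamma>) * (\<Sum>a\<in>\<Gamma>. act a P z))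
        = 1 / of_nat (card \<Gamma>) * op_trace k (\<lambda>P z. \<Sum>a\<in>\<Gamma>. act a P z)"
      by (rule op_trace_scale) (intro polys_sum act_in_polys G(4) monomial_in_polys)
    ultimately show ?thesis unfolding average_def[abs_def] by simp
  qed
  moreover have "op_trace k (act a) = complex_of_real (complete_symmetric (\<lambda>j. trace (mpow a j))
      k)" if "a \<in> \<Gamma>" for a
  proof -
    \<comment> \<open>The action of \<open>a\<close> is substitution by its inverse, that is its
      transpose, whose powers have the same traces.\<close>
    have "op_trace k (act a) = op_trace k (substitute (transpose a))"
      using that by (intro op_trace_cong) (simp add: act_orthogonal G(4))
    then show ?thesis by (simp add: op_trace_substitute trace_mpow_transpose)
  qed
  ultimately have "complex_of_real (real (cfun.dim (invariant_polys \<Gamma> k)))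
      = complex_of_real ((\<Sum>a\<in>\<Gamma>. complete_symmetric (\<lambda>j. trace (mpow a j)) k) / real (card \<Gamma>))"
    by simp
  then show ?thesis unfolding complex_dim_def of_real_eq_iff .
qed

text \<open>The Fischer decomposition for invariants: the harmonic ones are the kernel of the
  Laplacian, which by \<open>laplacian_image\<close> maps onto the invariants two degrees
  lower.\<close>

lemma dim_invariant_polys_Suc_Suc:
  assumes \<Gamma>: "finite_orthogonal_subgroup \<Gamma>"
  shows "complex_dim (invariant_polys \<Gamma> (Suc (Suc k)))
    = complex_dim (invariant_harmonics \<Gamma> (Suc (Suc k))) + complex_dim (invariant_polys \<Gamma> k)"
proof -
  let ?W = "invariant_polys \<Gamma> (Suc (Suc k))"
  have W: "P \<in> polys (Suc (Suc k))" if "P \<in> ?W" for P using that by (simp add: invariant_polys_def)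
  have "cfun.dim ?W = cfun.dim {P \<in> ?W. laplacian P = 0} + cfun.dim (laplacian ` ?W)"
  proof (rule cfun.dim_kernel_plus_dim_image)
    show "cfun.subspace ?W" by (rule subspace_invariant_polys)
    show "?W \<subseteq> cfun.span (monomial ` exponents (Suc (Suc k)))"
      using W polys_subset_span by blast
    show "laplacian (P + Q) = laplacian P + laplacian Q" if "P \<in> ?W" "Q \<in> ?W" for P Q
      using laplacian_add[OF W[OF that(1)] W[OF that(2)]] by (simp add: plus_fun_def)
    show "laplacian (\<lambda>z. c * P z) = (\<lambda>z. c * laplacian P z)" if "P \<in> ?W" for c P
      using laplacian_scale[OF W[OF that]] .
  qed auto
  moreover have "{P \<in> ?W. laplacian P = 0} = invariant_harmonics \<Gamma> (Suc (Suc k))"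
    by (auto simp: invariant_polys_def invariant_harmonics_def harmonic_polynomials_def polys_def
        fun_eq_iff)
  ultimately show ?thesis using laplacian_image[OF \<Gamma>] by (simp add: complex_dim_def)
qed

lemma laplacian_low_degree:
  assumes "P \<in> polys k" "k < 2"
  shows "laplacian P z = 0"
proof -
  obtain c where P: "P = (\<lambda>z. \<Sum>m\<in>exponents k. c m * monomial m z)" using assms(1) by (elim polysE)
  have "laplacian (monomial m) z = 0" if "m \<in> exponents k" for m
  proof -
    have m: "m i < 2" for i using that assms(2) member_le_sum[of i UNIV m] by (auto simp:
        exponents_def)
    have "m i * (m i - 1) = 0" for i using m[of i] by (cases "m i") auto
    then show ?thesis unfolding laplacian_monomial by (metis (no_types, lifting) mult_zero_left
        of_nat_0 sum.neutral)
  qed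
  moreover have "laplacian P = (\<lambda>z. \<Sum>m\<in>exponents k. laplacian (\<lambda>z. c m * monomial m z) z)"
    unfolding P by (rule laplacian_sum) (auto intro: polys_scale)
  ultimately show ?thesis by (simp add: laplacian_scale[OF monomial_in_polys])
qed

text \<open>The starting values of the two-step recursion between harmonic invariants and all
  invariants.\<close>

lemma invariant_harmonilow_degree_simps_degree: "k < 2 \<Longrightarrow> invariant_harmonics \<Gamma> k = invariant_polys
    \<Gamma> k"
  by (auto simp: invariant_polys_def invariant_harmonics_def harmonic_polynomials_def
      laplacian_low_degree)
    (auto simp: polys_def laplacian_low_degree)

section \<open>Isospectrality as equality of Molien coefficients\<close>

lemma isospectral_iff_harmonics:
  fixes \<Gamma> \<Gamma>' :: "(real^'n^'n) set"
  assumes "CARD('n) \<ge> 2"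
  shows "isospectral \<Gamma> \<Gamma>' \<longleftrightarrow>
    (\<forall>k. complex_dim (invariant_harmonics \<Gamma> k) = complex_dim (invariant_harmonics \<Gamma>' k))"
proof -
  \<comment> \<open>For \<open>CARD('n) = 1\<close> the degrees 0 and 1 would share the eigenvalue
    0; from \<open>CARD('n) = 2\<close> on the eigenvalue determines the degree.\<close>
  have inj: "inj (sphere_eigenvalue TYPE('n))"
  proof (rule linorder_injI)
    fix j k :: nat assume "j < k"
    have "real j * (real j + (real CARD('n) - 2)) \<le> real j * (real k + (real CARD('n) - 2))"
      using \<open>j < k\<close> by (intro mult_left_mono) auto
    also have "\<dots> < real k * (real k + (real CARD('n) - 2))"
      using \<open>j < k\<close> assms by (intro mult_strict_right_mono) auto
    finally show "sphere_eigenvalue TYPE('n) j \<noteq> sphere_eigenvalue TYPE('n) k"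
      by (simp add: sphere_eigenvalue_def algebra_simps)
  qed
  have set: "{k. sphere_eigenvalue TYPE('n) k = sphere_eigenvalue TYPE('n) j} = {j}" for j
    using inj by (auto dest: injD)
  have spec: "orbifold_spectrum \<Delta> (sphere_eigenvalue TYPE('n) k) = complex_dim
      (invariant_harmonics \<Delta> k)"
    for \<Delta> :: "(real^'n^'n) set" and k
    by (simp add: orbifold_spectrum_def set)
  show ?thesis
  proof
    assume "isospectral \<Gamma> \<Gamma>'"
    then show "\<forall>k. complex_dim (invariant_harmonics \<Gamma> k) = complex_dim (invariant_harmonics \<Gamma>' k)"
      using spec by (metis isospectral_def)
  next
    assume "\<forall>k. complex_dim (invariant_harmonics \<Gamma> k) = complex_dim (invariant_harmonics \<Gamma>' k)"
    then show "isospectral \<Gamma> \<Gamma>'" by (simp add: isospectral_def orbifold_spectrum_def fun_eq_iff)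
  qed
qed

text \<open>The dimensions of all invariants and of the harmonic ones determine each other by steps
  of two in the degree, so the spectrum carries exactly the coefficients of the Molien
  series.\<close>

theorem isospectral_iff_complete_symmetric:
  fixes \<Gamma> \<Gamma>' :: "(real^'n^'n) set"
  assumes "CARD('n) \<ge> 2" and \<Gamma>: "finite_orthogonal_subgroup \<Gamma>" and \<Gamma>': "finite_orthogonal_subgroup
      \<Gamma>'"
  shows "isospectral \<Gamma> \<Gamma>' \<longleftrightarrow>
    (\<forall>k. (\<Sum>a\<in>\<Gamma>. complete_symmetric (\<lambda>j. trace (mpow a j)) k) / real (card \<Gamma>)
       = (\<Sum>a\<in>\<Gamma>'. complete_symmetric (\<lambda>j. trace (mpow a j)) k) / real (card \<Gamma>'))"
proof -
  have "(\<forall>k. complex_dim (invariant_harmonics \<Gamma> k) = complex_dim (invariant_harmonics \<Gamma>' k)) \<longleftrightarrow>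
     (\<forall>k. complex_dim (invariant_polys \<Gamma> k) = complex_dim (invariant_polys \<Gamma>' k))"
  proof
    assume H: "\<forall>k. complex_dim (invariant_harmonics \<Gamma> k) = complex_dim (invariant_harmonics \<Gamma>' k)"
    show "\<forall>k. complex_dim (invariant_polys \<Gamma> k) = complex_dim (invariant_polys \<Gamma>' k)"
    proof
      fix k show "complex_dim (invariant_polys \<Gamma> k) = complex_dim (invariant_polys \<Gamma>' k)"
      proof (induction k rule: induct_nat_012)
        case (ge2 n)
        then show ?case
          using H by (simp add: dim_invariant_polys_Suc_Suc[OF \<Gamma>] dim_invariant_polys_Suc_Suc[OF
              \<Gamma>'])
      qed (use H invariant_harmonilow_degree_simps_degree in \<open>metis less_2_cases_iff One_nat_def\<close>)+
    qed
  next
    assume P: "\<forall>k. complex_dim (invariant_polys \<Gamma> k) = complex_dim (invariant_polys \<Gamma>' k)"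
    show "\<forall>k. complex_dim (invariant_harmonics \<Gamma> k) = complex_dim (invariant_harmonics \<Gamma>' k)"
    proof
      fix k
      show "complex_dim (invariant_harmonics \<Gamma> k) = complex_dim (invariant_harmonics \<Gamma>' k)"
      proof (cases "k < 2")
        case True
        then show ?thesis using P by (simp add: invariant_harmonilow_degree_simps_degree)
      next
        case False
        then obtain n where "k = Suc (Suc n)" by (metis less_2_cases_iff One_nat_def
            old.nat.exhaust)
        then show ?thesis
          using P dim_invariant_polys_Suc_Suc[OF \<Gamma>] dim_invariant_polys_Suc_Suc[OF \<Gamma>']
          by (metis add_right_cancel)
      qed
    qed
  qed
  also have "\<dots> \<longleftrightarrow> (\<forall>k. real (complex_dim (invariant_polys \<Gamma> k)) = real (complex_dim
      (invariant_polys \<Gamma>' k)))"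
    by simp
  finally show ?thesis
    unfolding isospectral_iff_harmonics[OF assms(1)] dim_invariant_polys[OF \<Gamma>]
        dim_invariant_polys[OF \<Gamma>'] .
qed

subsection \<open>Rigidity of local isometries of the sphere\<close>

text \<open>Derivatives of norm at most 1 make \<open>F\<close> 1-Lipschitz on a ball, and the
  inverse has orthogonal derivatives too, so it is 1-Lipschitz on a ball around \<open>F x\<close>.
  The two bounds together give equality of distances.\<close>

lemma locally_isometric_if_orthogonal_derivative:
  fixes F :: "'a::euclidean_space \<Rightarrow> 'a"
  assumes C: "open C" "x \<in> C" and inj: "inj_on F C"
    and der: "\<And>z. z \<in> C \<Longrightarrow> \<exists>L. orthogonal_transformation L \<and> (F has_derivative L) (at z)"
  shows "\<exists>r>0. ball x r \<subseteq> C \<and> (\<forall>y\<in>ball x r. \<forall>z\<in>ball x r. norm (F y - F z) = norm (y - z))"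
proof -
  obtain F' where F': "\<And>z. z \<in> C \<Longrightarrow> orthogonal_transformation (F' z)" "\<And>z. z \<in> C \<Longrightarrow> (F
      has_derivative F' z) (at z)"
    using der by metis
  have onorm: "onorm L \<le> 1" if "orthogonal_transformation L" for L :: "'a \<Rightarrow> 'a"
    using that by (intro onorm_le) (simp add: orthogonal_transformation)
  obtain r0 where r0: "r0 > 0" "ball x r0 \<subseteq> C" using C openE by blast
  define S where "S = ball x r0"
  have SC: "z \<in> C" if "z \<in> S" for z using r0 that by (auto simp: S_def)
  have lip: "norm (F y - F z) \<le> norm (y - z)" if "y \<in> S" "z \<in> S" for y z
  proof -
    have "norm (F y - F z) \<le> 1 * norm (y - z)"
      by (rule differentiable_bound[where S = S and f' = F'])
        (use that SC F' onorm in \<open>auto simp: S_def intro: has_derivative_at_withinI\<close>)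
    then show ?thesis by simp
  qed
  have cont: "continuous_on S F"
    using F'(2) SC by (meson continuous_at_imp_continuous_on has_derivative_continuous)
  have injS: "inj_on F S" using inj SC by (meson inj_on_subset subsetI)
  \<comment> \<open>The derivative is only known pointwise, not to vary continuously, so openness of
    the image comes from invariance of domain rather than from the inverse function theorem.\<close>
  have "open (F ` S)" using cont injS by (intro invariance_of_domain) (auto simp: S_def)
  moreover have "F x \<in> F ` S" using r0 by (auto simp: S_def)
  ultimately obtain s where s: "s > 0" "ball (F x) s \<subseteq> F ` S" using openE by blast
  define G where "G = inv_into S F"
  have GF: "G (F z) = z" if "z \<in> S" for z using that injS by (simp add: G_def)
  have Gder: "(G has_derivative inv_into UNIV (F' (G w))) (at w)" "orthogonal_transformation
      (inv_into UNIV (F' (G w)))" if w: "w \<in> F ` S" for w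
  proof -
    obtain z where z: "z \<in> S" "w = F z" using w by auto
    have ot: "orthogonal_transformation (F' z)" using F'(1) SC z by blast
    have "F' z \<circ> inv_into UNIV (F' z) = id"
      using orthogonal_transformation_surj[OF ot] by (simp add: surj_iff)
    then have "(G has_derivative inv_into UNIV (F' z)) (at (F z))"
      by (intro has_derivative_inverse_strong[of S z F G "F' z"])
        (use cont z GF F'(2) SC in \<open>auto simp: S_def\<close>)
    then show "(G has_derivative inv_into UNIV (F' (G w))) (at w)" using z GF by simp
    show "orthogonal_transformation (inv_into UNIV (F' (G w)))"
      using ot z GF by (simp add: orthogonal_transformation_inv)
  qed
  have Glip: "norm (G v - G w) \<le> norm (v - w)" if "v \<in> ball (F x) s" "w \<in> ball (F x) s" for v w
  proof -
    have "norm (G v - G w) \<le> 1 * norm (v - w)"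
      by (rule differentiable_bound[where S = "ball (F x) s" and f' = "\<lambda>w. inv_into UNIV (F' (G
          w))"])
        (use that in \<open>simp_all add: has_derivative_at_withinI[OF Gder(1)[OF subsetD[OF s(2)]]]
            onorm[OF Gder(2)[OF subsetD[OF s(2)]]] del: mem_ball\<close>)
    then show ?thesis by simp
  qed
  \<comment> \<open>Since \<open>F\<close> is 1-Lipschitz, points within \<open>s\<close> of
    \<open>x\<close> have their images in the ball on which the inverse is 1-Lipschitz.\<close>
  define r where "r = min r0 s"
  have rS: "z \<in> S" "F z \<in> ball (F x) s" if "z \<in> ball x r" for z
  proof -
    show zS: "z \<in> S" using that by (simp add: r_def S_def)
    have "x \<in> S" using r0 by (simp add: S_def)
    then show "F z \<in> ball (F x) s" using lip[of x z] zS that by (simp add: r_def dist_norm)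
  qed
  show ?thesis
  proof (intro exI[of _ r] conjI ballI)
    show "r > 0" using r0 s by (simp add: r_def)
    show "ball x r \<subseteq> C" using rS(1) SC by blast
    fix y z assume yz: "y \<in> ball x r" "z \<in> ball x r"
    show "norm (F y - F z) = norm (y - z)"
      using lip[OF rS(1)[OF yz(1)] rS(1)[OF yz(2)]] Glip[OF rS(2)[OF yz(1)] rS(2)[OF yz(2)]]
        GF[OF rS(1)[OF yz(1)]] GF[OF rS(1)[OF yz(2)]] by simp
  qed
qed

lemma has_derivative_normalize:
  fixes z :: "'a::real_inner"
  assumes "z \<noteq> 0"
  shows "((\<lambda>z. z /\<^sub>R norm z) has_derivative (\<lambda>h. (h - (h \<bullet> (z /\<^sub>R norm z)) *\<^sub>R (z /\<^sub>R norm z)) /\<^sub>R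
      norm z)) (at z)"
proof -
  have "((\<lambda>z. z /\<^sub>R norm z) has_derivative
     (\<lambda>h. (- (inverse (norm z) * (h \<bullet> sgn z) * inverse (norm z))) *\<^sub>R z + h /\<^sub>R norm z)) (at z)"
    using assms by (auto intro!: derivative_eq_intros has_derivative_norm simp: fun_eq_iff)
  then show ?thesis
    by (rule has_derivative_eq_rhs) (simp add: fun_eq_iff sgn_div_norm algebra_simps)
qed

text \<open>
  The radial extension \<open>z \<mapsto> |z| f (z / |z|)\<close> of a local isometry of the sphere has orthogonal
  derivatives, hence is locally an isometry of Euclidean space, and it is homogeneous.
\<close>

proposition riemannian_isometry_locally_linear:
  fixes f :: "real^'n \<Rightarrow> real^'n"
  assumes iso: "riemannian_isometry U V f" and x: "x \<in> U"
  shows "\<exists>A r. orthogonal_matrix A \<and> r > 0 \<and> sphere 0 1 \<inter> ball x r \<subseteq> U \<and>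
    (\<forall>u\<in>sphere 0 1 \<inter> ball x r. f u = A *v u)"
proof -
  obtain W where W: "open W" "U = sphere 0 1 \<inter> W"
    using iso unfolding riemannian_isometry_def openin_open by blast
  have bij: "bij_betw f U V" and V: "V \<subseteq> sphere 0 1"
    using iso by (auto simp: riemannian_isometry_def dest: openin_imp_subset)
  have fU: "norm (f u) = 1" if "u \<in> U" for u using bij V that by (auto simp: bij_betw_def)
  define N where "N = (\<lambda>z::real^'n. z /\<^sub>R norm z)"
  define C where "C = {z. z \<noteq> 0 \<and> N z \<in> W}"
  have "C = (- {0}) \<inter> N -` W" by (auto simp: C_def)
  moreover have "continuous_on (- {0}) N" unfolding N_def by (intro continuous_intros) auto
  ultimately have openC: "open C" using W(1) by (simp add: continuous_on_open_vimage open_Compl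
      Int_commute)
  have NU: "N z \<in> U" if "z \<in> C" for z using that W(2) by (auto simp: C_def N_def)
  have N1: "norm (N z) = 1" if "z \<in> C" for z using NU[OF that] W(2) by auto
  have zN: "norm z *\<^sub>R N z = z" for z by (cases "z = 0") (auto simp: N_def)
  have UC: "U \<subseteq> C" "\<And>u. u \<in> U \<Longrightarrow> N u = u" using W(2) by (auto simp: C_def N_def)
  define F where "F = (\<lambda>z. norm z *\<^sub>R f (N z))"
  have normF: "norm (F z) = norm z" if "z \<in> C" for z using fU[OF NU[OF that]] by (simp add: F_def)
  have injF: "inj_on F C"
  proof (rule inj_onI)
    fix y z assume yz: "y \<in> C" "z \<in> C" "F y = F z"
    then have n: "norm y = norm z" using normF by metis
    moreover have "norm z \<noteq> 0" using yz(2) by (simp add: C_def)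
    ultimately have "f (N y) = f (N z)" using yz(3) by (simp add: F_def)
    then have "N y = N z" using bij NU yz(1,2) by (meson bij_betw_imp_inj_on inj_onD)
    then show "y = z" using zN n by metis
  qed
  have der: "\<exists>L. orthogonal_transformation L \<and> (F has_derivative L) (at z)" if z: "z \<in> C" for z
  proof -
    define u where "u = N z"
    have u: "u \<in> U" "norm u = 1" "norm (f u) = 1" using NU[OF z] N1[OF z] fU by (auto simp: u_def)
    have z0: "z \<noteq> 0" using z by (simp add: C_def)
    obtain D where D: "(f has_derivative D) (at u within U)"
      "\<And>v w. u \<bullet> v = 0 \<Longrightarrow> u \<bullet> w = 0 \<Longrightarrow> D v \<bullet> D w = v \<bullet> w"
      using iso u(1) unfolding riemannian_isometry_def by metis
    have linD: "linear D" using D(1) by (rule has_derivative_linear)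
    define n' where "n' = (\<lambda>h. (h - (h \<bullet> u) *\<^sub>R u) /\<^sub>R norm z)"
    have Nd: "(N has_derivative n') (at z within C)"
      using has_derivative_normalize[OF z0] unfolding N_def n'_def u_def
      by (rule has_derivative_at_withinI)
    have "(f has_derivative D) (at (N z) within N ` C)"
      using D(1) NU unfolding u_def by (auto intro: has_derivative_subset)
    from has_derivative_in_compose[OF Nd this]
    have fN: "((\<lambda>z. f (N z)) has_derivative (\<lambda>h. D (n' h))) (at z)"
      using at_within_open[OF z openC] by simp
    \<comment> \<open>The derivative of the radial extension: \<open>D\<close> on the tangential
      part of \<open>h\<close>, and \<open>u\<close> goes to \<open>f u\<close>.\<close>
    define L where "L = (\<lambda>h. D (h - (h \<bullet> u) *\<^sub>R u) + (h \<bullet> u) *\<^sub>R f u)"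
    have "(F has_derivative (\<lambda>h. norm z *\<^sub>R D (n' h) + (h \<bullet> sgn z) *\<^sub>R f (N z))) (at z)"
      unfolding F_def by (rule has_derivative_scaleR[OF has_derivative_norm[OF z0] fN])
    moreover have "norm z *\<^sub>R D (n' h) = D (h - (h \<bullet> u) *\<^sub>R u)" for h
      using z0 by (simp add: n'_def linear_scale[OF linD])
    moreover have "sgn z = u" by (simp add: u_def N_def sgn_div_norm)
    ultimately have FL: "(F has_derivative L) (at z)" unfolding L_def u_def by simp
    then have linL: "linear L" by (rule has_derivative_linear)
    \<comment> \<open>Differentiating \<open>|F z|^2 = |z|^2\<close> gives
      \<open>f u \<bullet> L h = u \<bullet> h\<close>, so \<open>D\<close> sends tangent vectors at
      \<open>u\<close> to vectors orthogonal to \<open>f u\<close>.\<close>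
    have "((\<lambda>z. F z \<bullet> F z) has_derivative (\<lambda>h. F z \<bullet> L h + L h \<bullet> F z)) (at z)"
      by (rule has_derivative_inner[OF FL FL])
    moreover have "((\<lambda>z. F z \<bullet> F z) has_derivative (\<lambda>h. z \<bullet> h + h \<bullet> z)) (at z)"
    proof (rule has_derivative_transform_within_open)
      show "((\<lambda>z. z \<bullet> z) has_derivative (\<lambda>h. z \<bullet> h + h \<bullet> z)) (at z)"
        by (rule has_derivative_inner) (rule has_derivative_ident)+
      show "y \<bullet> y = F y \<bullet> F y" if "y \<in> C" for y using normF[OF that] by (metis power2_norm_eq_inner)
    qed (use z openC in auto)
    ultimately have "(\<lambda>h. F z \<bullet> L h + L h \<bullet> F z) = (\<lambda>h. z \<bullet> h + h \<bullet> z)" by (rule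
        has_derivative_unique)
    then have "F z \<bullet> L h = z \<bullet> h" for h by (simp add: fun_eq_iff inner_commute)
    then have "norm z * (f u \<bullet> L h) = norm z * (u \<bullet> h)" for h
      using zN[of z] by (metis F_def inner_scaleR_left u_def)
    then have fL: "f u \<bullet> L h = u \<bullet> h" for h using z0 by simp
    have "norm (L h) = norm h" for h
    proof -
      define w where "w = h - (h \<bullet> u) *\<^sub>R u"
      have uu: "u \<bullet> u = 1" "f u \<bullet> f u = 1" using u by (simp_all flip: power2_norm_eq_inner)
      have wu: "u \<bullet> w = 0" by (simp add: w_def inner_diff_right uu inner_commute)
      have "L w = D w" using wu by (simp add: L_def inner_commute)
      then have fD: "f u \<bullet> D w = 0" using fL[of w] wu by simp
      have "L h \<bullet> L h = D w \<bullet> D w + (h \<bullet> u)\<^sup>2"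
        by (simp add: L_def w_def[symmetric] inner_add_left inner_add_right inner_commute
            fD[unfolded inner_commute[of "f u"]] fD uu power2_eq_square)
      also have "D w \<bullet> D w = w \<bullet> w" using D(2) wu by simp
      also have "w \<bullet> w + (h \<bullet> u)\<^sup>2 = h \<bullet> h"
        by (simp add: w_def inner_diff_left inner_diff_right uu inner_commute power2_eq_square)
      finally show ?thesis by (simp add: norm_eq_sqrt_inner)
    qed
    then have "orthogonal_transformation L" using linL by (simp add: orthogonal_transformation)
    then show ?thesis using FL by blast
  qed
  have xC: "x \<in> C" using x UC by blast
  obtain r where r: "r > 0" "ball x r \<subseteq> C" and
    dist: "\<And>y z. y \<in> ball x r \<Longrightarrow> z \<in> ball x r \<Longrightarrow> norm (F y - F z) = norm (y - z)"
    using locally_isometric_if_orthogonal_derivative[OF openC xC injF der] by blast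
  \<comment> \<open>Norms and distances are both preserved, hence so are inner products.\<close>
  have inner: "F y \<bullet> F z = y \<bullet> z" if "y \<in> ball x r" "z \<in> ball x r" for y z
    using dist[OF that] normF r(2) that by (auto simp: dot_norm_neg subset_iff)
  obtain L where L: "orthogonal_transformation L" "(F has_derivative L) (at x)" using der[OF xC]
      by blast
  have FzL: "F z = L z" if z: "z \<in> ball x r" for z
  proof -
    \<comment> \<open>Differentiate \<open>F z \<bullet> F y = z \<bullet> y\<close> in
      \<open>y\<close> at \<open>x\<close>. As \<open>L\<close> is orthogonal, this forces
      \<open>F z = L z\<close>.\<close>
    have "F z \<bullet> L v = z \<bullet> v" for v
    proof -
      have "((\<lambda>y. F z \<bullet> F y) has_derivative (\<lambda>v. F z \<bullet> L v)) (at x)"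
        by (rule has_derivative_inner_right[OF L(2)])
      moreover have "((\<lambda>y. F z \<bullet> F y) has_derivative (\<lambda>v. z \<bullet> v)) (at x)"
      proof (rule has_derivative_transform_within_open)
        show "((\<lambda>y. z \<bullet> y) has_derivative (\<lambda>v. z \<bullet> v)) (at x)"
          by (rule has_derivative_inner_right) (rule has_derivative_ident)
        show "z \<bullet> y = F z \<bullet> F y" if "y \<in> ball x r" for y using inner[OF z that] by simp
      qed (use r in auto)
      ultimately have "(\<lambda>v. F z \<bullet> L v) = (\<lambda>v. z \<bullet> v)" by (rule has_derivative_unique)
      then show ?thesis by (rule fun_cong)
    qed
    then have "F z \<bullet> L v = L z \<bullet> L v" for v using L(1) by (simp add: orthogonal_transformation_def)
    moreover have "surj L" using L(1) by (rule orthogonal_transformation_surj)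
    ultimately have "F z \<bullet> w = L z \<bullet> w" for w by (metis surjD)
    then show ?thesis by (metis vector_eq_rdot)
  qed
  have linL: "linear L" using L(1) by (simp add: orthogonal_transformation_def)
  have "orthogonal_matrix (matrix L)" using L(1) by (simp add: orthogonal_transformation_matrix)
  moreover have sub: "sphere 0 1 \<inter> ball x r \<subseteq> U"
  proof
    fix u assume u: "u \<in> sphere 0 1 \<inter> ball x r"
    then have "u \<in> C" using r by auto
    moreover have "N u = u" using u by (simp add: N_def)
    ultimately show "u \<in> U" using NU by force
  qed
  moreover have "f u = matrix L *v u" if "u \<in> sphere 0 1 \<inter> ball x r" for u
  proof -
    have "F u = f u" using UC(2)[of u] sub that by (auto simp: F_def)
    then show ?thesis using FzL[of u] that by (simp add: fun_cong[OF matrix_vector_mul(2)[OF linL]])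
  qed
  ultimately show ?thesis using r(1) by blast
qed

text \<open>Near \<open>x\<close> the isometry lifts to a linear \<open>A\<close>, and
  \<open>A *v (a *v u)\<close> lies in the \<open>\<Gamma>'\<close>-orbit of \<open>A *v u\<close>,
  with an element \<open>b\<close> that may depend on \<open>u\<close>. Finitely many proper
  subspaces cannot cover an open set, so one \<open>b\<close> works for all
  \<open>u\<close>.\<close>

lemma isotropy_conjugate:
  fixes \<Gamma> \<Gamma>' :: "(real^'n^'n) set"
  assumes \<Gamma>: "finite_orthogonal_subgroup \<Gamma>" and \<Gamma>': "finite_orthogonal_subgroup \<Gamma>'"
    and iso: "orbifold_isometry \<Gamma> \<Gamma>' \<phi>" and x: "x \<in> sphere 0 1"
  shows "\<exists>A. orthogonal_matrix A \<and> (\<forall>a\<in>\<Gamma>. a *v x = x \<longrightarrow> (\<exists>b\<in>\<Gamma>'. A ** a = b ** A))"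
proof -
  note G = finite_orthogonal_subgroup_facts[OF \<Gamma>] and G' = finite_orthogonal_subgroup_facts[OF \<Gamma>']
  obtain U V f where U: "x \<in> U" "riemannian_isometry U V f" "\<And>u. u \<in> U \<Longrightarrow> \<phi> (orbit \<Gamma> u) = orbit \<Gamma>'
      (f u)"
    using iso x unfolding orbifold_isometry_def by metis
  obtain A r where A: "orthogonal_matrix A" "r > 0" "sphere 0 1 \<inter> ball x r \<subseteq> U"
    "\<And>u. u \<in> sphere 0 1 \<inter> ball x r \<Longrightarrow> f u = A *v u"
    using riemannian_isometry_locally_linear[OF U(2,1)] by metis
  have "\<exists>b\<in>\<Gamma>'. A ** a = b ** A" if a: "a \<in> \<Gamma>" "a *v x = x" for a
  proof (rule ccontr)
    assume neg: "\<not> (\<exists>b\<in>\<Gamma>'. A ** a = b ** A)"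
    \<comment> \<open>The subspace on which \<open>A ** a\<close> and \<open>b ** A\<close> agree;
      under the assumption \<open>neg\<close> it is proper for every \<open>b\<close> in
      \<open>\<Gamma>'\<close>.\<close>
    define S where "S = (\<lambda>b. {z. (A ** a - b ** A) *v z = 0})"
    have "negligible (S b)" if b: "b \<in> \<Gamma>'" for b
    proof (rule negligible_lowdim)
      have "S b \<noteq> UNIV"
      proof
        assume "S b = UNIV"
        then have "(A ** a - b ** A) *v z = 0 *v z" for z by (auto simp: S_def)
        then have "A ** a - b ** A = 0" by (subst matrix_eq) auto
        then show False using neg b by auto
      qed
      moreover have "subspace (S b)" unfolding S_def
        by (auto simp: subspace_def matrix_vector_right_distrib matrix_vector_mult_scaleR)
      ultimately have "dim (S b) \<noteq> DIM(real^'n)" using dim_eq_full[of "S b"] by (metis span_eq_iff)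
      then show "dim (S b) < DIM(real^'n)" using dim_subset_UNIV[of "S b"] by simp
    qed
    then have negl: "negligible (\<Union>b\<in>\<Gamma>'. S b)" using G'(1) by (intro negligible_Union) auto
    have "S b = {z. A *v (a *v z) = b *v (A *v z)}" for b
      by (simp add: S_def matrix_vector_mult_diff_rdistrib matrix_vector_mul_assoc)
    then have Sb: "z \<in> S b \<longleftrightarrow> A *v (a *v z) = b *v (A *v z)" for z b by simp
    have sph: "\<exists>b\<in>\<Gamma>'. u \<in> S b" if u: "u \<in> sphere 0 1 \<inter> ball x r" for u
    proof -
      have "a *v u \<in> sphere 0 1" using u G(4)[OF a(1)] by simp
      \<comment> \<open>As \<open>a\<close> fixes \<open>x\<close>, it maps the patch around
        \<open>x\<close> to itself, so \<open>f\<close> is given by \<open>A\<close> at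
        \<open>a *v u\<close> as well.\<close>
      moreover have "dist x (a *v u) = dist x u"
      proof -
        have "dist x (a *v u) = norm (a *v x - a *v u)" using a(2) by (simp add: dist_norm)
        also have "\<dots> = norm (a *v (x - u))" by (simp add: matrix_vector_mult_diff_distrib)
        finally show ?thesis using G(4)[OF a(1)] by (simp add: dist_norm)
      qed
      ultimately have au: "a *v u \<in> sphere 0 1 \<inter> ball x r" using u by simp
      have "orbit \<Gamma> (a *v u) = orbit \<Gamma> u"
      proof -
        have "orbit \<Gamma> (b *v v) \<subseteq> orbit \<Gamma> v" if "b \<in> \<Gamma>" for b v
          using G(3) that by (auto simp: orbit_def matrix_vector_mul_assoc)
        from this[OF a(1), of u] this[OF G(5)[OF a(1)], of "a *v u"] show ?thesis
          using G(4)[OF a(1)] by (auto simp: orthogonal_matrix_cancel)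
      qed
      then have "orbit \<Gamma>' (A *v (a *v u)) = orbit \<Gamma>' (A *v u)"
        using U(3) A(3,4) u au by (metis subsetD)
      moreover have "A *v (a *v u) \<in> orbit \<Gamma>' (A *v (a *v u))"
        using G'(2) by (auto simp: orbit_def intro!: image_eqI[of _ _ "mat 1"])
      ultimately show ?thesis by (auto simp: orbit_def Sb)
    qed
    \<comment> \<open>The \<open>S b\<close> are closed under scaling, so covering a patch of the
      sphere means covering an open ball of the ambient space.\<close>
    define N where "N = (\<lambda>z::real^'n. z /\<^sub>R norm z)"
    have "open ((- {0}) \<inter> N -` ball x r)"
    proof -
      have "continuous_on (- {0}) N" unfolding N_def by (intro continuous_intros) auto
      then have "open (N -` ball x r \<inter> - {0})" using continuous_on_open_vimage[of "- {0}" N] by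
          (simp add: open_Compl)
      then show ?thesis by (simp only: Int_commute)
    qed
    moreover have "x \<in> (- {0}) \<inter> N -` ball x r" using x A(2) by (auto simp: N_def)
    ultimately obtain e where e: "e > 0" "ball x e \<subseteq> (- {0}) \<inter> N -` ball x r" using openE by blast
    have "ball x e \<subseteq> (\<Union>b\<in>\<Gamma>'. S b)"
    proof
      fix z assume "z \<in> ball x e"
      then have z: "z \<noteq> 0" "N z \<in> ball x r" using e(2) by auto
      then have "N z \<in> sphere 0 1 \<inter> ball x r" by (simp add: N_def)
      then obtain b where b: "b \<in> \<Gamma>'" "N z \<in> S b" using sph by blast
      have "z = norm z *\<^sub>R N z" using z(1) by (simp add: N_def)
      moreover have "norm z *\<^sub>R N z \<in> S b"
        using b(2) by (simp add: S_def matrix_vector_mult_scaleR)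
      ultimately show "z \<in> (\<Union>b\<in>\<Gamma>'. S b)" using b(1) by auto
    qed
    then have "negligible (ball x e)" using negl negligible_subset by blast
    then show False using negligible_convex_interior[of "ball x e"] e(1) by simp
  qed
  then show ?thesis using A(1) by blast
qed

subsection \<open>Asymptotics of Molien series\<close>

definition gen_fun :: "(nat \<Rightarrow> real) \<Rightarrow> real \<Rightarrow> real" where
  "gen_fun p t = (\<Sum>k. complete_symmetric p k * t ^ k)"

lemma complete_symmetric_Suc:
  "real (Suc k) * complete_symmetric p (Suc k) = (\<Sum>j\<le>k. p (Suc j) * complete_symmetric p (k - j))"
  by (simp del: of_nat_Suc)

declare complete_symmetric.simps(2) [simp del]

text \<open>Constant power sums \<open>c\<close> belong to the series of
  \<open>(1 - t) powr (- c)\<close>, and this is the ratio of its consecutive coefficients. It makes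
  the constant sequence an explicit majorant for all sequences bounded by \<open>c\<close>.\<close>

lemma complete_symmetric_const_Suc:
  "real (Suc k) * complete_symmetric (\<lambda>_. c) (Suc k) = (c + real k) * complete_symmetric (\<lambda>_. c) k"
proof (cases k)
  case (Suc n)
  let ?h = "complete_symmetric (\<lambda>_. c)"
  have sum: "(\<Sum>j\<le>k. c * ?h (k - j)) = (\<Sum>j\<le>k. c * ?h j)" for k
    by (rule sum.nat_diff_reindex[of "\<lambda>j. c * ?h j" "Suc k", unfolded lessThan_Suc_atMost,
        simplified])
  have "real (Suc k) * ?h (Suc k) = (\<Sum>j\<le>k. c * ?h j)"
    unfolding complete_symmetric_Suc by (rule sum)
  also have "\<dots> = (\<Sum>j\<le>n. c * ?h j) + c * ?h k" by (simp add: Suc)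
  also have "(\<Sum>j\<le>n. c * ?h j) = real k * ?h k"
    unfolding Suc complete_symmetric_Suc by (rule sum[symmetric])
  finally show ?thesis by (simp add: algebra_simps)
qed (simp add: complete_symmetric.simps(2))

lemma complete_symmetric_const_nonneg: "c \<ge> 0 \<Longrightarrow> complete_symmetric (\<lambda>_. c) k \<ge> 0"
proof (induction k)
  case (Suc k)
  then have "real (Suc k) * complete_symmetric (\<lambda>_. c) (Suc k) \<ge> 0"
    unfolding complete_symmetric_const_Suc by simp
  then show ?case by (simp add: zero_le_mult_iff)
qed simp

lemma abs_complete_symmetric_le:
  assumes "\<And>j. \<bar>p j\<bar> \<le> c"
  shows "\<bar>complete_symmetric p k\<bar> \<le> complete_symmetric (\<lambda>_. c) k"
proof (induction k rule: less_induct)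
  case (less k)
  have c: "c \<ge> 0" using assms[of 0] by linarith
  show ?case
  proof (cases k)
    case (Suc n)
    have "real (Suc n) * \<bar>complete_symmetric p (Suc n)\<bar> = \<bar>real (Suc n) * complete_symmetric p
        (Suc n)\<bar>"
      by (simp add: abs_mult)
    also have "\<dots> \<le> (\<Sum>j\<le>n. \<bar>p (Suc j) * complete_symmetric p (n - j)\<bar>)"
      unfolding complete_symmetric_Suc by (rule sum_abs)
    also have "\<dots> \<le> (\<Sum>j\<le>n. c * complete_symmetric (\<lambda>_. c) (n - j))"
      using less Suc assms c by (intro sum_mono) (auto simp: abs_mult intro!: mult_mono)
    also have "\<dots> = real (Suc n) * complete_symmetric (\<lambda>_. c) (Suc n)"
      by (rule complete_symmetric_Suc[symmetric])
    finally show ?thesis using Suc by (simp del: of_nat_Suc)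
  qed simp
qed

lemma summable_complete_symmetric_const:
  assumes "c \<ge> 0" "0 \<le> t" "t < 1"
  shows "summable (\<lambda>k. complete_symmetric (\<lambda>_. c) k * t ^ k)"
proof -
  \<comment> \<open>The ratios of consecutive terms tend to \<open>t\<close>; \<open>q\<close> is
    the midpoint between \<open>t\<close> and 1, and from index \<open>n\<close> on the ratios stay
    below it.\<close>
  define q where "q = (1 + t) / 2"
  obtain n where n: "real n > (2 * c * t + 2) / (1 - t)" using reals_Archimedean2 by blast
  show ?thesis
  proof (rule summable_ratio_test[of q n])
  show "q < 1" using assms by (simp add: q_def)
  fix k assume "n \<le> k"
  have "(2 * c * t + 2) < real n * (1 - t)" using n assms by (simp add: field_simps)
  also have "\<dots> \<le> real k * (1 - t)" using \<open>n \<le> k\<close> assms by (intro mult_right_mono) auto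
  finally have k: "(c + real k) * t \<le> q * real (Suc k)"
    using assms by (simp add: q_def field_simps)
  have h: "complete_symmetric (\<lambda>_. c) (Suc k) = (c + real k) / real (Suc k) * complete_symmetric
      (\<lambda>_. c) k"
    using complete_symmetric_const_Suc[of k c] by (simp add: field_simps del: of_nat_Suc)
  have "complete_symmetric (\<lambda>_. c) (Suc k) * t ^ Suc k
      = ((c + real k) * t / real (Suc k)) * (complete_symmetric (\<lambda>_. c) k * t ^ k)"
    unfolding h by simp
  also have "\<dots> \<le> q * (complete_symmetric (\<lambda>_. c) k * t ^ k)"
  proof (rule mult_right_mono)
    show "(c + real k) * t / real (Suc k) \<le> q" using k by (simp add: divide_le_eq del: of_nat_Suc)
  qed (use assms complete_symmetric_const_nonneg in auto)
  finally show "norm (complete_symmetric (\<lambda>_. c) (Suc k) * t ^ Suc k) \<le> q * norm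
      (complete_symmetric (\<lambda>_. c) k * t ^ k)"
    using assms complete_symmetric_const_nonneg[of c] by (simp add: abs_mult)
  qed
qed

lemma summable_complete_symmetric:
  assumes p: "\<And>j. \<bar>p j\<bar> \<le> c" and t: "\<bar>t\<bar> < 1"
  shows "summable (\<lambda>k. norm (complete_symmetric p k * t ^ k))"
proof (rule summable_comparison_test')
  show "summable (\<lambda>k. complete_symmetric (\<lambda>_. c) k * \<bar>t\<bar> ^ k)"
    using p[of 0] t by (intro summable_complete_symmetric_const) auto
  show "norm (norm (complete_symmetric p k * t ^ k)) \<le> complete_symmetric (\<lambda>_. c) k * \<bar>t\<bar> ^ k" if
      "k \<ge> 0" for k
    using abs_complete_symmetric_le[OF p, where k = k] by (simp add: abs_mult power_abs
        mult_right_mono)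
qed

text \<open>Newton's recursion read as a differential equation: the logarithmic derivative of the
  series is the power series of the power sums.\<close>

lemma gen_fun_deriv:
  assumes p: "\<And>j. \<bar>p j\<bar> \<le> c" and t: "\<bar>t\<bar> < 1"
  shows "(gen_fun p has_real_derivative gen_fun p t * (\<Sum>j. p (Suc j) * t ^ j)) (at t)"
proof -
  define a where "a = complete_symmetric p"
  have sm: "summable (\<lambda>k. a k * x ^ k)" if "\<bar>x\<bar> < 1" for x
    unfolding a_def using summable_norm_cancel[OF summable_complete_symmetric[OF p that]] .
  have "((\<lambda>x. \<Sum>k. a k * x ^ k) has_real_derivative (\<Sum>k. diffs a k * t ^ k)) (at t)"
    by (rule termdiffs_strong'[of 1]) (use sm t in auto)
  moreover have "(\<Sum>k. diffs a k * t ^ k) = (\<Sum>k. \<Sum>j\<le>k. (p (Suc j) * t ^ j) * (a (k - j) * t ^ (k -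
      j)))"
  proof (rule suminf_cong)
    fix k
    have "diffs a k = (\<Sum>j\<le>k. p (Suc j) * a (k - j))" by (simp add: diffs_def a_def
        complete_symmetric_Suc[symmetric])
    moreover have "t ^ k = t ^ j * t ^ (k - j)" if "j \<le> k" for j using that by (simp flip:
        power_add)
    ultimately show "diffs a k * t ^ k = (\<Sum>j\<le>k. (p (Suc j) * t ^ j) * (a (k - j) * t ^ (k - j)))"
      by (auto simp: sum_distrib_right intro!: sum.cong)
  qed
  moreover have "\<dots> = (\<Sum>j. p (Suc j) * t ^ j) * (\<Sum>k. a k * t ^ k)"
  proof (rule Cauchy_product[symmetric])
    show "summable (\<lambda>k. norm (a k * t ^ k))" unfolding a_def by (rule
        summable_complete_symmetric[OF p t])
    show "summable (\<lambda>j. norm (p (Suc j) * t ^ j))"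
    proof (rule summable_comparison_test')
      show "summable (\<lambda>j. c * \<bar>t\<bar> ^ j)" using t by (intro summable_mult summable_geometric) auto
      show "norm (norm (p (Suc j) * t ^ j)) \<le> c * \<bar>t\<bar> ^ j" if "j \<ge> 0" for j
        using p by (simp add: abs_mult power_abs mult_right_mono)
    qed
  qed
  ultimately show ?thesis unfolding gen_fun_def[abs_def] a_def by (simp add: mult.commute)
qed

definition mean :: "nat \<Rightarrow> (nat \<Rightarrow> real) \<Rightarrow> real" where
  "mean m p = (\<Sum>j<m. p j) / real m"

definition periodic :: "nat \<Rightarrow> (nat \<Rightarrow> real) \<Rightarrow> bool" where
  "periodic m p \<longleftrightarrow> m > 0 \<and> (\<forall>j. p (j + m) = p j)"

lemma periodic_mod: "periodic m p \<Longrightarrow> p (j mod m) = p j"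
proof -
  assume p: "periodic m p"
  have "p (i + k * m) = p i" for i k
  proof (induction k)
    case (Suc k)
    have "i + Suc k * m = (i + k * m) + m" by simp
    then have "p (i + Suc k * m) = p ((i + k * m) + m)" by (rule arg_cong)
    also have "\<dots> = p (i + k * m)" using p unfolding periodic_def by blast
    finally show ?case using Suc by simp
  qed simp
  from this[of "j mod m" "j div m"] show ?thesis by simp
qed

lemma periodic_bounded:
  assumes "periodic m p"
  shows "\<exists>c. \<forall>j. \<bar>p j\<bar> \<le> c"
proof (intro exI allI)
  fix j
  have "\<bar>p (j mod m)\<bar> \<le> (\<Sum>i<m. \<bar>p i\<bar>)"
    by (rule member_le_sum) (use assms in \<open>auto simp: periodic_def\<close>)
  then show "\<bar>p j\<bar> \<le> (\<Sum>i<m. \<bar>p i\<bar>)" using periodic_mod[OF assms] by simp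
qed

text \<open>
  For the eigenvalue power sums \<open>p\<close> of a matrix of order \<open>m\<close>, \<open>mean m p\<close> is the multiplicity of the
  eigenvalue 1, and the generating function is the reciprocal of \<open>det (1 - t A)\<close>.
\<close>

proposition gen_fun_asymptotics:
  assumes p: "periodic m p"
  shows "\<exists>C>0. ((\<lambda>t. (1 - t) powr mean m p * gen_fun p t) \<longlongrightarrow> C) (at_left 1)"
proof -
  have m: "m > 0" and per: "\<And>j. p (j + m) = p j" using p by (auto simp: periodic_def)
  obtain c where c: "\<And>j. \<bar>p j\<bar> \<le> c" using periodic_bounded[OF p] by blast
  define f where "f = mean m p"
  define d where "d = (\<lambda>j. p (Suc j) - f)"
  \<comment> \<open>After subtraction of the mean the sum over one period vanishes, so the numerator
    of \<open>Q t - f / (1 - t)\<close> contains a factor \<open>1 - t\<close>.\<close>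
  have "(\<Sum>j<m. p (Suc j)) = (\<Sum>j<m. p j)"
    using sum.lessThan_Suc_shift[of p m] sum.lessThan_Suc[of p m] per[of 0] by simp
  then have d0: "(\<Sum>j<m. d j) = 0" using m by (simp add: d_def f_def mean_def sum_subtractf)
  \<comment> \<open>The quotient after cancelling \<open>1 - t\<close>. Its denominator is positive
    on \<open>{0..1}\<close>, so it has an antiderivative up to and including the endpoint
    1.\<close>
  define r where "r = (\<lambda>t::real. - (\<Sum>j<m. d j * (\<Sum>i<j. t ^ i)) / (\<Sum>i<m. t ^ i))"
  have den: "(\<Sum>i<m. t ^ i) > 0" if "t \<ge> 0" for t :: real
    using m that by (intro sum_pos2[of _ 0]) auto
  have "continuous_on {0..1} r"
    unfolding r_def by (intro continuous_intros) (use den in force)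
  then obtain R where R: "\<And>t. t \<in> {0..1} \<Longrightarrow> (R has_vector_derivative r t) (at t within {0..1})"
    using antiderivative_continuous by metis
  define Q where "Q = (\<lambda>t. \<Sum>j. p (Suc j) * t ^ j)"
  have Qr: "Q t - f / (1 - t) = r t" if t: "0 \<le> t" "t < 1" for t
  proof -
    have geo: "(1 - t) * (\<Sum>i<j. t ^ i) = 1 - t ^ j" for j using one_diff_power_eq by metis
    have tm: "1 - t ^ m > 0" using t m by (simp add: power_less_one_iff)
    have sum: "summable (\<lambda>j. p (Suc j) * t ^ j)"
    proof (rule summable_comparison_test')
      show "summable (\<lambda>j. c * t ^ j)" using t by (intro summable_mult summable_geometric) auto
      show "norm (p (Suc j) * t ^ j) \<le> c * t ^ j" if "j \<ge> 0" for j
        using c t by (simp add: abs_mult power_abs mult_right_mono)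
    qed
    have "Q t = (\<Sum>j. p (Suc (j + m)) * t ^ (j + m)) + (\<Sum>j<m. p (Suc j) * t ^ j)"
      unfolding Q_def using suminf_split_initial_segment[OF sum, of m] by simp
    also have "(\<Sum>j. p (Suc (j + m)) * t ^ (j + m)) = (\<Sum>j. t ^ m * (p (Suc j) * t ^ j))"
      using per[of "Suc _"] by (simp add: power_add mult_ac)
    also have "\<dots> = t ^ m * Q t" unfolding Q_def by (rule suminf_mult[OF sum])
    finally have Q: "Q t * (1 - t ^ m) = (\<Sum>j<m. p (Suc j) * t ^ j)" by (simp add: algebra_simps)
    have "(Q t - f / (1 - t)) * (1 - t ^ m) = (\<Sum>j<m. p (Suc j) * t ^ j) - f * (\<Sum>j<m. t ^ j)"
    proof -
      have "f / (1 - t) * (1 - t ^ m) = f * (\<Sum>j<m. t ^ j)"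
        unfolding geo[symmetric] using t by simp
      then show ?thesis by (simp only: left_diff_distrib Q)
    qed
    also have "\<dots> = (\<Sum>j<m. d j * t ^ j) - (\<Sum>j<m. d j)"
    proof -
      have "(\<Sum>j<m. d j * t ^ j) = (\<Sum>j<m. p (Suc j) * t ^ j) - f * (\<Sum>j<m. t ^ j)"
        by (simp add: d_def left_diff_distrib sum_subtractf sum_distrib_left)
      then show ?thesis using d0 by simp
    qed
    also have "\<dots> = - (\<Sum>j<m. d j * ((1 - t) * (\<Sum>i<j. t ^ i)))"
      by (simp add: geo right_diff_distrib sum_subtractf)
    also have "\<dots> = r t * (1 - t ^ m)"
    proof -
      have "r t * (\<Sum>i<m. t ^ i) = - (\<Sum>j<m. d j * (\<Sum>i<j. t ^ i))"
        unfolding r_def using den[OF t(1)] by simp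
      then have "(1 - t) * (r t * (\<Sum>i<m. t ^ i)) = (1 - t) * - (\<Sum>j<m. d j * (\<Sum>i<j. t ^ i))" by simp
      then have "r t * (1 - t ^ m) = - ((1 - t) * (\<Sum>j<m. d j * (\<Sum>i<j. t ^ i)))"
        unfolding geo[symmetric] by (simp only: mult.left_commute mult_minus_right)
      then show ?thesis by (simp add: sum_distrib_left mult_ac)
    qed
    finally show ?thesis using tm by simp
  qed
  \<comment> \<open>\<open>H\<close> solves \<open>H' = H r\<close> with \<open>H 0 = 1\<close>, so
    it equals \<open>exp (R t - R 0)\<close> and has a positive limit at 1.\<close>
  define H where "H = (\<lambda>t. (1 - t) powr f * gen_fun p t)"
  have Hd: "(H has_real_derivative H t * r t) (at t)" if t: "0 \<le> t" "t < 1" for t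
  proof -
    have "(H has_real_derivative (1 - t) powr f * (gen_fun p t * Q t) + (f * (1 - t) powr (f - 1)
        * (-1)) * gen_fun p t) (at t)"
      unfolding H_def Q_def using t
      by (auto intro!: derivative_eq_intros gen_fun_deriv[OF c])
    moreover have "(1 - t) powr (f - 1) = (1 - t) powr f / (1 - t)" using t by (simp add: powr_diff)
    ultimately have "(H has_real_derivative H t * (Q t - f / (1 - t))) (at t)"
      by (simp add: H_def algebra_simps)
    then show ?thesis using Qr[OF t] by simp
  qed
  define K where "K = (\<lambda>t. H t * exp (- R t))"
  have Kd: "(K has_real_derivative 0) (at t within {0..<1})" if t: "t \<in> {0..<1}" for t
  proof -
    have "(R has_real_derivative r t) (at t within {0..1})"
      using R[of t] t by (simp add: has_real_derivative_iff_has_vector_derivative)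
    then have Rd: "(R has_real_derivative r t) (at t within {0..<1})"
      by (rule DERIV_subset) auto
    have "(H has_real_derivative H t * r t) (at t within {0..<1})"
      using Hd[of t] t has_field_derivative_at_within by auto
    then have "(K has_real_derivative (H t * r t) * exp (- R t) + exp (- R t) * (- r t) * H t) (at
        t within {0..<1})"
      unfolding K_def by (auto intro!: derivative_eq_intros Rd)
    then show ?thesis by (simp add: algebra_simps)
  qed
  have K: "K t = K 0" if "t \<in> {0..<1}" for t
  proof -
    have "\<exists>c. \<forall>x\<in>{0..<1}. K x = c"
      by (rule has_field_derivative_zero_constant) (use Kd in auto)
    then show ?thesis using that by fastforce
  qed
  have "gen_fun p 0 = 1" unfolding gen_fun_def powser_zero by simp
  then have "H 0 = 1" by (simp add: H_def)
  then have Heq: "H t = exp (R t - R 0)" if "t \<in> {0..<1}" for t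
    using K[OF that] by (simp add: K_def exp_diff exp_minus field_simps)
  have "continuous_on {0..1} R"
    using R by (intro continuous_on_vector_derivative) auto
  then have "(R \<longlongrightarrow> R 1) (at 1 within {0..1})" by (simp add: continuous_on_def)
  then have "(R \<longlongrightarrow> R 1) (at_left 1)" by (simp add: at_within_Icc_at_left)
  then have "((\<lambda>t. exp (R t - R 0)) \<longlongrightarrow> exp (R 1 - R 0)) (at_left 1)" by (intro tendsto_intros)
  moreover have "eventually (\<lambda>t. exp (R t - R 0) = H t) (at_left 1)"
    by (rule eventually_mono[OF eventually_at_left_real[of 0 1]]) (auto simp: Heq)
  ultimately have "(H \<longlongrightarrow> exp (R 1 - R 0)) (at_left 1)" by (rule Lim_transform_eventually)
  then show ?thesis unfolding H_def f_def by (intro exI[of _ "exp (R 1 - R 0)"]) auto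
qed

lemma powr_mono_tendsto_0: "\<epsilon> > 0 \<Longrightarrow> ((\<lambda>t. (1 - t) powr \<epsilon>) \<longlongrightarrow> (0::real)) (at_left 1)"
proof -
  assume "\<epsilon> > 0"
  then have "((\<lambda>t. (1 - t) powr \<epsilon>) \<longlongrightarrow> (1 - 1) powr \<epsilon>) (at_left (1::real))"
    by (intro tendsto_powr' tendsto_intros) (auto simp: eventually_at_left_field intro!: exI[of _
        0])
  then show ?thesis by simp
qed

text \<open>\<open>M\<close> may be any upper bound of the means: a term of smaller mean is killed
  by the surplus power of \<open>1 - t\<close>.\<close>

lemma sum_gen_fun_asymptotics:
  assumes S: "finite S" and per: "\<And>a. a \<in> S \<Longrightarrow> periodic m (p a)" and le: "\<And>a. a \<in> S \<Longrightarrow> mean m (p a)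
      \<le> M"
    and C: "\<And>a. a \<in> S \<Longrightarrow> ((\<lambda>t. (1 - t) powr mean m (p a) * gen_fun (p a) t) \<longlongrightarrow> C a) (at_left 1)"
  shows "((\<lambda>t. (1 - t) powr M * (\<Sum>a\<in>S. gen_fun (p a) t)) \<longlongrightarrow> (\<Sum>a\<in>{a\<in>S. mean m (p a) = M}. C a))
      (at_left 1)"
proof -
  have "((\<lambda>t. (1 - t) powr M * gen_fun (p a) t) \<longlongrightarrow> (if mean m (p a) = M then C a else 0)) (at_left
      1)" if a: "a \<in> S" for a
  proof (cases "mean m (p a) = M")
    case True
    then show ?thesis using C[OF a] by simp
  next
    case False
    then have "M - mean m (p a) > 0" using le[OF a] by simp
    from tendsto_mult[OF powr_mono_tendsto_0[OF this] C[OF a]]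
    have "((\<lambda>t. (1 - t) powr (M - mean m (p a)) * ((1 - t) powr mean m (p a) * gen_fun (p a) t)) \<longlongrightarrow>
        0) (at_left 1)"
      by simp
    moreover have "(1 - t) powr (M - mean m (p a)) * ((1 - t) powr mean m (p a) * g) = (1 - t)
        powr M * g" for t g :: real
      by (simp add: powr_add[symmetric] mult.assoc[symmetric])
    ultimately show ?thesis using False by simp
  qed
  then have "((\<lambda>t. \<Sum>a\<in>S. (1 - t) powr M * gen_fun (p a) t) \<longlongrightarrow> (\<Sum>a\<in>S. if mean m (p a) = M then C a
      else 0)) (at_left 1)"
    by (rule tendsto_sum)
  then show ?thesis using S by (simp add: sum_distrib_left sum.inter_filter)
qed

lemma sum_gen_fun_eq:
  assumes S: "finite S" "finite S'" and per: "\<And>a. a \<in> S \<Longrightarrow> periodic m (p a)" "\<And>a. a \<in> S' \<Longrightarrow> periodic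
      m' (p' a)"
    and eq: "\<And>k. c * (\<Sum>a\<in>S. complete_symmetric (p a) k) = c' * (\<Sum>a\<in>S'. complete_symmetric (p' a) k)"
    and t: "\<bar>t\<bar> < 1"
  shows "c * (\<Sum>a\<in>S. gen_fun (p a) t) = c' * (\<Sum>a\<in>S'. gen_fun (p' a) t)"
proof -
  have sm: "summable (\<lambda>k. complete_symmetric p k * t ^ k)" if "periodic m p" for m p
    using summable_norm_cancel[OF summable_complete_symmetric[OF _ t]] periodic_bounded[OF that]
        by blast
  have "c * (\<Sum>a\<in>S. gen_fun (p a) t) = (\<Sum>k. c * (\<Sum>a\<in>S. complete_symmetric (p a) k * t ^ k))"
    unfolding gen_fun_def using sm[OF per(1)]
    by (subst suminf_sum[symmetric], blast, subst suminf_mult[symmetric]) (auto intro: summable_sum)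
  also have "\<dots> = (\<Sum>k. c' * (\<Sum>a\<in>S'. complete_symmetric (p' a) k * t ^ k))"
    using eq by (simp add: sum_distrib_right[symmetric] mult.assoc[symmetric])
  also have "\<dots> = c' * (\<Sum>a\<in>S'. gen_fun (p' a) t)"
    unfolding gen_fun_def using sm[OF per(2)]
    by (subst suminf_sum[symmetric], blast, subst suminf_mult[symmetric]) (auto intro: summable_sum)
  finally show ?thesis .
qed

text \<open>Both maxima are the pole order at \<open>t = 1\<close> of the same function. The leading
  constants are positive, so the terms of maximal mean cannot cancel.\<close>

proposition max_mean_eq:
  assumes S: "finite S" "finite S'" and ne: "S \<noteq> {}" "S' \<noteq> {}"
    and per: "\<And>a. a \<in> S \<Longrightarrow> periodic m (p a)" "\<And>a. a \<in> S' \<Longrightarrow> periodic m' (p' a)"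
    and eq: "\<And>k. (\<Sum>a\<in>S. complete_symmetric (p a) k) = (\<Sum>a\<in>S'. complete_symmetric (p' a) k)"
  shows "Max ((\<lambda>a. mean m (p a)) ` S) = Max ((\<lambda>a. mean m' (p' a)) ` S')"
proof -
  \<comment> \<open>One inequality for arbitrary families, so that it can be used again with the two
    sides exchanged.\<close>
  have *: "Max ((\<lambda>a. mean m (p a)) ` S) \<le> Max ((\<lambda>a. mean m' (p' a)) ` S')"
    if S: "finite S" "finite S'" and ne: "S \<noteq> {}" "S' \<noteq> {}"
    and per: "\<And>a. a \<in> S \<Longrightarrow> periodic m (p a)" "\<And>a. a \<in> S' \<Longrightarrow> periodic m' (p' a)"
    and eq: "\<And>k. (\<Sum>a\<in>S. complete_symmetric (p a) k) = (\<Sum>a\<in>S'. complete_symmetric (p' a) k)"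
    for S :: "'c set" and S' :: "'d set" and m m' p p'
  proof (rule ccontr)
    define M where "M = Max ((\<lambda>a. mean m (p a)) ` S)"
    assume "\<not> ?thesis"
    then have "Max ((\<lambda>a. mean m' (p' a)) ` S') < M" by (simp add: M_def)
    then have lt: "\<And>a. a \<in> S' \<Longrightarrow> mean m' (p' a) < M"
      using S(2) by (meson Max_ge finite_imageI image_eqI le_less_trans)
    have le: "\<And>a. a \<in> S \<Longrightarrow> mean m (p a) \<le> M" using S by (auto simp: M_def)
    obtain C where C: "\<And>a. a \<in> S \<Longrightarrow> C a > 0 \<and> ((\<lambda>t. (1 - t) powr mean m (p a) * gen_fun (p a) t) \<longlongrightarrow>
        C a) (at_left 1)"
      using gen_fun_asymptotics[OF per(1)] by metis
    obtain C' where C': "\<And>a. a \<in> S' \<Longrightarrow> ((\<lambda>t. (1 - t) powr mean m' (p' a) * gen_fun (p' a) t) \<longlongrightarrow> C'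
        a) (at_left 1)"
      using gen_fun_asymptotics[OF per(2)] by metis
    have 1: "((\<lambda>t. (1 - t) powr M * (\<Sum>a\<in>S. gen_fun (p a) t)) \<longlongrightarrow> (\<Sum>a\<in>{a\<in>S. mean m (p a) = M}. C a))
        (at_left 1)"
      using S per le C by (intro sum_gen_fun_asymptotics) auto
    have 2: "((\<lambda>t. (1 - t) powr M * (\<Sum>a\<in>S'. gen_fun (p' a) t)) \<longlongrightarrow> (\<Sum>a\<in>{a\<in>S'. mean m' (p' a) = M}.
        C' a)) (at_left 1)"
      using S per lt C' by (intro sum_gen_fun_asymptotics) (auto intro: less_imp_le)
    have "eventually (\<lambda>t. (1 - t) powr M * (\<Sum>a\<in>S. gen_fun (p a) t) = (1 - t) powr M * (\<Sum>a\<in>S'.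
        gen_fun (p' a) t)) (at_left (1::real))"
    proof (rule eventually_mono[OF eventually_at_left_real[of 0 1]])
      fix t :: real assume "t \<in> {0<..<1}"
      then have "1 * (\<Sum>a\<in>S. gen_fun (p a) t) = 1 * (\<Sum>a\<in>S'. gen_fun (p' a) t)"
        using S per eq by (intro sum_gen_fun_eq) auto
      then show "(1 - t) powr M * (\<Sum>a\<in>S. gen_fun (p a) t) = (1 - t) powr M * (\<Sum>a\<in>S'. gen_fun (p'
          a) t)" by simp
    qed auto
    from Lim_transform_eventually[OF 1 this] 2
    have "(\<Sum>a\<in>{a\<in>S. mean m (p a) = M}. C a) = (\<Sum>a\<in>{a\<in>S'. mean m' (p' a) = M}. C' a)"
      using tendsto_unique[OF trivial_limit_at_left_real] by blast
    moreover have "{a\<in>S'. mean m' (p' a) = M} = {}" using lt by force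
    ultimately have "(\<Sum>a\<in>{a\<in>S. mean m (p a) = M}. C a) = 0" by (simp only: sum.empty)
    moreover have "M \<in> (\<lambda>a. mean m (p a)) ` S" unfolding M_def using S ne by (intro Max_in) auto
    then have "{a\<in>S. mean m (p a) = M} \<noteq> {}" by auto
    then have "(\<Sum>a\<in>{a\<in>S. mean m (p a) = M}. C a) > 0" using S C by (intro sum_pos) auto
    ultimately show False by simp
  qed
  show ?thesis
    using *[OF S ne per eq] *[OF S(2,1) ne(2,1) per(2,1) eq[symmetric]] by (intro antisym)
qed

text \<open>Negating all eigenvalues amounts to replacing \<open>t\<close> by \<open>-t\<close>;
  this carries results on the pole at 1 over to the pole at -1.\<close>

lemma complete_symmetric_alternating:
  "complete_symmetric (\<lambda>j. (-1) ^ j * p j) k = (-1) ^ k * complete_symmetric p k"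
proof (induction k rule: less_induct)
  case (less k)
  show ?case
  proof (cases k)
    case (Suc n)
    have "(\<Sum>j\<le>n. (-1) ^ Suc j * p (Suc j) * complete_symmetric (\<lambda>j. (-1) ^ j * p j) (n - j))
        = (\<Sum>j\<le>n. (-1) ^ Suc n * (p (Suc j) * complete_symmetric p (n - j)))"
    proof (rule sum.cong[OF refl])
      fix j assume "j \<in> {..n}"
      then have "complete_symmetric (\<lambda>j. (-1) ^ j * p j) (n - j) = (-1) ^ (n - j) *
          complete_symmetric p (n - j)"
        and "(-1::real) ^ Suc n = (-1) ^ Suc j * (-1) ^ (n - j)"
        using less Suc by (auto simp flip: power_add)
      then show "(-1) ^ Suc j * p (Suc j) * complete_symmetric (\<lambda>j. (-1) ^ j * p j) (n - j)
          = (-1) ^ Suc n * (p (Suc j) * complete_symmetric p (n - j))" by simp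
    qed
    then show ?thesis unfolding Suc complete_symmetric.simps(2) sum_distrib_left[symmetric] by simp
  qed simp
qed

subsection \<open>Orthogonal representations with equal traces\<close>

lemma matrix_mul_sum_left: "(\<Sum>a\<in>S. f a) ** (B::real^'n^'m) = (\<Sum>a\<in>S. f a ** B)"
  by (induction S rule: infinite_finite_induct) (auto simp: matrix_matrix_mult_def vec_eq_iff
      algebra_simps sum.distrib)

lemma matrix_mul_sum_right: "(B::real^'n^'m) ** (\<Sum>a\<in>S. f a) = (\<Sum>a\<in>S. B ** f a)"
  by (induction S rule: infinite_finite_induct) (auto simp: matrix_matrix_mult_def vec_eq_iff
      algebra_simps sum.distrib)

lemma matrix_mul_diff_left: "((A::real^'n^'m) - B) ** C = A ** C - B ** C"
  by (simp add: vec_eq_iff matrix_matrix_mult_def algebra_simps sum_subtractf)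

lemma matrix_mul_diff_right: "(A::real^'n^'m) ** (B - C) = A ** B - A ** C"
  by (simp add: vec_eq_iff matrix_matrix_mult_def algebra_simps sum_subtractf)

lemma bounded_contractions: "bounded {T :: real^'n^'m. \<forall>x. norm (T *v x) \<le> norm x}"
proof -
  have "norm T \<le> real CARD('m) * real CARD('n)" if T: "\<forall>x. norm (T *v x) \<le> norm x" for T ::
      "real^'n^'m"
  proof -
    have e: "\<bar>T $ i $ j\<bar> \<le> 1" for i j
    proof -
      have "\<bar>(T *v axis j 1) $ i\<bar> \<le> norm (T *v axis j 1)" by (rule component_le_norm_cart)
      also have "\<dots> \<le> 1" using T by (metis norm_axis_1)
      finally show ?thesis by (simp add: matrix_vector_mul_component inner_axis)
    qed
    have "norm T \<le> (\<Sum>i\<in>UNIV. norm (T $ i))"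
      unfolding norm_vec_def by (rule L2_set_le_sum) auto
    also have "\<dots> \<le> (\<Sum>i\<in>(UNIV::'m set). real CARD('n))"
    proof (rule sum_mono)
      fix i
      have "norm (T $ i) \<le> (\<Sum>j\<in>UNIV. \<bar>T $ i $ j\<bar>)" by (rule norm_le_l1_cart)
      also have "\<dots> \<le> (\<Sum>j\<in>(UNIV::'n set). 1)" by (rule sum_mono) (rule e)
      finally show "norm (T $ i) \<le> real CARD('n)" by simp
    qed
    finally show ?thesis by simp
  qed
  then show ?thesis unfolding bounded_iff by blast
qed

lemma contraction_transpose:
  fixes T :: "real^'n^'m"
  assumes "\<And>x. norm (T *v x) \<le> norm x"
  shows "norm (transpose T *v y) \<le> norm y"
proof -
  have "(norm (transpose T *v y))\<^sup>2 = y \<bullet> (T *v (transpose T *v y))"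
    by (metis dot_lmul_matrix power2_norm_eq_inner transpose_matrix_vector)
  also have "\<dots> \<le> norm y * norm (T *v (transpose T *v y))" by (rule norm_cauchy_schwarz)
  also have "\<dots> \<le> norm y * norm (transpose T *v y)" by (intro mult_left_mono assms) auto
  finally show ?thesis
    by (metis mult_right_le_imp_le norm_ge_zero power2_eq_square order_le_less)
qed

text \<open>
  An intertwiner of maximal Euclidean norm among the contractive ones is orthogonal: otherwise it
  could be moved in the direction \<open>(1 - T T\<^sup>t) S (1 - T\<^sup>t T)\<close> for any intertwiner \<open>S\<close>.
\<close>

proposition orthogonal_conjugacy_of_equal_traces:
  fixes \<Gamma> :: "(real^'n^'n) set"
  assumes fin: "finite \<Gamma>" and one: "mat 1 \<in> \<Gamma>"
    and mult: "\<And>a b. a \<in> \<Gamma> \<Longrightarrow> b \<in> \<Gamma> \<Longrightarrow> a ** b \<in> \<Gamma>"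
    and orth: "\<And>a. a \<in> \<Gamma> \<Longrightarrow> orthogonal_matrix a"
    and orth': "\<And>a. a \<in> \<Gamma> \<Longrightarrow> orthogonal_matrix (h a)"
    and hom: "\<And>a b. a \<in> \<Gamma> \<Longrightarrow> b \<in> \<Gamma> \<Longrightarrow> h (a ** b) = h a ** h b"
    and tr: "\<And>a. a \<in> \<Gamma> \<Longrightarrow> trace (h a) = trace a"
  shows "\<exists>U. orthogonal_matrix U \<and> (\<forall>a\<in>\<Gamma>. U ** a = h a ** U)"
proof -
  define W where "W = {T :: real^'n^'n. (\<forall>a\<in>\<Gamma>. T ** a = h a ** T) \<and> (\<forall>x. norm (T *v x) \<le> norm x)}"
  have cont_mv: "continuous_on UNIV (\<lambda>T :: real^'n^'n. T *v x)" for x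
    unfolding matrix_vector_mult_def by (intro continuous_intros)
  have cont_mm: "continuous_on UNIV (\<lambda>T :: real^'n^'n. T ** a)"
     "continuous_on UNIV (\<lambda>T :: real^'n^'n. a ** T)" for a :: "real^'n^'n"
    unfolding matrix_matrix_mult_def by (intro continuous_intros)+
  have "closed ((\<Inter>a\<in>\<Gamma>. {T. T ** a = h a ** T}) \<inter> (\<Inter>x. {T. norm (T *v x) \<le> norm x}))"
    by (intro closed_Int closed_INT ballI closed_Collect_eq closed_Collect_le cont_mm
        continuous_on_norm cont_mv continuous_on_const)
  moreover have "W = (\<Inter>a\<in>\<Gamma>. {T. T ** a = h a ** T}) \<inter> (\<Inter>x. {T. norm (T *v x) \<le> norm x})"
    unfolding W_def by auto
  ultimately have "closed W" by simp
  moreover have "bounded W"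
    by (rule bounded_subset[OF bounded_contractions]) (auto simp: W_def)
  ultimately have "compact W" by (simp add: compact_eq_bounded_closed)
  moreover have "0 \<in> W" unfolding W_def by (auto simp: vec_eq_iff matrix_matrix_mult_def)
  ultimately obtain T where T: "T \<in> W" and Tmax: "\<And>S. S \<in> W \<Longrightarrow> norm S \<le> norm T"
    using continuous_attains_sup[of W norm] continuous_on_norm_id by blast
  have Ta: "T ** a = h a ** T" if "a \<in> \<Gamma>" for a using T that by (auto simp: W_def)
  have Tc: "norm (T *v x) \<le> norm x" for x using T by (auto simp: W_def)
  have Tc': "norm (transpose T *v x) \<le> norm x" for x by (rule contraction_transpose[OF Tc])
  have Ta': "transpose T ** h a = a ** transpose T" if a: "a \<in> \<Gamma>" for a
  proof -
    have "transpose T ** h a = (a ** transpose a) ** transpose T ** h a"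
      using orth[OF a] by (simp add: orthogonal_matrix_def)
    also have "\<dots> = a ** transpose (T ** a) ** h a"
      by (simp add: matrix_transpose_mul matrix_mul_assoc)
    also have "\<dots> = a ** transpose T ** (transpose (h a) ** h a)"
      by (simp add: Ta[OF a] matrix_transpose_mul matrix_mul_assoc)
    also have "\<dots> = a ** transpose T"
      using orth'[OF a] by (simp add: orthogonal_matrix_def)
    finally show ?thesis .
  qed
  \<comment> \<open>\<open>D\<close> and \<open>D'\<close> measure the failure of orthogonality of
    \<open>T\<close> on the source and on the target side. Each commutes with the group action on
    its side, which makes \<open>D' ** S ** D\<close> an intertwiner.\<close>
  define D where "D = mat 1 - transpose T ** T"
  define D' where "D' = mat 1 - T ** transpose T"
  have Da: "D ** a = a ** D" if a: "a \<in> \<Gamma>" for a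
  proof -
    have "transpose T ** T ** a = transpose T ** (T ** a)" by (simp add: matrix_mul_assoc)
    also have "\<dots> = (transpose T ** h a) ** T" by (simp add: Ta[OF a] matrix_mul_assoc)
    also have "\<dots> = a ** (transpose T ** T)" by (simp add: Ta'[OF a] matrix_mul_assoc)
    finally show ?thesis by (simp add: D_def matrix_mul_diff_left matrix_mul_diff_right)
  qed
  have D'a: "D' ** h a = h a ** D'" if a: "a \<in> \<Gamma>" for a
  proof -
    have "T ** transpose T ** h a = T ** (transpose T ** h a)" by (simp add: matrix_mul_assoc)
    also have "\<dots> = (T ** a) ** transpose T" by (simp add: Ta'[OF a] matrix_mul_assoc)
    also have "\<dots> = h a ** (T ** transpose T)" by (simp add: Ta[OF a] matrix_mul_assoc)
    finally show ?thesis by (simp add: D'_def matrix_mul_diff_left matrix_mul_diff_right)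
  qed
  have D'T: "transpose T ** D' = D ** transpose T"
    unfolding D_def D'_def matrix_mul_diff_left matrix_mul_diff_right
    by (simp add: matrix_mul_assoc)
  have Dt: "transpose D = D"
    unfolding D_def by (simp add: transpose_def vec_eq_iff matrix_matrix_mult_def mat_def
        mult.commute)
  have Dx: "D *v x = x - transpose T *v (T *v x)" for x
    unfolding D_def by (simp add: matrix_vector_mult_diff_rdistrib matrix_vector_mul_assoc)
  have Tx: "(T *v x) \<bullet> (T *v y) = x \<bullet> (transpose T *v (T *v y))" for x y
    by (metis dot_lmul_matrix transpose_matrix_vector transpose_transpose)
  have D_le: "(norm (D *v x))\<^sup>2 \<le> (norm x)\<^sup>2 - (norm (T *v x))\<^sup>2" for x
  proof -
    have "(norm (D *v x))\<^sup>2 = (norm x)\<^sup>2 - 2 * (norm (T *v x))\<^sup>2 + (norm (transpose T *v (T *v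
        x)))\<^sup>2"
      unfolding Dx power2_norm_eq_inner by (simp add: algebra_simps inner_commute Tx)
    also have "(norm (transpose T *v (T *v x)))\<^sup>2 \<le> (norm (T *v x))\<^sup>2"
      by (intro power_mono Tc') auto
    finally show ?thesis by simp
  qed
  have zero: "D' ** S ** D = 0" if S: "\<And>a. a \<in> \<Gamma> \<Longrightarrow> S ** a = h a ** S" for S :: "real^'n^'n"
  proof -
    define R where "R = D' ** S ** D"
    have Ra: "R ** a = h a ** R" if a: "a \<in> \<Gamma>" for a
    proof -
      have "R ** a = D' ** S ** (D ** a)" by (simp add: R_def matrix_mul_assoc)
      also have "\<dots> = D' ** (S ** a) ** D" by (simp add: Da[OF a] matrix_mul_assoc)
      also have "\<dots> = (D' ** h a) ** S ** D" by (simp add: S[OF a] matrix_mul_assoc)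
      also have "\<dots> = h a ** R" by (simp add: D'a[OF a] R_def matrix_mul_assoc)
      finally show ?thesis .
    qed
    obtain K2 where K2: "\<And>x. norm ((D' ** S) *v x) \<le> norm x * K2" "K2 > 0"
      using bounded_linear.pos_bounded[OF matrix_vector_mul_bounded_linear] by blast
    obtain K where K: "\<And>x. norm ((transpose T ** S) *v x) \<le> norm x * K" "K > 0"
      using bounded_linear.pos_bounded[OF matrix_vector_mul_bounded_linear] by blast
    \<comment> \<open>Small enough that the growth \<open>e * (2 * K + K2^2)\<close> times
      \<open>(norm (D *v x))^2\<close> fits into the room that \<open>D_le\<close> leaves below
      \<open>(norm x)^2\<close>.\<close>
    define e where "e = 1 / (2 * K + K2\<^sup>2 + 1)"
    have e: "e > 0" "e \<le> 1" "e * (2 * K + K2\<^sup>2) \<le> 1"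
    proof -
      have "2 * K + K2\<^sup>2 + 1 > 1" using K(2) by (simp add: add_pos_nonneg)
      then show "e > 0" "e \<le> 1" "e * (2 * K + K2\<^sup>2) \<le> 1"
        unfolding e_def by (simp_all add: divide_simps)
    qed
    have TR: "\<bar>(T *v x) \<bullet> (R *v x)\<bar> \<le> K * (norm (D *v x))\<^sup>2" for x
    proof -
      have "(T *v x) \<bullet> (R *v x) = x \<bullet> ((transpose T ** D') *v (S *v (D *v x)))"
        unfolding R_def by (metis dot_lmul_matrix transpose_matrix_vector transpose_transpose
            matrix_vector_mul_assoc)
      also have "\<dots> = x \<bullet> (D *v ((transpose T ** S) *v (D *v x)))"
        unfolding D'T by (simp add: matrix_vector_mul_assoc matrix_mul_assoc)
      also have "\<dots> = (D *v x) \<bullet> ((transpose T ** S) *v (D *v x))"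
        by (metis dot_lmul_matrix transpose_matrix_vector Dt)
      also have "\<bar>\<dots>\<bar> \<le> norm (D *v x) * norm ((transpose T ** S) *v (D *v x))"
        by (rule Cauchy_Schwarz_ineq2)
      also have "\<dots> \<le> norm (D *v x) * (norm (D *v x) * K)"
        by (intro mult_left_mono K) auto
      finally show ?thesis by (simp add: power2_eq_square mult_ac)
    qed
    have RR: "(norm (R *v x))\<^sup>2 \<le> K2\<^sup>2 * (norm (D *v x))\<^sup>2" for x
    proof -
      have "norm (R *v x) \<le> norm (D *v x) * K2"
        using K2(1)[of "D *v x"] by (simp add: R_def matrix_vector_mul_assoc)
      then have "(norm (R *v x))\<^sup>2 \<le> (norm (D *v x) * K2)\<^sup>2" by (intro power_mono) auto
      then show ?thesis by (simp add: power_mult_distrib mult_ac)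
    qed
    have in_W: "T + s *\<^sub>R R \<in> W" if s: "\<bar>s\<bar> = e" for s
    proof -
      have "(norm ((T + s *\<^sub>R R) *v x))\<^sup>2 \<le> (norm x)\<^sup>2" for x
      proof -
        have "(T + s *\<^sub>R R) *v x = T *v x + s *\<^sub>R (R *v x)"
          by (simp add: matrix_vector_mult_add_rdistrib scaleR_matrix_vector_assoc)
        then have "(norm ((T + s *\<^sub>R R) *v x))\<^sup>2
           = (norm (T *v x))\<^sup>2 + 2 * s * ((T *v x) \<bullet> (R *v x)) + s\<^sup>2 * (norm (R *v x))\<^sup>2"
          unfolding power2_norm_eq_inner by (simp add: algebra_simps inner_commute power2_eq_square)
        also have "\<dots> \<le> (norm (T *v x))\<^sup>2 + 2 * e * (K * (norm (D *v x))\<^sup>2) + e * (K2\<^sup>2 * (norm (D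
            *v x))\<^sup>2)"
        proof (intro add_mono order_refl)
          have "2 * s * ((T *v x) \<bullet> (R *v x)) \<le> \<bar>2 * s * ((T *v x) \<bullet> (R *v x))\<bar>" by simp
          also have "\<dots> = 2 * e * \<bar>(T *v x) \<bullet> (R *v x)\<bar>" using s by (simp add: abs_mult)
          also have "\<dots> \<le> 2 * e * (K * (norm (D *v x))\<^sup>2)" using e TR by (intro mult_left_mono) auto
          finally show "2 * s * ((T *v x) \<bullet> (R *v x)) \<le> 2 * e * (K * (norm (D *v x))\<^sup>2)" .
          have "s\<^sup>2 = e\<^sup>2" using s by (metis power2_abs)
          also have "\<dots> \<le> e" using e by (simp add: power2_eq_square mult_left_le)
          finally show "s\<^sup>2 * (norm (R *v x))\<^sup>2 \<le> e * (K2\<^sup>2 * (norm (D *v x))\<^sup>2)"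
            using RR e by (intro mult_mono) auto
        qed
        also have "\<dots> = (norm (T *v x))\<^sup>2 + e * (2 * K + K2\<^sup>2) * (norm (D *v x))\<^sup>2"
          by (simp add: algebra_simps)
        also have "\<dots> \<le> (norm (T *v x))\<^sup>2 + 1 * (norm (D *v x))\<^sup>2"
          using e by (intro add_mono mult_right_mono) auto
        also have "\<dots> \<le> (norm x)\<^sup>2" using D_le[of x] by simp
        finally show ?thesis .
      qed
      then have "norm ((T + s *\<^sub>R R) *v x) \<le> norm x" for x
        by (metis norm_ge_zero power2_le_imp_le)
      moreover have "(T + s *\<^sub>R R) ** a = h a ** (T + s *\<^sub>R R)" if "a \<in> \<Gamma>" for a
        using Ra[OF that] Ta[OF that]
        by (simp add: vec_eq_iff matrix_matrix_mult_def algebra_simps sum.distrib flip: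
            sum_distrib_left)
      ultimately show ?thesis by (simp add: W_def)
    qed
    \<comment> \<open>By the parallelogram law for the Euclidean norm of matrices, one of the two
      moves would exceed the norm of \<open>T\<close> unless \<open>R = 0\<close>.\<close>
    have "norm (T + e *\<^sub>R R) \<le> norm T" "norm (T + (-e) *\<^sub>R R) \<le> norm T"
      using in_W[of e] in_W[of "-e"] e Tmax by auto
    then have "(norm (T + e *\<^sub>R R))\<^sup>2 + (norm (T + (-e) *\<^sub>R R))\<^sup>2 \<le> (norm T)\<^sup>2 + (norm T)\<^sup>2"
      by (intro add_mono power_mono) auto
    moreover have "(norm (T + e *\<^sub>R R))\<^sup>2 + (norm (T + (-e) *\<^sub>R R))\<^sup>2 = 2 * (norm T)\<^sup>2 + 2 * e\<^sup>2 *
        (norm R)\<^sup>2"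
      unfolding power2_norm_eq_inner by (simp add: algebra_simps inner_commute power2_eq_square)
    ultimately have "2 * e\<^sup>2 * (norm R)\<^sup>2 \<le> 0" by simp
    then have "norm R = 0" using e by (simp add: mult_le_0_iff zero_le_mult_iff)
    then show ?thesis by (simp add: R_def)
  qed
  \<comment> \<open>Averaging an arbitrary \<open>X\<close> produces an intertwiner, to which
    \<open>zero\<close> applies.\<close>
  have avg: "(\<Sum>a\<in>\<Gamma>. h a ** X ** transpose a) ** b = h b ** (\<Sum>a\<in>\<Gamma>. h a ** X ** transpose a)"
    if b: "b \<in> \<Gamma>" for X b
  proof -
    have "bij_betw (\<lambda>a. b ** a) \<Gamma> \<Gamma>" by (rule bij_betw_left_mult[OF fin b orth[OF b] mult[OF b]])
    then have "(\<Sum>a\<in>\<Gamma>. h a ** X ** transpose a) = (\<Sum>a\<in>\<Gamma>. h (b ** a) ** X ** transpose (b ** a))"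
      by (rule sum.reindex_bij_betw[symmetric])
    then have "(\<Sum>a\<in>\<Gamma>. h a ** X ** transpose a) ** b
        = (\<Sum>a\<in>\<Gamma>. h (b ** a) ** X ** transpose (b ** a) ** b)"
      by (simp add: matrix_mul_sum_left)
    also have "\<dots> = (\<Sum>a\<in>\<Gamma>. h b ** (h a ** X ** transpose a))"
    proof (rule sum.cong[OF refl])
      fix a assume a: "a \<in> \<Gamma>"
      have "h (b ** a) ** X ** transpose (b ** a) ** b = h b ** (h a ** X ** transpose a) **
          (transpose b ** b)"
        by (simp add: hom[OF b a] matrix_transpose_mul matrix_mul_assoc)
      then show "h (b ** a) ** X ** transpose (b ** a) ** b = h b ** (h a ** X ** transpose a)"
        using orth[OF b] by (simp add: orthogonal_matrix_def)
    qed
    finally show ?thesis by (simp add: matrix_mul_sum_right)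
  qed
  have entry: "(\<Sum>a\<in>\<Gamma>. (D' ** h a) $ i $ i * (transpose a ** D) $ j $ j) = 0" for i j
  proof -
    \<comment> \<open>Matrix units as \<open>X\<close> turn the vanishing product into relations
      between single entries, as in the proof of Schur orthogonality.\<close>
    define X :: "real^'n^'n" where "X = (\<chi> k l. if k = i \<and> l = j then 1 else 0)"
    have "D' ** (\<Sum>a\<in>\<Gamma>. h a ** X ** transpose a) ** D = 0"
      by (rule zero) (rule avg)
    then have "0 = (\<Sum>a\<in>\<Gamma>. (D' ** h a) ** X ** (transpose a ** D))"
      by (simp add: matrix_mul_sum_left matrix_mul_sum_right matrix_mul_assoc)
    then have "0 = (\<Sum>a\<in>\<Gamma>. ((D' ** h a) ** X ** (transpose a ** D)) $ i $ j)"
      by (metis (no_types, lifting) sum_component zero_index sum.cong)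
    moreover have "(P ** X ** Q) $ i $ j = P $ i $ i * Q $ j $ j" for P Q :: "real^'n^'n"
    proof -
      have PX: "(P ** X) $ i $ l = (if l = j then P $ i $ i else 0)" for l
        by (simp add: matrix_matrix_mult_def X_def if_distrib cong: if_cong)
      have "(P ** X ** Q) $ i $ j = (\<Sum>l\<in>UNIV. (P ** X) $ i $ l * Q $ l $ j)"
        by (simp add: matrix_matrix_mult_def[of "P ** X"])
      also have "\<dots> = (\<Sum>l\<in>UNIV. if l = j then P $ i $ i * Q $ l $ j else 0)"
        by (intro sum.cong) (auto simp: PX)
      finally show ?thesis by simp
    qed
    ultimately show ?thesis by simp
  qed
  have "0 = (\<Sum>i\<in>UNIV. \<Sum>j\<in>UNIV. \<Sum>a\<in>\<Gamma>. (D' ** h a) $ i $ i * (transpose a ** D) $ j $ j)"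
    using entry by simp
  also have "\<dots> = (\<Sum>i\<in>UNIV. \<Sum>a\<in>\<Gamma>. \<Sum>j\<in>UNIV. (D' ** h a) $ i $ i * (transpose a ** D) $ j $ j)"
    by (intro sum.cong refl sum.swap)
  also have "\<dots> = (\<Sum>a\<in>\<Gamma>. \<Sum>i\<in>UNIV. \<Sum>j\<in>UNIV. (D' ** h a) $ i $ i * (transpose a ** D) $ j $ j)"
    by (rule sum.swap)
  also have "\<dots> = (\<Sum>a\<in>\<Gamma>. trace (D' ** h a) * trace (transpose a ** D))"
    by (simp add: trace_def sum_product)
  \<comment> \<open>Equality of traces enters here: it makes the traces of \<open>D' ** h a\<close>
    and \<open>D ** a\<close> agree, so the sum becomes a sum of squares.\<close>
  also have "\<dots> = (\<Sum>a\<in>\<Gamma>. (trace (D ** a))\<^sup>2)"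
  proof (rule sum.cong[OF refl])
    fix a assume a: "a \<in> \<Gamma>"
    have "trace (D' ** h a) = trace (h a) - trace (T ** (transpose T ** h a))"
      by (simp add: D'_def matrix_mul_diff_left trace_sub matrix_mul_assoc)
    also have "trace (T ** (transpose T ** h a)) = trace (transpose T ** (T ** a))"
      by (subst trace_mul_sym) (simp add: Ta[OF a] matrix_mul_assoc)
    finally have 1: "trace (D' ** h a) = trace (D ** a)"
      by (simp add: D_def matrix_mul_diff_left trace_sub matrix_mul_assoc tr[OF a])
    have "transpose a ** D = transpose (D ** a)" by (simp add: matrix_transpose_mul Dt)
    then have "trace (transpose a ** D) = trace (D ** a)"
      by (simp add: trace_def transpose_def)
    with 1 show "trace (D' ** h a) * trace (transpose a ** D) = (trace (D ** a))\<^sup>2"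
      by (simp add: power2_eq_square)
  qed
  finally have "\<forall>a\<in>\<Gamma>. (trace (D ** a))\<^sup>2 = 0"
    using fin sum_nonneg_eq_0_iff[OF fin, of "\<lambda>a. (trace (D ** a))\<^sup>2"] by simp
  \<comment> \<open>The identity element yields \<open>trace D = 0\<close>. The diagonal of
    \<open>D\<close> is nonnegative because \<open>T\<close> is contractive, so it vanishes, and by
    \<open>D_le\<close> so do all columns.\<close>
  with one have "trace (D ** mat 1) = 0" by auto
  then have trD: "(\<Sum>i\<in>UNIV. D $ i $ i) = 0" by (simp add: trace_def)
  have Dii: "D $ i $ i = axis i 1 \<bullet> (D *v axis i 1)" for i
    by (simp add: inner_axis' matrix_vector_mul_component inner_axis)
  have Dn: "axis i 1 \<bullet> (D *v axis i 1) = (norm (axis i (1::real)::real^'n))\<^sup>2 - (norm (T *v axis i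
      1))\<^sup>2" for i
    unfolding Dx power2_norm_eq_inner by (simp add: inner_diff_right Tx)
  have "D $ i $ i \<ge> 0" for i
    unfolding Dii Dn using D_le[of "axis i 1"] by (meson order_trans zero_le_power2)
  then have "D $ i $ i = 0" for i using trD by (simp add: sum_nonneg_eq_0_iff)
  then have "D *v axis i 1 = 0" for i
    using D_le[of "axis i 1"] Dii[of i] Dn[of i] by simp
  then have "D = 0"
    by (metis matrix_eq matrix_vector_mult_basis column_def vec_eq_iff vec_lambda_beta zero_index)
  then have "transpose T ** T = mat 1" unfolding D_def by simp
  then have "orthogonal_matrix T" by (simp add: orthogonal_matrix)
  with Ta show ?thesis by blast
qed

subsection \<open>Small groups\<close>

lemma mpow_add: "mpow A (i + j) = mpow A i ** mpow A j"
  by (induction i) (simp_all add: matrix_mul_assoc)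

lemma mpow_mult: "mpow A (i * j) = mpow (mpow A i) j"
  by (induction j) (simp_all add: mpow_add)

lemma mpow_mat_1 [simp]: "mpow (mat 1) j = mat 1"
  by (induction j) simp_all

lemma mpow_1 [simp]: "mpow A (Suc 0) = A"
  by simp

lemma mpow_mod: "mpow A n = mat 1 \<Longrightarrow> mpow A (k mod n) = mpow A k"
proof -
  assume A: "mpow A n = mat 1"
  have "mpow A k = mpow A (n * (k div n) + k mod n)" by simp
  also have "\<dots> = mpow A (k mod n)" by (simp only: mpow_add mpow_mult A mpow_mat_1 matrix_mul_lid)
  finally show ?thesis by simp
qed

lemma orthogonal_matrix_mpow: "orthogonal_matrix A \<Longrightarrow> orthogonal_matrix (mpow A k)"
  by (induction k) (simp_all add: orthogonal_matrix_mul orthogonal_matrix_id)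

lemma orthogonal_left_cancel:
  fixes A B C :: "real^'n^'n"
  assumes "orthogonal_matrix A"
  shows "A ** B = A ** C \<longleftrightarrow> B = C"
proof
  assume "A ** B = A ** C"
  then have "(transpose A ** A) ** B = (transpose A ** A) ** C" by (simp flip: matrix_mul_assoc)
  then show "B = C" using assms by (simp add: orthogonal_matrix_def)
qed simp

lemma orthogonal_right_cancel:
  fixes A B C :: "real^'n^'n"
  assumes "orthogonal_matrix A"
  shows "B ** A = C ** A \<longleftrightarrow> B = C"
proof
  assume "B ** A = C ** A"
  then have "B ** (A ** transpose A) = C ** (A ** transpose A)" by (simp add: matrix_mul_assoc)
  then show "B = C" using assms by (simp add: orthogonal_matrix_def)
qed simp

section \<open>Traces of powers and the order of the group\<close>

lemma trace_transpose: "trace (transpose A) = trace A"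
  by (simp add: trace_def transpose_def)

text \<open>The entry \<open>A $ i $ i\<close> is 1 minus half the squared distance between
  \<open>axis i 1\<close> and its image.\<close>

lemma trace_orthogonal_le:
  fixes A :: "real^'n^'n"
  assumes A: "orthogonal_matrix A"
  shows "trace A \<le> real CARD('n)" and "trace A = real CARD('n) \<Longrightarrow> A = mat 1"
proof -
  have n: "(norm (A *v axis i 1 - axis i 1))\<^sup>2 = 2 - 2 * A $ i $ i" for i
  proof -
    have "axis i 1 \<bullet> (A *v axis i 1) = A $ i $ i"
      by (simp add: inner_axis' matrix_vector_mult_basis column_def)
    then show ?thesis
      unfolding power2_norm_eq_inner
      by (simp add: inner_diff_left inner_diff_right orthogonal_matrix_inner[OF A] inner_axis_axis
          inner_commute)
  qed
  then have le: "A $ i $ i \<le> 1" for i using zero_le_power2[of "norm (A *v axis i 1 - axis i 1)"]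
      by simp
  have "trace A \<le> (\<Sum>i\<in>(UNIV::'n set). 1)" unfolding trace_def by (rule sum_mono) (rule le)
  then show "trace A \<le> real CARD('n)" by simp
  assume "trace A = real CARD('n)"
  then have "(\<Sum>i\<in>UNIV. 1 - A $ i $ i) = 0" by (simp add: trace_def sum_subtractf)
  then have "1 - A $ i $ i = 0" for i using le by (simp add: sum_nonneg_eq_0_iff)
  then have "A *v axis i 1 = axis i 1" for i using n[of i] by simp
  then have "column i A = column i (mat 1)" for i
    using matrix_vector_mult_basis[of A i] matrix_vector_mult_basis[of "mat 1" i] by simp
  then show "A = mat 1" by (simp add: vec_eq_iff column_def)
qed

abbreviation power_traces :: "real^'n^'n \<Rightarrow> nat \<Rightarrow> real" where
  "power_traces a j \<equiv> trace (mpow a j)"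

context
  fixes \<Gamma> :: "(real^'n^'n) set"
  assumes \<Gamma>: "finite_orthogonal_subgroup \<Gamma>"
begin

private lemmas power_facts = finite_orthogonal_subgroup_facts[OF \<Gamma>]

lemma mpow_closed: "a \<in> \<Gamma> \<Longrightarrow> mpow a k \<in> \<Gamma>"
  by (induction k) (simp_all add: power_facts)

abbreviation "grp \<equiv> orthogonal_group \<lparr>carrier := \<Gamma>\<rparr>"

lemma group_grp: "group grp"
  by (rule subgroup.subgroup_is_group[OF _ group_orthogonal_group])
    (use \<Gamma> in \<open>simp add: finite_orthogonal_subgroup_def\<close>)

lemma grp_simps: "carrier grp = \<Gamma>" "x \<otimes>\<^bsub>grp\<^esub> y = x ** y" "\<one>\<^bsub>grp\<^esub> = mat 1" "order grp = card \<Gamma>"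
  by (simp_all add: orthogonal_group_def order_def)

lemma grp_pow: "x [^]\<^bsub>grp\<^esub> (k::nat) = mpow x k"
proof (induction k)
  case (Suc k)
  then show ?case unfolding group.is_monoid[OF group_grp, THEN monoid.nat_pow_Suc] grp_simps
      mpow_Suc_right by simp
qed (simp add: group.is_monoid[OF group_grp, THEN monoid.nat_pow_0] grp_simps)

lemma mpow_eq_1_iff: "a \<in> \<Gamma> \<Longrightarrow> mpow a k = mat 1 \<longleftrightarrow> group.ord grp a dvd k"
  using group.pow_eq_id[OF group_grp, of a k] by (simp add: grp_pow grp_simps)

lemma ord_dvd_card: "a \<in> \<Gamma> \<Longrightarrow> group.ord grp a dvd card \<Gamma>"
  using group.ord_dvd_group_order[OF group_grp, of a] by (simp add: grp_simps)

lemma mpow_card: "a \<in> \<Gamma> \<Longrightarrow> mpow a (card \<Gamma>) = mat 1"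
  by (simp add: mpow_eq_1_iff ord_dvd_card)

lemma mpow_inj:
  assumes a: "a \<in> \<Gamma>" and ij: "mpow a i = mpow a j" "i < group.ord grp a" "j < group.ord grp a"
  shows "i = j"
proof -
  have *: "j \<le> i" if "mpow a i = mpow a j" "i \<le> j" "j < group.ord grp a" for i j
  proof -
    have "mpow a i ** mpow a (j - i) = mpow a i ** mat 1" using that mpow_add[of a i "j - i"] by
        simp
    then have "mpow a (j - i) = mat 1" using orthogonal_left_cancel orthogonal_matrix_mpow
        power_facts(4)[OF a] by blast
    then have "group.ord grp a dvd (j - i)" using mpow_eq_1_iff a by blast
    then have "j - i = 0" using that(3) by (metis dvd_imp_le leD less_imp_diff_less not_gr_zero)
    then show ?thesis by simp
  qed
  show ?thesis
  proof (cases "i \<le> j")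
    case True
    show ?thesis using *[OF ij(1) True ij(3)] True by simp
  next
    case False
    then show ?thesis using *[OF ij(1)[symmetric] _ ij(2)] by simp
  qed
qed

lemma periodic_power_traces: "a \<in> \<Gamma> \<Longrightarrow> periodic (card \<Gamma>) (power_traces a)"
  using card_pos[OF \<Gamma>] mpow_card by (simp add: periodic_def mpow_add)

lemma mean_power_traces_le: "a \<in> \<Gamma> \<Longrightarrow> mean (card \<Gamma>) (power_traces a) \<le> real CARD('n)"
proof -
  assume "a \<in> \<Gamma>"
  then have "(\<Sum>j<card \<Gamma>. power_traces a j) \<le> (\<Sum>j<card \<Gamma>. real CARD('n))"
    by (intro sum_mono trace_orthogonal_le power_facts mpow_closed)
  then show ?thesis using card_pos[OF \<Gamma>] by (simp add: mean_def divide_le_eq mult.commute)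
qed

text \<open>No term of the mean exceeds \<open>CARD('n)\<close>, so a maximal mean forces a maximal
  trace already for the first power.\<close>

lemma mean_power_traces_eq:
  assumes a: "a \<in> \<Gamma>" and m: "mean (card \<Gamma>) (power_traces a) = real CARD('n)"
  shows "a = mat 1"
proof (rule ccontr)
  assume "a \<noteq> mat 1"
  then have lt: "trace a < real CARD('n)" using trace_orthogonal_le[OF power_facts(4)[OF a]] by
      force
  have "card \<Gamma> \<noteq> 1" using a power_facts(2) \<open>a \<noteq> mat 1\<close> by (metis card_1_singletonE singletonD)
  then have "Suc 0 \<in> {..<card \<Gamma>}" using card_pos[OF \<Gamma>] by simp
  then have "(\<Sum>j<card \<Gamma>. power_traces a j) < (\<Sum>j<card \<Gamma>. real CARD('n))"
    using lt a by (intro sum_strict_mono_ex1) (auto intro!: trace_orthogonal_le power_facts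
        mpow_closed bexI[of _ "Suc 0"])
  then show False using m card_pos[OF \<Gamma>] by (simp add: mean_def divide_eq_eq)
qed

end

text \<open>Only the identity has a pole of order \<open>CARD('n)\<close> at \<open>t = 1\<close>,
  with a positive constant \<open>C\<close> common to both groups. The leading terms of the Molien
  series are therefore \<open>C / card \<Gamma>\<close> and
  \<open>C / card \<Gamma>'\<close>.\<close>

proposition isospectral_imp_card_eq:
  fixes \<Gamma> \<Gamma>' :: "(real^'n^'n) set"
  assumes "CARD('n) \<ge> 2" and \<Gamma>: "finite_orthogonal_subgroup \<Gamma>" and \<Gamma>': "finite_orthogonal_subgroup
      \<Gamma>'"
    and iso: "isospectral \<Gamma> \<Gamma>'"
  shows "card \<Gamma> = card \<Gamma>'"
proof -
  define N where "N = real CARD('n)"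
  \<comment> \<open>The power traces of the identity, taken with period 1 so that \<open>C\<close>
    is chosen independently of either group.\<close>
  define q :: "nat \<Rightarrow> real" where "q = (\<lambda>_. N)"
  have "periodic 1 q" "mean 1 q = N" by (simp_all add: periodic_def q_def mean_def)
  then obtain C where C: "C > 0" "((\<lambda>t. (1 - t) powr N * gen_fun q t) \<longlongrightarrow> C) (at_left 1)"
    using gen_fun_asymptotics by metis
  have lim: "((\<lambda>t. (1 - t) powr N * (\<Sum>a\<in>\<Delta>. gen_fun (power_traces a) t)) \<longlongrightarrow> C) (at_left 1)"
    if \<Delta>: "finite_orthogonal_subgroup \<Delta>" for \<Delta> :: "(real^'n^'n) set"
  proof -
    note G = finite_orthogonal_subgroup_facts[OF \<Delta>]
    have q1: "power_traces (mat 1 :: real^'n^'n) = q" by (simp add: fun_eq_iff q_def N_def trace_I)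
    have m1: "mean (card \<Delta>) q = N" using card_pos[OF \<Delta>] by (simp add: mean_def q_def)
    obtain D where D: "\<And>a. a \<in> \<Delta> \<Longrightarrow> ((\<lambda>t. (1 - t) powr mean (card \<Delta>) (power_traces a) * gen_fun
        (power_traces a) t) \<longlongrightarrow> D a) (at_left 1)"
      using gen_fun_asymptotics[OF periodic_power_traces[OF \<Delta>]] by metis
    have "((\<lambda>t. (1 - t) powr N * (\<Sum>a\<in>\<Delta>. gen_fun (power_traces a) t)) \<longlongrightarrow>
        (\<Sum>a\<in>{a\<in>\<Delta>. mean (card \<Delta>) (power_traces a) = N}. D a)) (at_left 1)"
      using G(1) periodic_power_traces[OF \<Delta>] mean_power_traces_le[OF \<Delta>] D unfolding N_def
      by (intro sum_gen_fun_asymptotics) auto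
    moreover have "{a\<in>\<Delta>. mean (card \<Delta>) (power_traces a) = N} = {mat 1}"
    proof (intro equalityI subsetI)
      fix a assume "a \<in> {mat 1 :: real^'n^'n}"
      then have "a = mat 1" by simp
      then show "a \<in> {a\<in>\<Delta>. mean (card \<Delta>) (power_traces a) = N}" using G(2) m1 unfolding
          q1[symmetric] by blast
    next
      fix a assume "a \<in> {a\<in>\<Delta>. mean (card \<Delta>) (power_traces a) = N}"
      then have "a = mat 1" by (intro mean_power_traces_eq[OF \<Delta>]) (auto simp: N_def)
      then show "a \<in> {mat 1}" by simp
    qed
    moreover have "D (mat 1) = C"
      using tendsto_unique[OF trivial_limit_at_left_real D[OF G(2), unfolded q1 m1] C(2)] .
    ultimately show ?thesis by simp
  qed
  have "eventually (\<lambda>t. 1 / real (card \<Gamma>) * ((1 - t) powr N * (\<Sum>a\<in>\<Gamma>. gen_fun (power_traces a) t))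
     = 1 / real (card \<Gamma>') * ((1 - t) powr N * (\<Sum>a\<in>\<Gamma>'. gen_fun (power_traces a) t))) (at_left
         (1::real))"
  proof (rule eventually_mono[OF eventually_at_left_real[of 0 1]])
    fix t :: real assume t: "t \<in> {0<..<1}"
    have e: "1 / real (card \<Gamma>) * (\<Sum>a\<in>\<Gamma>. complete_symmetric (power_traces a) k)
        = 1 / real (card \<Gamma>') * (\<Sum>a\<in>\<Gamma>'. complete_symmetric (power_traces a) k)" for k
      using iso[unfolded isospectral_iff_complete_symmetric[OF assms(1) \<Gamma> \<Gamma>'], rule_format, of k]
          by simp
    have "1 / real (card \<Gamma>) * (\<Sum>a\<in>\<Gamma>. gen_fun (power_traces a) t) = 1 / real (card \<Gamma>') * (\<Sum>a\<in>\<Gamma>'.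
        gen_fun (power_traces a) t)"
      by (rule sum_gen_fun_eq[OF finite_orthogonal_subgroup_facts(1)[OF \<Gamma>]
          finite_orthogonal_subgroup_facts(1)[OF \<Gamma>']
            periodic_power_traces[OF \<Gamma>] periodic_power_traces[OF \<Gamma>'] e]) (use t in auto)
    then show "1 / real (card \<Gamma>) * ((1 - t) powr N * (\<Sum>a\<in>\<Gamma>. gen_fun (power_traces a) t))
     = 1 / real (card \<Gamma>') * ((1 - t) powr N * (\<Sum>a\<in>\<Gamma>'. gen_fun (power_traces a) t))"
      by (simp only: mult.left_commute[of _ "(1 - t) powr N"])
  qed auto
  from Lim_transform_eventually[OF tendsto_mult_left[OF lim[OF \<Gamma>]] this] tendsto_mult_left[OF
      lim[OF \<Gamma>']]
  have "1 / real (card \<Gamma>) * C = 1 / real (card \<Gamma>') * C"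
    using tendsto_unique[OF trivial_limit_at_left_real] by blast
  then show ?thesis using C(1) card_pos[OF \<Gamma>] card_pos[OF \<Gamma>'] by simp
qed

text \<open>
  Every group of order at most 7 has such a presentation: the cyclic groups with \<open>b = 1\<close>, the Klein
  four-group with \<open>(a, b, e) = (2, 2, 1)\<close>, and the groups of order 6 with \<open>(3, 2, 1)\<close> and \<open>(3, 2, 2)\<close>.
\<close>

definition metacyclic :: "(real^'n^'n) set \<Rightarrow> nat \<Rightarrow> nat \<Rightarrow> nat \<Rightarrow> real^'n^'n \<Rightarrow> real^'n^'n \<Rightarrow> bool" where
  "metacyclic \<Gamma> a b e r s \<longleftrightarrow> bij_betw (\<lambda>(i, j). mpow r i ** mpow s j) ({..<a} \<times> {..<b}) \<Gamma> \<and>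
     mpow r a = mat 1 \<and> mpow s b = mat 1 \<and> s ** r = mpow r e ** s"

lemma metacyclic_commute:
  assumes "s ** r = mpow r e ** s"
  shows "mpow s j ** mpow r k = mpow r (e ^ j * k) ** mpow s j"
proof -
  have 1: "s ** mpow r k = mpow r (e * k) ** s" for k
  proof (induction k)
    case (Suc k)
    have "s ** mpow r (Suc k) = (s ** r) ** mpow r k" by (simp add: matrix_mul_assoc)
    also have "\<dots> = mpow r e ** (s ** mpow r k)" by (simp add: assms matrix_mul_assoc)
    also have "\<dots> = mpow r (e * Suc k) ** s" by (simp add: Suc mpow_add matrix_mul_assoc)
    finally show ?case .
  qed simp
  show ?thesis
  proof (induction j)
    case (Suc j)
    have "mpow s (Suc j) ** mpow r k = s ** (mpow s j ** mpow r k)" by (simp add: matrix_mul_assoc)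
    also have "\<dots> = (s ** mpow r (e ^ j * k)) ** mpow s j" by (simp add: Suc matrix_mul_assoc)
    also have "\<dots> = mpow r (e ^ Suc j * k) ** mpow s (Suc j)" by (simp add: 1 matrix_mul_assoc
        mult.assoc)
    finally show ?case .
  qed simp
qed

text \<open>The multiplication table depends on \<open>a\<close>, \<open>b\<close>, \<open>e\<close>
  alone, so two groups with the same parameters are isomorphic by matching exponents.\<close>

lemma metacyclic_mult:
  assumes "metacyclic \<Gamma> a b e r s"
  shows "(mpow r i ** mpow s j) ** (mpow r k ** mpow s l)
    = mpow r ((i + e ^ j * k) mod a) ** mpow s ((j + l) mod b)"
proof -
  have m: "mpow r a = mat 1" "mpow s b = mat 1" "s ** r = mpow r e ** s" using assms by (auto
      simp: metacyclic_def)
  have "(mpow r i ** mpow s j) ** (mpow r k ** mpow s l) = mpow r i ** (mpow s j ** mpow r k) **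
      mpow s l"
    by (simp add: matrix_mul_assoc)
  also have "\<dots> = mpow r (i + e ^ j * k) ** mpow s (j + l)"
    by (simp add: metacyclic_commute[OF m(3)] mpow_add matrix_mul_assoc)
  finally show ?thesis using m by (simp add: mpow_mod)
qed

text \<open>Matching exponents is a homomorphism by \<open>metacyclic_mult\<close>. With equal
  traces it is realised by conjugation with an orthogonal matrix, which induces an isometry.\<close>

lemma metacyclic_isometric:
  fixes \<Gamma> \<Gamma>' :: "(real^'n^'n) set"
  assumes \<Gamma>: "finite_orthogonal_subgroup \<Gamma>" and \<Gamma>': "finite_orthogonal_subgroup \<Gamma>'"
    and mc: "metacyclic \<Gamma> a b e r s" and mc': "metacyclic \<Gamma>' a b e r' s'"
    and tr: "\<And>i j. i < a \<Longrightarrow> j < b \<Longrightarrow> trace (mpow r i ** mpow s j) = trace (mpow r' i ** mpow s' j)"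
  shows "isometric_orbifolds \<Gamma> \<Gamma>'"
proof -
  note G = finite_orthogonal_subgroup_facts[OF \<Gamma>] and G' = finite_orthogonal_subgroup_facts[OF \<Gamma>']
  define I where "I = {..<a} \<times> {..<b}"
  define \<rho> where "\<rho> = (\<lambda>(i, j). mpow r i ** mpow s j)"
  define \<rho>' where "\<rho>' = (\<lambda>(i, j). mpow r' i ** mpow s' j)"
  have bij: "bij_betw \<rho> I \<Gamma>" "bij_betw \<rho>' I \<Gamma>'"
    using mc mc' by (auto simp: metacyclic_def I_def \<rho>_def \<rho>'_def)
  define h where "h = (\<lambda>x. \<rho>' (inv_into I \<rho> x))"
  have h\<rho>: "h (\<rho> i) = \<rho>' i" if "i \<in> I" for i
    using bij(1) that by (simp add: h_def bij_betw_def inv_into_f_f)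
  have \<Gamma>E: "\<exists>i\<in>I. x = \<rho> i" if "x \<in> \<Gamma>" for x using bij(1) that by (auto simp: bij_betw_def)
  have "I \<noteq> {}" using bij(1) G(2) by (auto simp: bij_betw_def)
  then have ab: "a > 0" "b > 0" by (auto simp: I_def)
  define m where "m = (\<lambda>(i, j) (k, l). ((i + e ^ j * k) mod a, (j + l) mod b))"
  have mI: "m u v \<in> I" for u v using ab by (auto simp: m_def I_def split: prod.splits)
  have m\<rho>: "\<rho> u ** \<rho> v = \<rho> (m u v)" "\<rho>' u ** \<rho>' v = \<rho>' (m u v)" for u v
    using metacyclic_mult[OF mc] metacyclic_mult[OF mc'] by (auto simp: \<rho>_def \<rho>'_def m_def split:
        prod.splits)
  have "\<exists>U. orthogonal_matrix U \<and> (\<forall>x\<in>\<Gamma>. U ** x = h x ** U)"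
  proof (rule orthogonal_conjugacy_of_equal_traces)
    show "finite \<Gamma>" "mat 1 \<in> \<Gamma>" by (fact G)+
    fix x assume x: "x \<in> \<Gamma>"
    then obtain u where u: "u \<in> I" "x = \<rho> u" using \<Gamma>E by blast
    show "orthogonal_matrix x" using x by (rule G)
    show "orthogonal_matrix (h x)" using u h\<rho> bij(2) G'(4) by (auto simp: bij_betw_def)
    show "trace (h x) = trace x" using u h\<rho> tr by (auto simp: I_def \<rho>_def \<rho>'_def)
    fix y assume y: "y \<in> \<Gamma>"
    then obtain v where v: "v \<in> I" "y = \<rho> v" using \<Gamma>E by blast
    show "x ** y \<in> \<Gamma>" using x y by (rule G)
    show "h (x ** y) = h x ** h y" using u v m\<rho> h\<rho> mI by simp
  qed
  then obtain U where U: "orthogonal_matrix U" "\<And>x. x \<in> \<Gamma> \<Longrightarrow> U ** x = h x ** U" by blast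
  have "U ** x ** transpose U = h x" if "x \<in> \<Gamma>" for x
    using U(1) by (simp add: U(2)[OF that] orthogonal_matrix_def flip: matrix_mul_assoc)
  then have "(\<lambda>x. U ** x ** transpose U) ` \<Gamma> = h ` \<Gamma>" by (rule image_cong[OF refl])
  also have "\<dots> = h ` \<rho> ` I" using bij(1) by (simp add: bij_betw_def)
  also have "\<dots> = \<rho>' ` I" unfolding image_image by (rule image_cong[OF refl]) (rule h\<rho>)
  also have "\<dots> = \<Gamma>'" using bij(2) by (simp add: bij_betw_def)
  finally show ?thesis using isometric_orbifolds_conjugate[OF U(1)] by blast
qed

lemma metacyclicI:
  assumes \<Gamma>: "finite_orthogonal_subgroup \<Gamma>" and "r \<in> \<Gamma>" "s \<in> \<Gamma>" "card \<Gamma> = a * b"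
    and inj: "inj_on (\<lambda>(i, j). mpow r i ** mpow s j) ({..<a} \<times> {..<b})"
    and "mpow r a = mat 1" "mpow s b = mat 1" "s ** r = mpow r e ** s"
  shows "metacyclic \<Gamma> a b e r s"
proof -
  note G = finite_orthogonal_subgroup_facts[OF \<Gamma>]
  have "(\<lambda>(i, j). mpow r i ** mpow s j) ` ({..<a} \<times> {..<b}) = \<Gamma>"
  proof (rule card_subset_eq[OF G(1)])
    show "(\<lambda>(i, j). mpow r i ** mpow s j) ` ({..<a} \<times> {..<b}) \<subseteq> \<Gamma>"
      using assms(2,3) G(3) mpow_closed[OF \<Gamma>] by auto
    show "card ((\<lambda>(i, j). mpow r i ** mpow s j) ` ({..<a} \<times> {..<b})) = card \<Gamma>"
      using card_image[OF inj] assms(4) by simp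
  qed
  then show ?thesis using assms inj by (simp add: metacyclic_def bij_betw_def)
qed

lemma cyclic_metacyclic:
  assumes \<Gamma>: "finite_orthogonal_subgroup \<Gamma>" and r: "r \<in> \<Gamma>" "group.ord (grp \<Gamma>) r = card \<Gamma>"
  shows "metacyclic \<Gamma> (card \<Gamma>) 1 1 r (mat 1)"
proof (rule metacyclicI[OF \<Gamma>])
  show "inj_on (\<lambda>(i, j). mpow r i ** mpow (mat 1) j) ({..<card \<Gamma>} \<times> {..<1})"
    using mpow_inj[OF \<Gamma> r(1)] r(2) by (auto simp: inj_on_def)
  show "r \<in> \<Gamma>" "mat 1 \<in> \<Gamma>" by (fact r(1), fact finite_orthogonal_subgroup_facts(2)[OF \<Gamma>])
  show "mpow r (card \<Gamma>) = mat 1" by (rule mpow_card[OF \<Gamma> r(1)])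
  show "mat 1 ** r = mpow r 1 ** mat 1" by simp
qed simp_all

lemma ord_eq_1:
  assumes "finite_orthogonal_subgroup \<Gamma>" "r \<in> \<Gamma>" "group.ord (grp \<Gamma>) r = 1"
  shows "r = mat 1"
proof -
  have "mpow r 1 = mat 1" unfolding mpow_eq_1_iff[OF assms(1,2)] assms(3) by (rule dvd_refl)
  then show ?thesis by simp
qed

lemma prime_metacyclic:
  assumes \<Gamma>: "finite_orthogonal_subgroup \<Gamma>" and r: "r \<in> \<Gamma>" "r \<noteq> mat 1" and p: "prime (card \<Gamma>)"
  shows "metacyclic \<Gamma> (card \<Gamma>) 1 1 r (mat 1)"
proof (rule cyclic_metacyclic[OF \<Gamma> r(1)])
  have "group.ord (grp \<Gamma>) r = 1 \<or> group.ord (grp \<Gamma>) r = card \<Gamma>"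
    using ord_dvd_card[OF \<Gamma> r(1)] p unfolding prime_nat_iff by blast
  then show "group.ord (grp \<Gamma>) r = card \<Gamma>" using ord_eq_1[OF \<Gamma> r(1)] r(2) by blast
qed

lemma klein_metacyclic:
  assumes \<Gamma>: "finite_orthogonal_subgroup \<Gamma>" and c: "card \<Gamma> = 4"
    and sq: "\<And>x. x \<in> \<Gamma> \<Longrightarrow> x ** x = mat 1"
    and r: "r \<in> \<Gamma>" "r \<noteq> mat 1" and s: "s \<in> \<Gamma>" "s \<noteq> mat 1" "s \<noteq> r"
  shows "metacyclic \<Gamma> 2 2 1 r s"
proof (rule metacyclicI[OF \<Gamma>])
  note G = finite_orthogonal_subgroup_facts[OF \<Gamma>]
  have 1: "r ** s \<noteq> r"
  proof
    assume "r ** s = r"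
    then have "r ** s = r ** mat 1" by (simp only: matrix_mul_rid)
    then show False using orthogonal_left_cancel[OF G(4)[OF r(1)]] s(2) by blast
  qed
  have 2: "r ** s \<noteq> s"
  proof
    assume "r ** s = s"
    then have "r ** s = mat 1 ** s" by (simp only: matrix_mul_lid)
    then show False using orthogonal_right_cancel[OF G(4)[OF s(1)]] r(2) by blast
  qed
  have 3: "r ** s \<noteq> mat 1"
  proof
    assume "r ** s = mat 1"
    then have "r ** s = r ** r" by (simp only: sq[OF r(1)])
    then show False using orthogonal_left_cancel[OF G(4)[OF r(1)]] s(3) by blast
  qed
  note ne = 1 1[symmetric] 2 2[symmetric] 3 3[symmetric] r(2) r(2)[symmetric] s(2) s(2)[symmetric]
      s(3) s(3)[symmetric]
  show "inj_on (\<lambda>(i, j). mpow r i ** mpow s j) ({..<2} \<times> {..<2})"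
    by (rule inj_onI) (use ne in \<open>auto simp: less_2_cases_iff\<close>)
  have "(r ** s) ** (r ** s) = mat 1" by (intro sq G r s)
  then have "r ** ((r ** s) ** (r ** s)) ** s = r ** s" by simp
  then have "(r ** r) ** (s ** r) ** (s ** s) = r ** s" by (simp add: matrix_mul_assoc)
  then show "s ** r = mpow r 1 ** s" using sq r s by simp
qed (use c r s sq in \<open>auto simp: numeral_2_eq_2\<close>)

text \<open>Cauchy's theorem: take any nontrivial element of a subgroup of order
  \<open>p\<close>.\<close>

lemma sylow_element:
  assumes \<Gamma>: "finite_orthogonal_subgroup \<Gamma>" and p: "prime p" "card \<Gamma> = p * m"
  shows "\<exists>r\<in>\<Gamma>. r \<noteq> mat 1 \<and> mpow r p = mat 1"
proof -
  note G = finite_orthogonal_subgroup_facts[OF \<Gamma>]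
  have "\<exists>H. subgroup H (grp \<Gamma>) \<and> card H = p ^ 1"
    by (rule sylow_thm[OF p(1) group_grp[OF \<Gamma>], of 1 m])
      (simp_all only: grp_simps[OF \<Gamma>] p(2) G(1) power_one_right)
  then obtain H where H: "subgroup H (grp \<Gamma>)" "card H = p" by auto
  have "H \<subseteq> \<Gamma>" using subgroup.subset[OF H(1)] grp_simps[OF \<Gamma>] by simp
  have "subgroup H orthogonal_group"
    using group.incl_subgroup[OF group_orthogonal_group _ H(1)] \<Gamma> by (simp add:
        finite_orthogonal_subgroup_def)
  then have fosH: "finite_orthogonal_subgroup H"
    using \<open>H \<subseteq> \<Gamma>\<close> G(1) finite_subset by (auto simp: finite_orthogonal_subgroup_def)
  have "p > 1" using p(1) unfolding prime_nat_iff by blast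
  then obtain r where "r \<in> H" "r \<noteq> mat 1"
  proof -
    have "H \<noteq> {mat 1}" using H(2) \<open>p > 1\<close> by auto
    then show ?thesis using that finite_orthogonal_subgroup_facts(2)[OF fosH] by blast
  qed
  then show ?thesis using mpow_card[OF fosH] H(2) \<open>H \<subseteq> \<Gamma>\<close> by auto
qed

section \<open>Newton's identities and numbers recovered from power sums\<close>

lemma sum_lessThan_numerals:
  fixes f :: "nat \<Rightarrow> real"
  shows "(\<Sum>i<2. f i) = f 0 + f 1" "(\<Sum>i<3. f i) = f 0 + f 1 + f 2" "(\<Sum>i<4. f i) = f 0 + f 1 + f 2 +
      f 3"
    "(\<Sum>i<5. f i) = f 0 + f 1 + f 2 + f 3 + f 4" "(\<Sum>i<6. f i) = f 0 + f 1 + f 2 + f 3 + f 4 + f 5"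
    "(\<Sum>i<7. f i) = f 0 + f 1 + f 2 + f 3 + f 4 + f 5 + f 6"
  by (simp_all add: eval_nat_numeral)

lemma complete_symmetric_low_degree:
  "complete_symmetric p 1 = p 1"
  "complete_symmetric p 2 = (p 1 ^ 2 + p 2) / 2"
  "complete_symmetric p 3 = (p 1 ^ 3 + 3 * p 1 * p 2 + 2 * p 3) / 6"
  "complete_symmetric p 4 = (p 1 ^ 4 + 6 * p 1 ^ 2 * p 2 + 3 * p 2 ^ 2 + 8 * p 1 * p 3 + 6 * p 4)
      / 24"
  by (simp_all add: eval_nat_numeral complete_symmetric.simps(2) field_simps)

lemma power_sums_2:
  fixes y :: real
  assumes "Y + Z = y + z" "Y ^ 2 + Z ^ 2 = y ^ 2 + z ^ 2"
  shows "Y = y \<and> Z = z \<or> Y = z \<and> Z = y"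
proof -
  have Z: "Z = y + z - Y" using assms(1) by simp
  have "(Y - y) * (Y - z) = 0"
    using assms(2) unfolding Z by (simp add: power2_eq_square algebra_simps)
  then show ?thesis using Z by auto
qed

lemma power_sums_3:
  fixes x :: real
  assumes 1: "X + Y + Z = x + y + z" and 2: "X ^ 2 + Y ^ 2 + Z ^ 2 = x ^ 2 + y ^ 2 + z ^ 2"
    and 3: "X ^ 3 + Y ^ 3 + Z ^ 3 = x ^ 3 + y ^ 3 + z ^ 3"
  shows "X = x \<and> (Y = y \<and> Z = z \<or> Y = z \<and> Z = y) \<or> X = y \<and> (Y = x \<and> Z = z \<or> Y = z \<and> Z = x)
    \<or> X = z \<and> (Y = x \<and> Z = y \<or> Y = y \<and> Z = x)"
proof -
  have "2 * (X * Y + Y * Z + Z * X) = (X + Y + Z) ^ 2 - (X ^ 2 + Y ^ 2 + Z ^ 2)" by (simp add: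
      power2_eq_square power3_eq_cube algebra_simps)
  also have "\<dots> = 2 * (x * y + y * z + z * x)" unfolding 1 2 by (simp add: power2_eq_square
      power3_eq_cube algebra_simps)
  finally have e2: "X * Y + Y * Z + Z * X = x * y + y * z + z * x" by simp
  have "3 * (X * Y * Z) = X ^ 3 + Y ^ 3 + Z ^ 3 - (X + Y + Z) * (X ^ 2 + Y ^ 2 + Z ^ 2 - (X * Y +
      Y * Z + Z * X))" by (simp add: power2_eq_square power3_eq_cube algebra_simps)
  also have "\<dots> = 3 * (x * y * z)" unfolding 1 2 3 e2 by (simp add: power2_eq_square power3_eq_cube
      algebra_simps)
  finally have e3: "X * Y * Z = x * y * z" by simp
  have "(X - x) * (X - y) * (X - z) = X ^ 3 - (x + y + z) * X ^ 2 + (x * y + y * z + z * x) * X -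
      x * y * z" by (simp add: power2_eq_square power3_eq_cube algebra_simps)
  also have "\<dots> = 0" unfolding 1[symmetric] e2[symmetric] e3[symmetric] by (simp add:
      power2_eq_square power3_eq_cube algebra_simps)
  finally have "X = x \<or> X = y \<or> X = z" by auto
  then show ?thesis
  proof (elim disjE)
    assume X: "X = x"
    then show ?thesis using power_sums_2[of Y Z y z] 1 2 by simp
  next
    assume X: "X = y"
    then show ?thesis using power_sums_2[of Y Z x z] 1 2 by simp
  next
    assume X: "X = z"
    then show ?thesis using power_sums_2[of Y Z x y] 1 2 by simp
  qed
qed

text \<open>Power sums determine the triple up to order. An odd permutation changes the extra cyclic
  polynomial by the Vandermonde product (\<open>key\<close>), so an odd match forces two equal
  entries and is then also a cyclic match. For order 7 only cyclic permutations of the three traces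
  come from automorphisms.\<close>

lemma cyclic_power_sums_3:
  fixes x :: real
  assumes "X + Y + Z = x + y + z" "X ^ 2 + Y ^ 2 + Z ^ 2 = x ^ 2 + y ^ 2 + z ^ 2"
    "X ^ 3 + Y ^ 3 + Z ^ 3 = x ^ 3 + y ^ 3 + z ^ 3" and
    4: "X ^ 2 * Y + Y ^ 2 * Z + Z ^ 2 * X = x ^ 2 * y + y ^ 2 * z + z ^ 2 * x"
  shows "X = x \<and> Y = y \<and> Z = z \<or> X = y \<and> Y = z \<and> Z = x \<or> X = z \<and> Y = x \<and> Z = y"
proof -
  have key: "(x - y) * (y - z) * (z - x) = (x ^ 2 * z + z ^ 2 * y + y ^ 2 * x) - (x ^ 2 * y + y ^
      2 * z + z ^ 2 * x)"
    by (simp add: power2_eq_square power3_eq_cube algebra_simps)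
  have odd: "x = y \<or> y = z \<or> z = x" if "X ^ 2 * Y + Y ^ 2 * Z + Z ^ 2 * X = x ^ 2 * z + z ^ 2 * y
      + y ^ 2 * x"
    using key that 4 by simp
  consider "X = x \<and> Y = y \<and> Z = z \<or> X = y \<and> Y = z \<and> Z = x \<or> X = z \<and> Y = x \<and> Z = y"
    | "X = x \<and> Y = z \<and> Z = y \<or> X = y \<and> Y = x \<and> Z = z \<or> X = z \<and> Y = y \<and> Z = x"
    using power_sums_3[OF assms(1-3)] by blast
  then show ?thesis
  proof cases
    case 2
    then have "X ^ 2 * Y + Y ^ 2 * Z + Z ^ 2 * X = x ^ 2 * z + z ^ 2 * y + y ^ 2 * x" by auto
    then show ?thesis using odd 2 by blast
  qed blast
qed

lemma metacyclic_sum: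
  assumes "metacyclic \<Gamma> a b e r s"
  shows "(\<Sum>g\<in>\<Gamma>. \<phi> g) = (\<Sum>i<a. \<Sum>j<b. \<phi> (mpow r i ** mpow s j))"
proof -
  have "(\<Sum>g\<in>\<Gamma>. \<phi> g) = (\<Sum>u\<in>{..<a} \<times> {..<b}. \<phi> ((\<lambda>(i, j). mpow r i ** mpow s j) u))"
    using assms by (intro sum.reindex_bij_betw[symmetric]) (simp add: metacyclic_def)
  then show ?thesis by (simp add: sum.cartesian_product case_prod_beta')
qed

lemma power_traces_mpow: "mpow r n = mat 1 \<Longrightarrow> power_traces (mpow r i) j = trace (mpow r ((i * j)
    mod n))"
  by (simp add: mpow_mod mpow_mult)

text \<open>For orthogonal matrices the inverse is the transpose, which has the same trace.\<close>

lemma trace_mpow_reflect: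
  assumes "orthogonal_matrix r" "mpow r n = mat 1" "i \<le> n"
  shows "trace (mpow r (n - i)) = trace (mpow r i)"
proof -
  have "mpow r i ** mpow r (n - i) = mpow r i ** transpose (mpow r i)"
    using assms orthogonal_matrix_mpow[OF assms(1), of i] mpow_add[of r i "n - i"]
    by (simp add: orthogonal_matrix_def)
  then have "mpow r (n - i) = transpose (mpow r i)"
    using orthogonal_left_cancel orthogonal_matrix_mpow[OF assms(1)] by blast
  then show ?thesis by (simp add: trace_transpose)
qed

section \<open>Structure of the groups of order at most 7\<close>

lemma isometric_card_1:
  assumes \<Gamma>: "finite_orthogonal_subgroup \<Gamma>" and \<Gamma>': "finite_orthogonal_subgroup \<Gamma>'"
    and card: "card \<Gamma> = 1" "card \<Gamma>' = 1"
  shows "isometric_orbifolds \<Gamma> \<Gamma>'"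
proof -
  have "\<Gamma> = {mat 1}" "\<Gamma>' = {mat 1}"
    using card finite_orthogonal_subgroup_facts(2)[OF \<Gamma>] finite_orthogonal_subgroup_facts(2)[OF \<Gamma>']
    by (auto simp: card_1_singleton_iff)
  then show ?thesis
    by (intro isometric_orbifolds_conjugate[of "mat 1"]) (auto simp: orthogonal_matrix_id)
qed

lemma exists_nontrivial:
  assumes "card \<Gamma> > 1"
  shows "\<exists>r\<in>\<Gamma>. r \<noteq> mat 1"
proof (rule ccontr)
  assume "\<not> ?thesis"
  then have "\<Gamma> \<subseteq> {mat 1}" by auto
  then have "card \<Gamma> \<le> 1" using card_mono[of "{mat 1}" \<Gamma>] by simp
  then show False using assms by simp
qed

lemma prime_power_nontrivial:
  assumes \<Gamma>: "finite_orthogonal_subgroup \<Gamma>" and r: "r \<in> \<Gamma>" "r \<noteq> mat 1" and p: "prime (card \<Gamma>)"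
    and c: "0 < c" "c < card \<Gamma>"
  shows "mpow r c \<noteq> mat 1"
proof -
  have "group.ord (grp \<Gamma>) r = 1 \<or> group.ord (grp \<Gamma>) r = card \<Gamma>"
    using ord_dvd_card[OF \<Gamma> r(1)] p unfolding prime_nat_iff by blast
  then have "group.ord (grp \<Gamma>) r = card \<Gamma>" using ord_eq_1[OF \<Gamma> r(1)] r(2) by blast
  then show ?thesis using mpow_eq_1_iff[OF \<Gamma> r(1)] c by (auto dest: dvd_imp_le)
qed

text \<open>The exponent \<open>c\<close> stands for the automorphism of the cyclic group that
  raises elements to the power \<open>c\<close>; the traces have to match only after applying
  it.\<close>

lemma prime_isometric:
  assumes \<Gamma>: "finite_orthogonal_subgroup \<Gamma>" and \<Gamma>': "finite_orthogonal_subgroup \<Gamma>'"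
    and n: "card \<Gamma> = n" "card \<Gamma>' = n" "prime n"
    and r: "r \<in> \<Gamma>" "r \<noteq> mat 1" and r': "r' \<in> \<Gamma>'" "r' \<noteq> mat 1"
    and c: "0 < c" "c < n" and tr: "\<And>i. i < n \<Longrightarrow> trace (mpow r i) = trace (mpow r' ((c * i) mod n))"
  shows "isometric_orbifolds \<Gamma> \<Gamma>'"
proof -
  have 1: "metacyclic \<Gamma> n 1 1 r (mat 1)" using prime_metacyclic[OF \<Gamma> r] n by simp
  have "mpow r' c \<noteq> mat 1" using prime_power_nontrivial[OF \<Gamma>' r'] n c by simp
  then have 2: "metacyclic \<Gamma>' n 1 1 (mpow r' c) (mat 1)"
    using prime_metacyclic[OF \<Gamma>' mpow_closed[OF \<Gamma>' r'(1)], of c] n by simp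
  have r'n: "mpow r' n = mat 1" using mpow_card[OF \<Gamma>' r'(1)] n by simp
  show ?thesis
    by (rule metacyclic_isometric[OF \<Gamma> \<Gamma>' 1 2]) (simp add: tr power_traces_mpow[OF r'n])
qed

lemma order_4_cases:
  assumes \<Gamma>: "finite_orthogonal_subgroup \<Gamma>" and c: "card \<Gamma> = 4"
  shows "(\<exists>r\<in>\<Gamma>. r ** r \<noteq> mat 1 \<and> metacyclic \<Gamma> 4 1 1 r (mat 1)) \<or> (\<forall>r\<in>\<Gamma>. r ** r = mat 1)"
proof (cases "\<forall>r\<in>\<Gamma>. r ** r = mat 1")
  case False
  then obtain r where r: "r \<in> \<Gamma>" "r ** r \<noteq> mat 1" by blast
  let ?o = "group.ord (grp \<Gamma>) r"
  have "\<not> ?o dvd 2" using mpow_eq_1_iff[OF \<Gamma> r(1), of 2] r(2) by (simp add: numeral_2_eq_2)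
  moreover have "?o dvd 4" using ord_dvd_card[OF \<Gamma> r(1)] c by simp
  ultimately have "?o = 4"
  proof -
    have "?o \<le> 4" using \<open>?o dvd 4\<close> by (auto dest: dvd_imp_le)
    then have "?o = 0 \<or> ?o = 1 \<or> ?o = 2 \<or> ?o = 3 \<or> ?o = 4" by linarith
    then show ?thesis using \<open>?o dvd 4\<close> \<open>\<not> ?o dvd 2\<close> by (elim disjE) (simp_all only:, simp_all)
  qed
  then have "metacyclic \<Gamma> 4 1 1 r (mat 1)" using cyclic_metacyclic[OF \<Gamma> r(1)] c by simp
  then show ?thesis using r by blast
qed blast

text \<open>Elements \<open>r\<close> of order 3 and \<open>s\<close> of order 2 generate the group,
  and the only freedom is the exponent in \<open>s ** r = mpow r i ** s\<close>: 1 for the cyclic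
  and 2 for the dihedral group.\<close>

lemma order_6_metacyclic:
  assumes \<Gamma>: "finite_orthogonal_subgroup \<Gamma>" and c: "card \<Gamma> = 6"
  shows "\<exists>r\<in>\<Gamma>. \<exists>s\<in>\<Gamma>. r \<noteq> mat 1 \<and> s \<noteq> mat 1 \<and> (metacyclic \<Gamma> 3 2 1 r s \<or> metacyclic \<Gamma> 3 2 2 r s)"
proof -
  note G = finite_orthogonal_subgroup_facts[OF \<Gamma>]
  obtain r where r: "r \<in> \<Gamma>" "r \<noteq> mat 1" "mpow r 3 = mat 1" using sylow_element[OF \<Gamma>, of 3 2] c by
      auto
  obtain s where s: "s \<in> \<Gamma>" "s \<noteq> mat 1" "mpow s 2 = mat 1" using sylow_element[OF \<Gamma>, of 2 3] c by
      auto
  have or: "group.ord (grp \<Gamma>) r = 3"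
  proof -
    have "group.ord (grp \<Gamma>) r dvd 3" using mpow_eq_1_iff[OF \<Gamma> r(1)] r(3) by blast
    moreover have "group.ord (grp \<Gamma>) r \<noteq> 1" using ord_eq_1[OF \<Gamma> r(1)] r(2) by blast
    moreover have "prime (3::nat)" by simp
    ultimately show ?thesis unfolding prime_nat_iff by blast
  qed
  \<comment> \<open>The cube of a power of \<open>r\<close> is the identity, whereas the cube of
    \<open>s\<close> is \<open>s\<close>.\<close>
  have s_notin: "s \<noteq> mpow r i" for i
  proof
    assume "s = mpow r i"
    then have "mpow s 3 = mat 1" using mpow_mult[of r i 3] mpow_mult[of r 3 i] r(3) by (simp add:
        mult.commute)
    moreover have "mpow s 3 = s" using s(3) by (simp add: numeral_3_eq_3 numeral_2_eq_2
        matrix_mul_assoc)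
    ultimately show False using s(2) by simp
  qed
  have inj: "inj_on (\<lambda>(i, j). mpow r i ** mpow s j) ({..<3} \<times> {..<2})"
  proof (rule inj_onI)
    fix u v assume uv: "u \<in> {..<3::nat} \<times> {..<2::nat}" "v \<in> {..<3::nat} \<times> {..<2::nat}"
      and e: "(\<lambda>(i, j). mpow r i ** mpow s j) u = (\<lambda>(i, j). mpow r i ** mpow s j) v"
    obtain i j k l where u: "u = (i, j)" and v: "v = (k, l)" by (cases u, cases v) blast
    have ij: "i \<in> {..<3}" "j \<in> {..<2}" and kl: "k \<in> {..<3}" "l \<in> {..<2}"
      and eq: "mpow r i ** mpow s j = mpow r k ** mpow s l"
      using uv e by (auto simp: u v)
    have *: False if "mpow r i ** s = mpow r k" "i < 3" for i k
    proof -
      have "mpow r (3 - i) ** mpow r i = mpow r (3 - i + i)" by (rule mpow_add[symmetric])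
      then have "mpow r (3 - i) ** mpow r i = mat 1" using that(2) r(3) by simp
      then have "s = (mpow r (3 - i) ** mpow r i) ** s" by simp
      also have "\<dots> = mpow r (3 - i) ** mpow r k" by (simp add: that(1) flip: matrix_mul_assoc)
      also have "\<dots> = mpow r (3 - i + k)" by (rule mpow_add[symmetric])
      finally show False using s_notin by blast
    qed
    have jl: "j = 0 \<or> j = Suc 0" "l = 0 \<or> l = Suc 0" using ij kl by auto
    have "j = l" using *[of i k] *[of k i] eq ij kl jl by auto
    then have "mpow r i = mpow r k"
      using eq orthogonal_right_cancel[OF G(4)[OF s(1)]] jl(2) by auto
    then have "i = k" using mpow_inj[OF \<Gamma> r(1)] or ij kl by simp
    then show "u = v" using \<open>j = l\<close> u v by blast
  qed
  have img: "(\<lambda>(i, j). mpow r i ** mpow s j) ` ({..<3} \<times> {..<2}) = \<Gamma>"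
  proof (rule card_subset_eq[OF G(1)])
    show "(\<lambda>(i, j). mpow r i ** mpow s j) ` ({..<3} \<times> {..<2}) \<subseteq> \<Gamma>"
      using r s G(3) mpow_closed[OF \<Gamma>] by auto
    show "card ((\<lambda>(i, j). mpow r i ** mpow s j) ` ({..<3} \<times> {..<2})) = card \<Gamma>"
      using card_image[OF inj] c by simp
  qed
  have "s ** r \<in> \<Gamma>" using G(3) r s by blast
  then obtain i j where ij: "i < 3" "j < 2" "s ** r = mpow r i ** mpow s j" using img by force
  \<comment> \<open>Otherwise \<open>s\<close> would be a power of \<open>r\<close>.\<close>
  have "j \<noteq> 0"
  proof
    assume "j = 0"
    then have "s ** r = mpow r i" using ij by simp
    then have "s ** (r ** mpow r 2) = mpow r i ** mpow r 2" by (simp only: matrix_mul_assoc)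
    also have "\<dots> = mpow r (i + 2)" by (rule mpow_add[symmetric])
    finally have "s ** (r ** mpow r 2) = mpow r (i + 2)" .
    moreover have "r ** mpow r 2 = mat 1" using r(3) by (simp add: numeral_3_eq_3 numeral_2_eq_2)
    ultimately show False using s_notin by (metis matrix_mul_rid)
  qed
  then have j: "j = 1" using ij by simp
  have "i \<noteq> 0"
  proof
    assume "i = 0"
    then have "s ** r = s ** mat 1" using ij j by simp
    then show False using orthogonal_left_cancel[OF G(4)[OF s(1)]] r(2) by blast
  qed
  then have "i = 1 \<or> i = 2" using ij by linarith
  moreover have "metacyclic \<Gamma> 3 2 i r s"
    using ij j by (intro metacyclicI[OF \<Gamma> r(1) s(1) _ inj r(3) s(3)]) (simp_all add: c)
  ultimately show ?thesis using r s by blast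
qed

subsection \<open>Comparison of Molien series\<close>

text \<open>Periodic sequences as explicit lists: for a concrete group the pole orders become
  finitely many sums, whose maxima can be compared by simplification.\<close>

definition cycle_seq :: "real list \<Rightarrow> nat \<Rightarrow> real" where
  "cycle_seq L j = L ! (j mod length L)"

lemma periodic_cycle_seq: "L \<noteq> [] \<Longrightarrow> periodic (length L) (cycle_seq L)"
  by (simp add: periodic_def cycle_seq_def)

lemma mean_cycle_seq: "mean (length L) (cycle_seq L) = sum_list L / real (length L)"
  by (simp add: mean_def cycle_seq_def sum_list_sum_nth lessThan_atLeast0)

text \<open>Lists of lists and not sets, because different group elements may have the same power
  traces and each must be counted in the sums of \<open>eq\<close>.\<close>

lemma max_mean_cycle_seq_eq:
  assumes ne: "Ls \<noteq> []" "Ms \<noteq> []" and n: "n > 0" and len: "\<And>L. L \<in> set Ls \<union> set Ms \<Longrightarrow> length L = n"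
    and eq: "\<And>k. (\<Sum>L\<leftarrow>Ls. complete_symmetric (cycle_seq L) k) = (\<Sum>L\<leftarrow>Ms. complete_symmetric
        (cycle_seq L) k)"
  shows "Max (sum_list ` set Ls) = Max (sum_list ` set Ms)"
proof -
  have "Max ((\<lambda>i. mean n (cycle_seq (Ls ! i))) ` {..<length Ls}) = Max ((\<lambda>i. mean n (cycle_seq (Ms
      ! i))) ` {..<length Ms})"
  proof (rule max_mean_eq)
    show "periodic n (cycle_seq (Ls ! i))" if "i \<in> {..<length Ls}" for i
      using periodic_cycle_seq[of "Ls ! i"] len[of "Ls ! i"] n that by force
    show "periodic n (cycle_seq (Ms ! i))" if "i \<in> {..<length Ms}" for i
      using periodic_cycle_seq[of "Ms ! i"] len[of "Ms ! i"] n that by force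
    show "(\<Sum>i<length Ls. complete_symmetric (cycle_seq (Ls ! i)) k) = (\<Sum>i<length Ms.
        complete_symmetric (cycle_seq (Ms ! i)) k)" for k
      using eq[of k] by (simp add: sum_list_sum_nth lessThan_atLeast0)
    have "0 \<in> {..<length Ls}" "0 \<in> {..<length Ms}" using ne by simp_all
    then show "{..<length Ls} \<noteq> {}" "{..<length Ms} \<noteq> {}" by blast+
  qed (rule finite_lessThan)+
  moreover have "Max ((\<lambda>i. mean n (cycle_seq (Ls ! i))) ` {..<length Ls}) = Max (sum_list ` set
      Ls) / real n"
    if ne: "Ls \<noteq> []" and len: "\<And>L. L \<in> set Ls \<Longrightarrow> length L = n" for Ls
  proof -
    have "(\<lambda>i. mean n (cycle_seq (Ls ! i))) ` {..<length Ls} = (\<lambda>x. x / real n) ` sum_list ` set Ls"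
    proof -
      have "set Ls = (!) Ls ` {..<length Ls}" by (auto simp: set_conv_nth)
      then have "(\<lambda>i. mean n (cycle_seq (Ls ! i))) ` {..<length Ls} = (\<lambda>L. mean n (cycle_seq L)) `
          set Ls"
        by (simp only: image_image)
      also have "\<dots> = (\<lambda>L. sum_list L / real n) ` set Ls"
        by (rule image_cong[OF refl]) (use mean_cycle_seq len in metis)
      finally show ?thesis by (simp only: image_image)
    qed
    moreover have "mono (\<lambda>x. x / real n)" using n by (simp add: mono_def divide_right_mono)
    ultimately show ?thesis using mono_Max_commute[of "\<lambda>x. x / real n" "sum_list ` set Ls"] ne by
        simp
  qed
  ultimately have "Max (sum_list ` set Ls) / real n = Max (sum_list ` set Ms) / real n" using ne
      len by simp
  then show ?thesis using n by simp
qed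

text \<open>The comparison of pole orders at \<open>t = -1\<close>. Evenness of \<open>n\<close>
  keeps the sequence with alternating signs \<open>n\<close>-periodic.\<close>

lemma max_alternating_cycle_seq_eq:
  assumes ne: "Ls \<noteq> []" "Ms \<noteq> []" and n: "n > 0" "even n" and len: "\<And>L. L \<in> set Ls \<union> set Ms \<Longrightarrow>
      length L = n"
    and eq: "\<And>k. (\<Sum>L\<leftarrow>Ls. complete_symmetric (cycle_seq L) k) = (\<Sum>L\<leftarrow>Ms. complete_symmetric
        (cycle_seq L) k)"
  shows "Max ((\<lambda>L. \<Sum>j<n. (-1) ^ j * L ! j) ` set Ls) = Max ((\<lambda>L. \<Sum>j<n. (-1) ^ j * L ! j) ` set Ms)"
proof -
  define alt where "alt = (\<lambda>L. map (\<lambda>j. (-1) ^ j * L ! j) [0..<n] :: real list)"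
  have cs: "complete_symmetric (cycle_seq (alt L)) k = (-1) ^ k * complete_symmetric (cycle_seq L)
      k"
    if "length L = n" for L k
  proof -
    have "(-1::real) ^ (j mod n) = (-1) ^ j" for j
      using n(2) by (metis dvd_mod_iff minus_one_power_iff)
    then have "cycle_seq (alt L) = (\<lambda>j. (-1) ^ j * cycle_seq L j)"
      using that n(1) by (simp add: cycle_seq_def alt_def fun_eq_iff)
    then show ?thesis by (simp only: complete_symmetric_alternating)
  qed
  have sl: "sum_list (alt L) = (\<Sum>j<n. (-1) ^ j * L ! j)" for L
    by (simp add: alt_def interv_sum_list_conv_sum_set_nat lessThan_atLeast0)
  have "Max (sum_list ` set (map alt Ls)) = Max (sum_list ` set (map alt Ms))"
  proof (rule max_mean_cycle_seq_eq[where n = n])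
    fix k
    have "(\<Sum>L\<leftarrow>map alt Ls. complete_symmetric (cycle_seq L) k) = (-1) ^ k * (\<Sum>L\<leftarrow>Ls.
        complete_symmetric (cycle_seq L) k)"
      if "\<And>L. L \<in> set Ls \<Longrightarrow> length L = n" for Ls
      using that cs by (induction Ls) (simp_all add: algebra_simps)
    from this[of Ls] this[of Ms] show "(\<Sum>L\<leftarrow>map alt Ls. complete_symmetric (cycle_seq L) k) =
        (\<Sum>L\<leftarrow>map alt Ms. complete_symmetric (cycle_seq L) k)"
      using eq[of k] len by simp
  qed (use ne n in \<open>auto simp: alt_def\<close>)
  then show ?thesis by (simp add: image_image sl)
qed

text \<open>\<open>(r\<^sup>i s\<^sup>j)\<^sup>k = r\<^sup>u s\<^sup>v\<close> for \<open>(u, v) = exponent_pair a b e i j k\<close>.\<close>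

primrec exponent_pair :: "nat \<Rightarrow> nat \<Rightarrow> nat \<Rightarrow> nat \<Rightarrow> nat \<Rightarrow> nat \<Rightarrow> nat \<times> nat" where
  "exponent_pair a b e i j 0 = (0, 0)"
| "exponent_pair a b e i j (Suc k) = (case exponent_pair a b e i j k of (u, v) \<Rightarrow> ((i + e ^ j * u)
    mod a, (j + v) mod b))"

definition pair_trace :: "real^'n^'n \<Rightarrow> real^'n^'n \<Rightarrow> nat \<times> nat \<Rightarrow> real" where
  "pair_trace r s = (\<lambda>(u, v). trace (mpow r u ** mpow s v))"

lemma metacyclic_mpow:
  assumes "metacyclic \<Gamma> a b e r s"
  shows "trace (mpow (mpow r i ** mpow s j) k) = pair_trace r s (exponent_pair a b e i j k)"
proof -
  have "mpow (mpow r i ** mpow s j) k = (case exponent_pair a b e i j k of (u, v) \<Rightarrow> mpow r u **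
      mpow s v)"
    by (induction k) (auto simp: metacyclic_mult[OF assms] split: prod.splits)
  then show ?thesis by (simp add: pair_trace_def split: prod.splits)
qed

lemma metacyclic_in:
  assumes "metacyclic \<Gamma> a b e r s" "i < a" "j < b"
  shows "mpow r i ** mpow s j \<in> \<Gamma>"
  using assms by (force simp: metacyclic_def bij_betw_def)

lemma metacyclic_card:
  assumes "metacyclic \<Gamma> a b e r s"
  shows "card \<Gamma> = a * b"
  using assms bij_betw_same_card by (fastforce simp: metacyclic_def)

lemma metacyclic_power_traces:
  assumes \<Gamma>: "finite_orthogonal_subgroup \<Gamma>" and mc: "metacyclic \<Gamma> a b e r s" and ij: "i < a" "j < b"
  shows "power_traces (mpow r i ** mpow s j)
     = cycle_seq (map (\<lambda>k. pair_trace r s (exponent_pair a b e i j k)) [0..<a * b])"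
proof
  fix k
  have "periodic (a * b) (power_traces (mpow r i ** mpow s j))"
    using periodic_power_traces[OF \<Gamma> metacyclic_in[OF mc ij]] metacyclic_card[OF mc] by simp
  then have "power_traces (mpow r i ** mpow s j) k = power_traces (mpow r i ** mpow s j) (k mod (a
      * b))"
    by (rule periodic_mod[symmetric])
  then show "power_traces (mpow r i ** mpow s j) k
     = cycle_seq (map (\<lambda>k. pair_trace r s (exponent_pair a b e i j k)) [0..<a * b]) k"
    using ij by (simp add: cycle_seq_def metacyclic_mpow[OF mc])
qed

lemma metacyclic_molien:
  assumes \<Gamma>: "finite_orthogonal_subgroup \<Gamma>" and mc: "metacyclic \<Gamma> a b e r s"
  shows "(\<Sum>g\<in>\<Gamma>. complete_symmetric (power_traces g) k)
    = (\<Sum>i<a. \<Sum>j<b. complete_symmetric (cycle_seq (map (pair_trace r s) (map (exponent_pair a b e i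
        j) [0..<a * b]))) k)"
  unfolding metacyclic_sum[OF mc]
  by (intro sum.cong refl) (simp add: metacyclic_power_traces[OF \<Gamma> mc] comp_def)

text \<open>The exponent \<open>a * b - 1\<close> gives the inverse, whose trace is the same; this
  roughly halves the number of unknown traces.\<close>

lemma pair_trace_inverse:
  assumes \<Gamma>: "finite_orthogonal_subgroup \<Gamma>" and mc: "metacyclic \<Gamma> a b e r s" and ij: "i < a" "j < b"
  shows "pair_trace r s (exponent_pair a b e i j (a * b - 1)) = pair_trace r s (i, j)"
proof -
  let ?g = "mpow r i ** mpow s j"
  have g: "?g \<in> \<Gamma>" by (rule metacyclic_in[OF mc ij])
  have "trace (mpow ?g (a * b - 1)) = trace (mpow ?g 1)"
    using trace_mpow_reflect[OF finite_orthogonal_subgroup_facts(4)[OF \<Gamma> g] mpow_card[OF \<Gamma> g], of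
        1] metacyclic_card[OF mc] ij
    by (simp add: Suc_le_eq)
  then show ?thesis by (simp add: metacyclic_mpow[OF mc] pair_trace_def)
qed

text \<open>Invariance of the trace under exchanging two factors, in terms of exponents. It
  identifies the traces of the conjugate reflections in the dihedral group of order 6.\<close>

lemma pair_trace_swap:
  assumes mc: "metacyclic \<Gamma> a b e r s"
  shows "pair_trace r s ((i + e ^ j * k) mod a, (j + l) mod b) = pair_trace r s ((k + e ^ l * i)
      mod a, (l + j) mod b)"
  using trace_mul_sym[of "mpow r i ** mpow s j" "mpow r k ** mpow s l"]
  by (simp add: pair_trace_def metacyclic_mult[OF mc])

lemma pair_trace_0: "pair_trace r s (0, 0) = real CARD('n)" for r s :: "real^'n^'n"
  by (simp add: pair_trace_def trace_I)

lemma pair_trace_less: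
  fixes r s :: "real^'n^'n"
  assumes \<Gamma>: "finite_orthogonal_subgroup \<Gamma>" and mc: "metacyclic \<Gamma> a b e r s" and ij: "i < a" "j <
      b" "(i, j) \<noteq> (0, 0)"
  shows "pair_trace r s (i, j) < real CARD('n)"
proof -
  let ?g = "mpow r i ** mpow s j"
  have g: "orthogonal_matrix ?g" using metacyclic_in[OF mc ij(1,2)]
      finite_orthogonal_subgroup_facts(4)[OF \<Gamma>] by blast
  have "inj_on (\<lambda>(i, j). mpow r i ** mpow s j) ({..<a} \<times> {..<b})" using mc by (simp add:
      metacyclic_def bij_betw_def)
  from inj_onD[OF this, of "(i, j)" "(0, 0)"] ij have "?g \<noteq> mat 1" by auto
  then show ?thesis using trace_orthogonal_le[OF g] by (force simp: pair_trace_def)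
qed

text \<open>The traces are the entries of the Gram matrix of the powers of \<open>r\<close> under
  the Euclidean inner product of matrices. For \<open>c\<close> the real part of a character this
  expresses that eigenvalue multiplicities are nonnegative.\<close>

lemma power_traces_positive:
  fixes r :: "real^'n^'n" and c :: "nat \<Rightarrow> real"
  assumes r: "orthogonal_matrix r" "mpow r n = mat 1"
  shows "0 \<le> (\<Sum>i<n. \<Sum>j<n. c i * c j * power_traces r ((i + (n - j)) mod n))"
proof -
  have tr: "mpow r i \<bullet> mpow r j = power_traces r ((i + (n - j)) mod n)" if "j < n" for i j
  proof -
    have "mpow r j ** mpow r (n - j) = mpow r j ** transpose (mpow r j)"
      using that r orthogonal_matrix_mpow[OF r(1), of j] mpow_add[of r j "n - j"] by (simp add:
          orthogonal_matrix_def)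
    then have "mpow r (n - j) = transpose (mpow r j)"
      using orthogonal_left_cancel orthogonal_matrix_mpow[OF r(1)] by blast
    then have "trace (mpow r ((i + (n - j)) mod n)) = trace (mpow r i ** transpose (mpow r j))"
      by (simp add: mpow_mod[OF r(2)] mpow_add)
    also have "\<dots> = mpow r i \<bullet> mpow r j"
      by (simp add: trace_def inner_vec_def matrix_matrix_mult_def transpose_def)
    finally show ?thesis by simp
  qed
  have "0 \<le> (\<Sum>i<n. c i *\<^sub>R mpow r i) \<bullet> (\<Sum>j<n. c j *\<^sub>R mpow r j)" by simp
  also have "\<dots> = (\<Sum>i<n. \<Sum>j<n. c i * c j * (mpow r i \<bullet> mpow r j))"
    unfolding inner_sum_left by (intro sum.cong refl) (simp add: inner_sum_right sum_distrib_left
        mult_ac)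
  also have "\<dots> = (\<Sum>i<n. \<Sum>j<n. c i * c j * power_traces r ((i + (n - j)) mod n))"
    by (intro sum.cong refl) (simp add: tr)
  finally show ?thesis .
qed

lemma metacyclic_positive:
  assumes \<Gamma>: "finite_orthogonal_subgroup \<Gamma>" and mc: "metacyclic \<Gamma> a b e r s" and ij: "i < a" "j < b"
  shows "0 \<le> (\<Sum>u<a * b. \<Sum>v<a * b. c u * c v *
     (map (pair_trace r s) (map (exponent_pair a b e i j) [0..<a * b])) ! ((u + (a * b - v)) mod
         (a * b)))"
proof -
  let ?g = "mpow r i ** mpow s j"
  have g: "?g \<in> \<Gamma>" by (rule metacyclic_in[OF mc ij])
  have "0 \<le> (\<Sum>u<a*b. \<Sum>v<a*b. c u * c v * power_traces ?g ((u + (a*b - v)) mod (a*b)))"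
    using power_traces_positive[OF finite_orthogonal_subgroup_facts(4)[OF \<Gamma> g] mpow_card[OF \<Gamma> g]]
        metacyclic_card[OF mc] by simp
  then show ?thesis using ij by (simp add: metacyclic_mpow[OF mc])
qed

section \<open>Power tables and Molien sums of the individual groups\<close>

abbreviation molien_term :: "real list \<Rightarrow> nat \<Rightarrow> real" where
  "molien_term L \<equiv> complete_symmetric (cycle_seq L)"

lemma sum_lessThan_1: "(\<Sum>j<1. f j) = (f 0 :: real)" for f :: "nat \<Rightarrow> real"
  by simp

text \<open>Here and below the digits in the name are \<open>a\<close>, \<open>b\<close>,
  \<open>e\<close>, and the row for \<open>(i, j)\<close> lists the successive powers of
  \<open>mpow r i ** mpow s j\<close>. Rows that agree up to the trace symmetries are collected in
  the coefficients 2 and 3 of the \<open>molien\<close> lemmas.\<close>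

lemma exponent_pairs_211:
  "map (exponent_pair 2 1 1 0 0) [0..<2 * 1] = [(0, 0), (0, 0)]"
  "map (exponent_pair 2 1 1 1 0) [0..<2 * 1] = [(0, 0), (1, 0)]"
  by code_simp+

lemma exponent_pairs_311:
  "map (exponent_pair 3 1 1 0 0) [0..<3 * 1] = [(0, 0), (0, 0), (0, 0)]"
  "map (exponent_pair 3 1 1 1 0) [0..<3 * 1] = [(0, 0), (1, 0), (2, 0)]"
  "map (exponent_pair 3 1 1 2 0) [0..<3 * 1] = [(0, 0), (2, 0), (1, 0)]"
  by code_simp+

lemma exponent_pairs_411:
  "map (exponent_pair 4 1 1 0 0) [0..<4 * 1] = [(0, 0), (0, 0), (0, 0), (0, 0)]"
  "map (exponent_pair 4 1 1 1 0) [0..<4 * 1] = [(0, 0), (1, 0), (2, 0), (3, 0)]"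
  "map (exponent_pair 4 1 1 2 0) [0..<4 * 1] = [(0, 0), (2, 0), (0, 0), (2, 0)]"
  "map (exponent_pair 4 1 1 3 0) [0..<4 * 1] = [(0, 0), (3, 0), (2, 0), (1, 0)]"
  by code_simp+

lemma exponent_pairs_511:
  "map (exponent_pair 5 1 1 0 0) [0..<5 * 1] = [(0, 0), (0, 0), (0, 0), (0, 0), (0, 0)]"
  "map (exponent_pair 5 1 1 1 0) [0..<5 * 1] = [(0, 0), (1, 0), (2, 0), (3, 0), (4, 0)]"
  "map (exponent_pair 5 1 1 2 0) [0..<5 * 1] = [(0, 0), (2, 0), (4, 0), (1, 0), (3, 0)]"
  "map (exponent_pair 5 1 1 3 0) [0..<5 * 1] = [(0, 0), (3, 0), (1, 0), (4, 0), (2, 0)]"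
  "map (exponent_pair 5 1 1 4 0) [0..<5 * 1] = [(0, 0), (4, 0), (3, 0), (2, 0), (1, 0)]"
  by code_simp+

lemma exponent_pairs_711:
  "map (exponent_pair 7 1 1 0 0) [0..<7 * 1] = [(0, 0), (0, 0), (0, 0), (0, 0), (0, 0), (0, 0),
      (0, 0)]"
  "map (exponent_pair 7 1 1 1 0) [0..<7 * 1] = [(0, 0), (1, 0), (2, 0), (3, 0), (4, 0), (5, 0),
      (6, 0)]"
  "map (exponent_pair 7 1 1 2 0) [0..<7 * 1] = [(0, 0), (2, 0), (4, 0), (6, 0), (1, 0), (3, 0),
      (5, 0)]"
  "map (exponent_pair 7 1 1 3 0) [0..<7 * 1] = [(0, 0), (3, 0), (6, 0), (2, 0), (5, 0), (1, 0),
      (4, 0)]"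
  "map (exponent_pair 7 1 1 4 0) [0..<7 * 1] = [(0, 0), (4, 0), (1, 0), (5, 0), (2, 0), (6, 0),
      (3, 0)]"
  "map (exponent_pair 7 1 1 5 0) [0..<7 * 1] = [(0, 0), (5, 0), (3, 0), (1, 0), (6, 0), (4, 0),
      (2, 0)]"
  "map (exponent_pair 7 1 1 6 0) [0..<7 * 1] = [(0, 0), (6, 0), (5, 0), (4, 0), (3, 0), (2, 0),
      (1, 0)]"
  by code_simp+

lemma exponent_pairs_221:
  "map (exponent_pair 2 2 1 0 0) [0..<2 * 2] = [(0, 0), (0, 0), (0, 0), (0, 0)]"
  "map (exponent_pair 2 2 1 0 1) [0..<2 * 2] = [(0, 0), (0, 1), (0, 0), (0, 1)]"
  "map (exponent_pair 2 2 1 1 0) [0..<2 * 2] = [(0, 0), (1, 0), (0, 0), (1, 0)]"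
  "map (exponent_pair 2 2 1 1 1) [0..<2 * 2] = [(0, 0), (1, 1), (0, 0), (1, 1)]"
  by code_simp+

lemma exponent_pairs_321:
  "map (exponent_pair 3 2 1 0 0) [0..<3 * 2] = [(0, 0), (0, 0), (0, 0), (0, 0), (0, 0), (0, 0)]"
  "map (exponent_pair 3 2 1 0 1) [0..<3 * 2] = [(0, 0), (0, 1), (0, 0), (0, 1), (0, 0), (0, 1)]"
  "map (exponent_pair 3 2 1 1 0) [0..<3 * 2] = [(0, 0), (1, 0), (2, 0), (0, 0), (1, 0), (2, 0)]"
  "map (exponent_pair 3 2 1 1 1) [0..<3 * 2] = [(0, 0), (1, 1), (2, 0), (0, 1), (1, 0), (2, 1)]"
  "map (exponent_pair 3 2 1 2 0) [0..<3 * 2] = [(0, 0), (2, 0), (1, 0), (0, 0), (2, 0), (1, 0)]"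
  "map (exponent_pair 3 2 1 2 1) [0..<3 * 2] = [(0, 0), (2, 1), (1, 0), (0, 1), (2, 0), (1, 1)]"
  by code_simp+

lemma exponent_pairs_322:
  "map (exponent_pair 3 2 2 0 0) [0..<3 * 2] = [(0, 0), (0, 0), (0, 0), (0, 0), (0, 0), (0, 0)]"
  "map (exponent_pair 3 2 2 0 1) [0..<3 * 2] = [(0, 0), (0, 1), (0, 0), (0, 1), (0, 0), (0, 1)]"
  "map (exponent_pair 3 2 2 1 0) [0..<3 * 2] = [(0, 0), (1, 0), (2, 0), (0, 0), (1, 0), (2, 0)]"
  "map (exponent_pair 3 2 2 1 1) [0..<3 * 2] = [(0, 0), (1, 1), (0, 0), (1, 1), (0, 0), (1, 1)]"
  "map (exponent_pair 3 2 2 2 0) [0..<3 * 2] = [(0, 0), (2, 0), (1, 0), (0, 0), (2, 0), (1, 0)]"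
  "map (exponent_pair 3 2 2 2 1) [0..<3 * 2] = [(0, 0), (2, 1), (0, 0), (2, 1), (0, 0), (2, 1)]"
  by code_simp+

lemma exponent_inverse_311:
  "exponent_pair 3 1 1 1 0 (3 * 1 - 1) = (2, 0)"
  by code_simp+

lemma exponent_inverse_411:
  "exponent_pair 4 1 1 1 0 (4 * 1 - 1) = (3, 0)"
  by code_simp+

lemma exponent_inverse_511:
  "exponent_pair 5 1 1 1 0 (5 * 1 - 1) = (4, 0)"
  "exponent_pair 5 1 1 2 0 (5 * 1 - 1) = (3, 0)"
  by code_simp+

lemma exponent_inverse_711:
  "exponent_pair 7 1 1 1 0 (7 * 1 - 1) = (6, 0)"
  "exponent_pair 7 1 1 2 0 (7 * 1 - 1) = (5, 0)"
  "exponent_pair 7 1 1 3 0 (7 * 1 - 1) = (4, 0)"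
  by code_simp+

lemma exponent_inverse_321:
  "exponent_pair 3 2 1 1 0 (3 * 2 - 1) = (2, 0)"
  "exponent_pair 3 2 1 1 1 (3 * 2 - 1) = (2, 1)"
  by code_simp+

lemma exponent_inverse_322:
  "exponent_pair 3 2 2 1 0 (3 * 2 - 1) = (2, 0)"
  by code_simp+

lemma molien_211:
  fixes \<Gamma> :: "(real^'n^'n) set"
  assumes \<Gamma>: "finite_orthogonal_subgroup \<Gamma>" and mc: "metacyclic \<Gamma> 2 1 1 r s"
  shows "(\<Sum>g\<in>\<Gamma>. complete_symmetric (power_traces g) k)
    = molien_term [real CARD('n), real CARD('n)] k
      + molien_term [real CARD('n), pair_trace r s (1, 0)] k"
  unfolding metacyclic_molien[OF \<Gamma> mc] sum_lessThan_numerals sum_lessThan_1 exponent_pairs_211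
      list.map pair_trace_0 by simp

lemma pair_trace_symmetry_311:
  fixes \<Gamma> :: "(real^'n^'n) set"
  assumes \<Gamma>: "finite_orthogonal_subgroup \<Gamma>" and mc: "metacyclic \<Gamma> 3 1 1 r s"
  shows "pair_trace r s (2, 0) = pair_trace r s (1, 0)"
  using pair_trace_inverse[OF \<Gamma> mc, of 1 0, unfolded exponent_inverse_311] by simp_all

lemma molien_311:
  fixes \<Gamma> :: "(real^'n^'n) set"
  assumes \<Gamma>: "finite_orthogonal_subgroup \<Gamma>" and mc: "metacyclic \<Gamma> 3 1 1 r s"
  shows "(\<Sum>g\<in>\<Gamma>. complete_symmetric (power_traces g) k)
    = molien_term [real CARD('n), real CARD('n), real CARD('n)] k
      + 2 * molien_term [real CARD('n), pair_trace r s (1, 0), pair_trace r s (1, 0)] k"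
  unfolding metacyclic_molien[OF \<Gamma> mc] sum_lessThan_numerals sum_lessThan_1 exponent_pairs_311
      list.map pair_trace_0
    pair_trace_symmetry_311[OF \<Gamma> mc] by simp

lemma pair_trace_symmetry_411:
  fixes \<Gamma> :: "(real^'n^'n) set"
  assumes \<Gamma>: "finite_orthogonal_subgroup \<Gamma>" and mc: "metacyclic \<Gamma> 4 1 1 r s"
  shows "pair_trace r s (3, 0) = pair_trace r s (1, 0)"
  using pair_trace_inverse[OF \<Gamma> mc, of 1 0, unfolded exponent_inverse_411] by simp_all

lemma molien_411:
  fixes \<Gamma> :: "(real^'n^'n) set"
  assumes \<Gamma>: "finite_orthogonal_subgroup \<Gamma>" and mc: "metacyclic \<Gamma> 4 1 1 r s"
  shows "(\<Sum>g\<in>\<Gamma>. complete_symmetric (power_traces g) k)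
    = molien_term [real CARD('n), real CARD('n), real CARD('n), real CARD('n)] k
      + 2 * molien_term [real CARD('n), pair_trace r s (1, 0), pair_trace r s (2, 0), pair_trace r
          s (1, 0)] k
      + molien_term [real CARD('n), pair_trace r s (2, 0), real CARD('n), pair_trace r s (2, 0)] k"
  unfolding metacyclic_molien[OF \<Gamma> mc] sum_lessThan_numerals sum_lessThan_1 exponent_pairs_411
      list.map pair_trace_0
    pair_trace_symmetry_411[OF \<Gamma> mc] by simp

lemma pair_trace_symmetry_511:
  fixes \<Gamma> :: "(real^'n^'n) set"
  assumes \<Gamma>: "finite_orthogonal_subgroup \<Gamma>" and mc: "metacyclic \<Gamma> 5 1 1 r s"
  shows "pair_trace r s (4, 0) = pair_trace r s (1, 0)"
    and "pair_trace r s (3, 0) = pair_trace r s (2, 0)"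
  using pair_trace_inverse[OF \<Gamma> mc, of 1 0, unfolded exponent_inverse_511] pair_trace_inverse[OF \<Gamma>
      mc, of 2 0, unfolded exponent_inverse_511] by simp_all

lemma molien_511:
  fixes \<Gamma> :: "(real^'n^'n) set"
  assumes \<Gamma>: "finite_orthogonal_subgroup \<Gamma>" and mc: "metacyclic \<Gamma> 5 1 1 r s"
  shows "(\<Sum>g\<in>\<Gamma>. complete_symmetric (power_traces g) k)
    = molien_term [real CARD('n), real CARD('n), real CARD('n), real CARD('n), real CARD('n)] k
      + 2 * molien_term [real CARD('n), pair_trace r s (1, 0), pair_trace r s (2, 0), pair_trace r
          s (2, 0), pair_trace r s (1, 0)] k
      + 2 * molien_term [real CARD('n), pair_trace r s (2, 0), pair_trace r s (1, 0), pair_trace r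
          s (1, 0), pair_trace r s (2, 0)] k"
  unfolding metacyclic_molien[OF \<Gamma> mc] sum_lessThan_numerals sum_lessThan_1 exponent_pairs_511
      list.map pair_trace_0
    pair_trace_symmetry_511[OF \<Gamma> mc] by simp

lemma pair_trace_symmetry_711:
  fixes \<Gamma> :: "(real^'n^'n) set"
  assumes \<Gamma>: "finite_orthogonal_subgroup \<Gamma>" and mc: "metacyclic \<Gamma> 7 1 1 r s"
  shows "pair_trace r s (6, 0) = pair_trace r s (1, 0)"
    and "pair_trace r s (5, 0) = pair_trace r s (2, 0)"
    and "pair_trace r s (4, 0) = pair_trace r s (3, 0)"
  using pair_trace_inverse[OF \<Gamma> mc, of 1 0, unfolded exponent_inverse_711] pair_trace_inverse[OF \<Gamma>
      mc, of 2 0, unfolded exponent_inverse_711] pair_trace_inverse[OF \<Gamma> mc, of 3 0, unfolded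
      exponent_inverse_711] by simp_all

lemma molien_711:
  fixes \<Gamma> :: "(real^'n^'n) set"
  assumes \<Gamma>: "finite_orthogonal_subgroup \<Gamma>" and mc: "metacyclic \<Gamma> 7 1 1 r s"
  shows "(\<Sum>g\<in>\<Gamma>. complete_symmetric (power_traces g) k)
    = molien_term [real CARD('n), real CARD('n), real CARD('n), real CARD('n), real CARD('n), real
        CARD('n), real CARD('n)] k
      + 2 * molien_term [real CARD('n), pair_trace r s (1, 0), pair_trace r s (2, 0), pair_trace r
          s (3, 0), pair_trace r s (3, 0), pair_trace r s (2, 0), pair_trace r s (1, 0)] k
      + 2 * molien_term [real CARD('n), pair_trace r s (2, 0), pair_trace r s (3, 0), pair_trace r
          s (1, 0), pair_trace r s (1, 0), pair_trace r s (3, 0), pair_trace r s (2, 0)] k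
      + 2 * molien_term [real CARD('n), pair_trace r s (3, 0), pair_trace r s (1, 0), pair_trace r
          s (2, 0), pair_trace r s (2, 0), pair_trace r s (1, 0), pair_trace r s (3, 0)] k"
  unfolding metacyclic_molien[OF \<Gamma> mc] sum_lessThan_numerals sum_lessThan_1 exponent_pairs_711
      list.map pair_trace_0
    pair_trace_symmetry_711[OF \<Gamma> mc] by simp

lemma molien_221:
  fixes \<Gamma> :: "(real^'n^'n) set"
  assumes \<Gamma>: "finite_orthogonal_subgroup \<Gamma>" and mc: "metacyclic \<Gamma> 2 2 1 r s"
  shows "(\<Sum>g\<in>\<Gamma>. complete_symmetric (power_traces g) k)
    = molien_term [real CARD('n), real CARD('n), real CARD('n), real CARD('n)] k
      + molien_term [real CARD('n), pair_trace r s (1, 0), real CARD('n), pair_trace r s (1, 0)] k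
      + molien_term [real CARD('n), pair_trace r s (0, 1), real CARD('n), pair_trace r s (0, 1)] k
      + molien_term [real CARD('n), pair_trace r s (1, 1), real CARD('n), pair_trace r s (1, 1)] k"
  unfolding metacyclic_molien[OF \<Gamma> mc] sum_lessThan_numerals sum_lessThan_1 exponent_pairs_221
      list.map pair_trace_0 by simp

lemma pair_trace_symmetry_321:
  fixes \<Gamma> :: "(real^'n^'n) set"
  assumes \<Gamma>: "finite_orthogonal_subgroup \<Gamma>" and mc: "metacyclic \<Gamma> 3 2 1 r s"
  shows "pair_trace r s (2, 0) = pair_trace r s (1, 0)"
    and "pair_trace r s (2, 1) = pair_trace r s (1, 1)"
  using pair_trace_inverse[OF \<Gamma> mc, of 1 0, unfolded exponent_inverse_321] pair_trace_inverse[OF \<Gamma>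
      mc, of 1 1, unfolded exponent_inverse_321] by simp_all

lemma molien_321:
  fixes \<Gamma> :: "(real^'n^'n) set"
  assumes \<Gamma>: "finite_orthogonal_subgroup \<Gamma>" and mc: "metacyclic \<Gamma> 3 2 1 r s"
  shows "(\<Sum>g\<in>\<Gamma>. complete_symmetric (power_traces g) k)
    = molien_term [real CARD('n), real CARD('n), real CARD('n), real CARD('n), real CARD('n), real
        CARD('n)] k
      + 2 * molien_term [real CARD('n), pair_trace r s (1, 0), pair_trace r s (1, 0), real
          CARD('n), pair_trace r s (1, 0), pair_trace r s (1, 0)] k
      + molien_term [real CARD('n), pair_trace r s (0, 1), real CARD('n), pair_trace r s (0, 1),
          real CARD('n), pair_trace r s (0, 1)] k
      + 2 * molien_term [real CARD('n), pair_trace r s (1, 1), pair_trace r s (1, 0), pair_trace r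
          s (0, 1), pair_trace r s (1, 0), pair_trace r s (1, 1)] k"
  unfolding metacyclic_molien[OF \<Gamma> mc] sum_lessThan_numerals sum_lessThan_1 exponent_pairs_321
      list.map pair_trace_0
    pair_trace_symmetry_321[OF \<Gamma> mc] by simp

text \<open>The two rotations are inverse to each other and the three reflections are conjugate, so
  two unknown traces remain.\<close>

lemma pair_trace_symmetry_322:
  fixes \<Gamma> :: "(real^'n^'n) set"
  assumes \<Gamma>: "finite_orthogonal_subgroup \<Gamma>" and mc: "metacyclic \<Gamma> 3 2 2 r s"
  shows "pair_trace r s (2, 0) = pair_trace r s (1, 0)"
    and "pair_trace r s (1, 1) = pair_trace r s (0, 1)"
    and "pair_trace r s (2, 1) = pair_trace r s (0, 1)"
proof -
  show "pair_trace r s (2, 0) = pair_trace r s (1, 0)"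
    using pair_trace_inverse[OF \<Gamma> mc, of 1 0, unfolded exponent_inverse_322] by simp
  \<comment> \<open>The product of \<open>r\<close> and \<open>r^2 s\<close> is \<open>s\<close> in
    one order and \<open>r s\<close> in the other; likewise \<open>r\<close> and \<open>s\<close>
    give \<open>r s\<close> and \<open>r^2 s\<close>.\<close>
  show "pair_trace r s (1, 1) = pair_trace r s (0, 1)"
    using pair_trace_swap[OF mc, of 1 0 2 1] by simp
  then show "pair_trace r s (2, 1) = pair_trace r s (0, 1)"
    using pair_trace_swap[OF mc, of 1 0 0 1] by (simp add: numeral_2_eq_2)
qed

lemma molien_322:
  fixes \<Gamma> :: "(real^'n^'n) set"
  assumes \<Gamma>: "finite_orthogonal_subgroup \<Gamma>" and mc: "metacyclic \<Gamma> 3 2 2 r s"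
  shows "(\<Sum>g\<in>\<Gamma>. complete_symmetric (power_traces g) k)
    = molien_term [real CARD('n), real CARD('n), real CARD('n), real CARD('n), real CARD('n), real
        CARD('n)] k
      + 2 * molien_term [real CARD('n), pair_trace r s (1, 0), pair_trace r s (1, 0), real
          CARD('n), pair_trace r s (1, 0), pair_trace r s (1, 0)] k
      + 3 * molien_term [real CARD('n), pair_trace r s (0, 1), real CARD('n), pair_trace r s (0,
          1), real CARD('n), pair_trace r s (0, 1)] k"
  unfolding metacyclic_molien[OF \<Gamma> mc] sum_lessThan_numerals sum_lessThan_1 exponent_pairs_322
      list.map pair_trace_0
    pair_trace_symmetry_322[OF \<Gamma> mc] by simp

text \<open>The left side is four times the multiplicity of the eigenvalue -1 of
  \<open>r\<close>.\<close>

lemma metacyclic_positive_411: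
  fixes r :: "real^'n^'n"
  assumes \<Gamma>: "finite_orthogonal_subgroup \<Gamma>" and mc: "metacyclic \<Gamma> 4 1 1 r s"
  shows "real CARD('n) - 2 * pair_trace r s (1, 0) + pair_trace r s (2, 0) \<ge> 0"
  using metacyclic_positive[OF \<Gamma> mc, of 1 0 "\<lambda>i. (-1) ^ i"] pair_trace_symmetry_411[OF \<Gamma> mc]
  unfolding exponent_pairs_411 list.map pair_trace_0
  by (simp add: sum_lessThan_numerals)

text \<open>Six times the multiplicities of -1 and of a primitive sixth root of unity as eigenvalues
  of \<open>r ** s\<close>. The weights \<open>2, 1, -1, -2, -1, 1\<close> are the values
  \<open>2 cos (i \<pi> / 3)\<close>.\<close>

lemma metacyclic_positive_321:
  fixes r :: "real^'n^'n"
  assumes \<Gamma>: "finite_orthogonal_subgroup \<Gamma>" and mc: "metacyclic \<Gamma> 3 2 1 r s"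
  shows "real CARD('n) - 2 * pair_trace r s (1, 1) + 2 * pair_trace r s (1, 0) - pair_trace r s
      (0, 1) \<ge> 0"
    and "real CARD('n) + pair_trace r s (1, 1) - pair_trace r s (1, 0) - pair_trace r s (0, 1) \<ge> 0"
  using metacyclic_positive[OF \<Gamma> mc, of 1 1 "\<lambda>i. (-1) ^ i"]
    metacyclic_positive[OF \<Gamma> mc, of 1 1 "\<lambda>i. [2, 1, -1, -2, -1, 1] ! i"]
        pair_trace_symmetry_321[OF \<Gamma> mc]
  unfolding exponent_pairs_321 list.map pair_trace_0
  by (simp_all add: sum_lessThan_numerals)

section \<open>Traces recovered from equal Molien series\<close>

lemmas low_degree_simps = complete_symmetric_low_degree complete_symmetric_low_degree(1)[unfolded
    One_nat_def]

text \<open>The identity has already been cancelled from \<open>H\<close>. By \<open>pos\<close> the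
  maximal pole order at \<open>t = 1\<close> is attained by the square of the generator, which gives
  \<open>y\<close>; degree 1 then gives \<open>x\<close>.\<close>

lemma cyclic_4_traces:
  fixes N :: real
  assumes H: "\<And>k. 2 * molien_term [N, x, y, x] k + molien_term [N, y, N, y] k
      = 2 * molien_term [N, X, Y, X] k + molien_term [N, Y, N, Y] k"
    and pos: "N - 2 * x + y \<ge> 0" "N - 2 * X + Y \<ge> 0"
  shows "x = X" "y = Y"
proof -
  let ?L = "[[N, x, y, x], [N, x, y, x], [N, y, N, y]]" and ?M = "[[N, X, Y, X], [N, X, Y, X], [N,
      Y, N, Y]]"
  have "Max (sum_list ` set ?L) = Max (sum_list ` set ?M)"
    by (rule max_mean_cycle_seq_eq[where n = 4]) (use H in auto)
  then show "y = Y" using pos by (auto simp: max_def split: if_splits)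
  then show "x = X" using H[of 1] by (simp add: low_degree_simps cycle_seq_def)
qed

text \<open>The pole order at 1 equates \<open>y\<close> with one of the three involution traces.
  Degrees 1 and 2 then give the other two a negative squared difference.\<close>

lemma cyclic_4_klein_traces:
  fixes N :: real
  assumes H: "\<And>k. 2 * molien_term [N, x, y, x] k + molien_term [N, y, N, y] k
      = molien_term [N, X, N, X] k + molien_term [N, Y, N, Y] k + molien_term [N, Z, N, Z] k"
    and pos: "N - 2 * x + y \<ge> 0" "y < N"
  shows False
proof -
  let ?L = "[[N, x, y, x], [N, x, y, x], [N, y, N, y]]" and ?M = "[[N, X, N, X], [N, Y, N, Y], [N,
      Z, N, Z]]"
  have "Max (sum_list ` set ?L) = Max (sum_list ` set ?M)"
    by (rule max_mean_cycle_seq_eq[where n = 4]) (use H in \<open>auto simp: algebra_simps\<close>)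
  then have y: "y = X \<or> y = Y \<or> y = Z" using pos by (auto simp: max_def split: if_splits)
  have k1: "2 * x + y = X + Y + Z" using H[of 1] by (simp add: low_degree_simps cycle_seq_def)
  have k2: "2 * (x ^ 2 + y) + y ^ 2 = X ^ 2 + Y ^ 2 + Z ^ 2 + 2 * N" using H[of 2] by (simp add:
      low_degree_simps cycle_seq_def field_simps)
  have *: False if "2 * x = U + V" "2 * (x ^ 2 + y) = U ^ 2 + V ^ 2 + 2 * N" for U V
  proof -
    have "(U - V) ^ 2 = 2 * (U ^ 2 + V ^ 2) - (U + V) ^ 2" by (simp add: power2_eq_square
        algebra_simps)
    also have "\<dots> = 4 * (y - N)" unfolding that(1)[symmetric] using that(2) by (simp add:
        power2_eq_square algebra_simps)
    also have "\<dots> < 0" using pos(2) by simp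
    finally show False by simp
  qed
  from y show False
  proof (elim disjE)
    assume "y = X" then show False using *[of Y Z] k1 k2 by simp
  next
    assume "y = Y" then show False using *[of X Z] k1 k2 by simp
  next
    assume "y = Z" then show False using *[of X Y] k1 k2 by simp
  qed
qed

text \<open>Every permutation of the three involutions is an automorphism of the Klein group, so an
  unordered match of traces suffices.\<close>

lemma klein_traces:
  fixes N :: real
  assumes H: "\<And>k. molien_term [N, x, N, x] k + molien_term [N, y, N, y] k + molien_term [N, z, N,
      z] k
      = molien_term [N, X, N, X] k + molien_term [N, Y, N, Y] k + molien_term [N, Z, N, Z] k"
  shows "x = X \<and> (y = Y \<and> z = Z \<or> y = Z \<and> z = Y) \<or> x = Y \<and> (y = X \<and> z = Z \<or> y = Z \<and> z = X)
    \<or> x = Z \<and> (y = X \<and> z = Y \<or> y = Y \<and> z = X)"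
proof (rule power_sums_3)
  show 1: "x + y + z = X + Y + Z" using H[of 1] by (simp add: low_degree_simps cycle_seq_def)
  show "x ^ 2 + y ^ 2 + z ^ 2 = X ^ 2 + Y ^ 2 + Z ^ 2" using H[of 2] by (simp add:
      low_degree_simps cycle_seq_def field_simps)
  have "x ^ 3 + y ^ 3 + z ^ 3 + (3 * N + 2) * (x + y + z) = X ^ 3 + Y ^ 3 + Z ^ 3 + (3 * N + 2) *
      (X + Y + Z)"
    using H[of 3] by (simp add: low_degree_simps cycle_seq_def field_simps)
  then show "x ^ 3 + y ^ 3 + z ^ 3 = X ^ 3 + Y ^ 3 + Z ^ 3" unfolding 1 by simp
qed

text \<open>The second alternative corresponds to the automorphism that squares the
  generator.\<close>

lemma cyclic_5_traces:
  fixes N :: real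
  assumes H: "\<And>k. 2 * molien_term [N, x, y, y, x] k + 2 * molien_term [N, y, x, x, y] k
      = 2 * molien_term [N, X, Y, Y, X] k + 2 * molien_term [N, Y, X, X, Y] k"
  shows "x = X \<and> y = Y \<or> x = Y \<and> y = X"
proof (rule power_sums_2)
  show 1: "x + y = X + Y" using H[of 1] by (simp add: low_degree_simps cycle_seq_def)
  have "x ^ 2 + y ^ 2 + (x + y) = X ^ 2 + Y ^ 2 + (X + Y)" using H[of 2] by (simp add:
      low_degree_simps cycle_seq_def field_simps)
  then show "x ^ 2 + y ^ 2 = X ^ 2 + Y ^ 2" unfolding 1 by simp
qed

text \<open>Degrees 1 to 3 give the first three power sums, which determine the fourth; degree 4
  then isolates the cyclic polynomial required by \<open>cyclic_power_sums_3\<close>.\<close>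

lemma cyclic_7_traces:
  fixes N :: real
  assumes H: "\<And>k. 2 * molien_term [N, x, y, z, z, y, x] k + 2 * molien_term [N, y, z, x, x, z, y] k
       + 2 * molien_term [N, z, x, y, y, x, z] k
      = 2 * molien_term [N, X, Y, Z, Z, Y, X] k + 2 * molien_term [N, Y, Z, X, X, Z, Y] k
       + 2 * molien_term [N, Z, X, Y, Y, X, Z] k"
  shows "x = X \<and> y = Y \<and> z = Z \<or> x = Y \<and> y = Z \<and> z = X \<or> x = Z \<and> y = X \<and> z = Y"
proof (rule cyclic_power_sums_3)
  show 1: "x + y + z = X + Y + Z" using H[of 1] by (simp add: low_degree_simps cycle_seq_def)
  have "x ^ 2 + y ^ 2 + z ^ 2 + (x + y + z) = X ^ 2 + Y ^ 2 + Z ^ 2 + (X + Y + Z)" using H[of 2]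
      by (simp add: low_degree_simps cycle_seq_def field_simps)
  then show 2: "x ^ 2 + y ^ 2 + z ^ 2 = X ^ 2 + Y ^ 2 + Z ^ 2" unfolding 1 by simp
  have e: "2 * (a * b + b * c + c * a) = (a + b + c) ^ 2 - (a ^ 2 + b ^ 2 + c ^ 2)" for a b c ::
      real
    by (simp add: power2_eq_square algebra_simps)
  have "2 * (x * y + y * z + z * x) = 2 * (X * Y + Y * Z + Z * X)" unfolding e 1 2 ..
  then have e2: "x * y + y * z + z * x = X * Y + Y * Z + Z * X" by simp
  have "x ^ 3 + y ^ 3 + z ^ 3 + 3 * (x * y + y * z + z * x) + 2 * (x + y + z) = X ^ 3 + Y ^ 3 + Z
      ^ 3 + 3 * (X * Y + Y * Z + Z * X) + 2 * (X + Y + Z)"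
    using H[of 3] by (simp add: low_degree_simps cycle_seq_def field_simps)
  then show 3: "x ^ 3 + y ^ 3 + z ^ 3 = X ^ 3 + Y ^ 3 + Z ^ 3" unfolding 1 e2 by simp
  \<comment> \<open>Newton's identity in degree 4 for three numbers, whose fourth elementary
    symmetric function vanishes.\<close>
  have p4: "6 * (a ^ 4 + b ^ 4 + c ^ 4) = (a + b + c) ^ 4 - 6 * (a + b + c) ^ 2 * (a ^ 2 + b ^ 2 +
      c ^ 2) + 3 * (a ^ 2 + b ^ 2 + c ^ 2) ^ 2 + 8 * (a + b + c) * (a ^ 3 + b ^ 3 + c ^ 3)" for a
      b c :: real
    by (simp add: eval_nat_numeral algebra_simps)
  have p4': "x ^ 4 + y ^ 4 + z ^ 4 = X ^ 4 + Y ^ 4 + Z ^ 4"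
    using p4[of x y z] p4[of X Y Z] unfolding 1 2 3 by simp
  have "(x ^ 4 + y ^ 4 + z ^ 4) + 6 * (x ^ 2 * y + y ^ 2 * z + z ^ 2 * x) + 3 * (x ^ 2 + y ^ 2 + z
      ^ 2) + 8 * (x * y + y * z + z * x) + 6 * (x + y + z)
     = (X ^ 4 + Y ^ 4 + Z ^ 4) + 6 * (X ^ 2 * Y + Y ^ 2 * Z + Z ^ 2 * X) + 3 * (X ^ 2 + Y ^ 2 + Z
         ^ 2) + 8 * (X * Y + Y * Z + Z * X) + 6 * (X + Y + Z)"
    using H[of 4] by (simp add: low_degree_simps cycle_seq_def field_simps)
  then show "x ^ 2 * y + y ^ 2 * z + z ^ 2 * x = X ^ 2 * Y + Y ^ 2 * Z + Z ^ 2 * X" unfolding 1 2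
      p4' e2 by simp
qed

text \<open>The traces are peeled off one at a time: the pole at \<open>t = -1\<close> gives the
  trace of the involution, after its removal the pole at \<open>t = 1\<close> gives the trace of the
  elements of order 3, and degree 1 gives the last one.\<close>

lemma cyclic_6_traces:
  fixes N :: real
  assumes H: "\<And>k. 2 * molien_term [N, y, y, N, y, y] k + molien_term [N, z, N, z, N, z] k + 2 *
      molien_term [N, x, y, z, y, x] k
      = 2 * molien_term [N, Y, Y, N, Y, Y] k + molien_term [N, Z, N, Z, N, Z] k + 2 * molien_term
          [N, X, Y, Z, Y, X] k"
    and pos: "N - 2 * x + 2 * y - z \<ge> 0" "N + x - y - z \<ge> 0" "N - 2 * X + 2 * Y - Z \<ge> 0" "N + X -
        Y - Z \<ge> 0" "z < N" "Z < N"
  shows "x = X" "y = Y" "z = Z"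
proof -
  let ?L = "[[N, y, y, N, y, y], [N, y, y, N, y, y], [N, z, N, z, N, z], [N, x, y, z, y, x], [N,
      x, y, z, y, x]]"
    and ?M = "[[N, Y, Y, N, Y, Y], [N, Y, Y, N, Y, Y], [N, Z, N, Z, N, Z], [N, X, Y, Z, Y, X], [N,
        X, Y, Z, Y, X]]"
  have "Max ((\<lambda>L. \<Sum>j<6. (-1) ^ j * L ! j) ` set ?L) = Max ((\<lambda>L. \<Sum>j<6. (-1) ^ j * L ! j) ` set ?M)"
    by (rule max_alternating_cycle_seq_eq) (use H in \<open>auto simp: algebra_simps\<close>)
  \<comment> \<open>The alternating sums are 0 for order 3, \<open>3 * N - 3 * z\<close> for the
    involution and \<open>N - 2 * x + 2 * y - z\<close> for order 6; by \<open>pos\<close> the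
    second is the maximum.\<close>
  then show z: "z = Z" using pos by (auto simp: sum_lessThan_numerals max_def split: if_splits)
  let ?L' = "[[N, y, y, N, y, y], [N, y, y, N, y, y], [N, x, y, z, y, x], [N, x, y, z, y, x]]"
    and ?M' = "[[N, Y, Y, N, Y, Y], [N, Y, Y, N, Y, Y], [N, X, Y, Z, Y, X], [N, X, Y, Z, Y, X]]"
  have "Max (sum_list ` set ?L') = Max (sum_list ` set ?M')"
    by (rule max_mean_cycle_seq_eq[where n = 6]) (use H z in \<open>auto simp: algebra_simps\<close>)
  then show y: "y = Y" using pos by (auto simp: max_def split: if_splits)
  show "x = X" using H[of 1] y z by (simp add: low_degree_simps cycle_seq_def)
qed

text \<open>Elements of order 3 have alternating sum 0 and reflections
  \<open>3 * N - 3 * z > 0\<close>, so the pole at -1 isolates \<open>z\<close>.\<close>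

lemma dihedral_traces:
  fixes N :: real
  assumes H: "\<And>k. 2 * molien_term [N, y, y, N, y, y] k + 3 * molien_term [N, z, N, z, N, z] k
      = 2 * molien_term [N, Y, Y, N, Y, Y] k + 3 * molien_term [N, Z, N, Z, N, Z] k"
    and pos: "z < N" "Z < N"
  shows "y = Y" "z = Z"
proof -
  let ?L = "[[N, y, y, N, y, y], [N, y, y, N, y, y], [N, z, N, z, N, z], [N, z, N, z, N, z], [N,
      z, N, z, N, z]]"
    and ?M = "[[N, Y, Y, N, Y, Y], [N, Y, Y, N, Y, Y], [N, Z, N, Z, N, Z], [N, Z, N, Z, N, Z], [N,
        Z, N, Z, N, Z]]"
  have "Max ((\<lambda>L. \<Sum>j<6. (-1) ^ j * L ! j) ` set ?L) = Max ((\<lambda>L. \<Sum>j<6. (-1) ^ j * L ! j) ` set ?M)"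
    by (rule max_alternating_cycle_seq_eq) (use H in \<open>auto simp: algebra_simps\<close>)
  then show z: "z = Z" using pos by (auto simp: sum_lessThan_numerals max_def split: if_splits)
  show "y = Y" using H[of 1] z by (simp add: low_degree_simps cycle_seq_def)
qed

text \<open>The pole at \<open>t = -1\<close> is used twice, first to match the involutions and
  then, with one of them cancelled, for the elements of order 6. All traces are then expressed by
  \<open>N\<close>, \<open>z\<close> and one positive number \<open>w\<close>, and degrees 2 and 3
  force \<open>w = 0\<close>.\<close>

lemma cyclic_6_dihedral_traces:
  fixes N :: real
  assumes H: "\<And>k. 2 * molien_term [N, y, y, N, y, y] k + molien_term [N, z, N, z, N, z] k + 2 *
      molien_term [N, x, y, z, y, x] k
      = 2 * molien_term [N, Y, Y, N, Y, Y] k + 3 * molien_term [N, Z, N, Z, N, Z] k"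
    and pos: "N + x - y - z \<ge> 0" "z < N" "Z < N" "y < N"
  shows False
proof -
  let ?L = "[[N, y, y, N, y, y], [N, y, y, N, y, y], [N, z, N, z, N, z], [N, x, y, z, y, x], [N,
      x, y, z, y, x]]"
    and ?M = "[[N, Y, Y, N, Y, Y], [N, Y, Y, N, Y, Y], [N, Z, N, Z, N, Z], [N, Z, N, Z, N, Z], [N,
        Z, N, Z, N, Z]]"
  have "Max ((\<lambda>L. \<Sum>j<6. (-1) ^ j * L ! j) ` set ?L) = Max ((\<lambda>L. \<Sum>j<6. (-1) ^ j * L ! j) ` set ?M)"
    by (rule max_alternating_cycle_seq_eq) (use H in \<open>auto simp: algebra_simps\<close>)
  then have z: "Z = z" using pos by (auto simp: sum_lessThan_numerals max_def split: if_splits)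
  \<comment> \<open>One involution has been cancelled on each side and the rest divided by
    2.\<close>
  have H': "molien_term [N, y, y, N, y, y] k + molien_term [N, x, y, z, y, x] k
      = molien_term [N, Y, Y, N, Y, Y] k + molien_term [N, z, N, z, N, z] k" for k
    using H[of k] unfolding z by simp
  let ?L' = "[[N, y, y, N, y, y], [N, x, y, z, y, x]]" and ?M' = "[[N, Y, Y, N, Y, Y], [N, z, N,
      z, N, z]]"
  have "Max ((\<lambda>L. \<Sum>j<6. (-1) ^ j * L ! j) ` set ?L') = Max ((\<lambda>L. \<Sum>j<6. (-1) ^ j * L ! j) ` set ?M')"
    by (rule max_alternating_cycle_seq_eq) (use H' in auto)
  then have e: "y = N + x - z" using pos by (auto simp: sum_lessThan_numerals max_def split:
      if_splits)
  \<comment> \<open>By \<open>e\<close> this difference is also \<open>N - y\<close>, hence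
    positive.\<close>
  define w where "w = z - x"
  have x: "x = z - w" by (simp add: w_def)
  have y: "y = N - w" by (simp add: w_def e)
  have w0: "w > 0" using pos y by simp
  have Y: "Y = N - 2 * w" using H'[of 1] x y by (simp add: low_degree_simps cycle_seq_def)
  have "(y ^ 2 + y) + (x ^ 2 + y) = (Y ^ 2 + Y) + (z ^ 2 + N)"
    using H'[of 2] by (simp add: low_degree_simps cycle_seq_def field_simps)
  then have "2 * w * (w + z - N) = 0" unfolding x y Y by (simp add: power2_eq_square algebra_simps)
  then have N: "N = w + z" using w0 by simp
  have "(y ^ 3 + 3 * y * y + 2 * N) + (x ^ 3 + 3 * x * y + 2 * z) = (Y ^ 3 + 3 * Y * Y + 2 * N) +
      (z ^ 3 + 3 * z * N + 2 * z)"
    using H'[of 3] by (simp add: low_degree_simps cycle_seq_def field_simps)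
  then have "w ^ 2 = 0" unfolding x y Y N by (simp add: power2_eq_square power3_eq_cube
      algebra_simps)
  then show False using w0 by simp
qed

section \<open>Isospectral groups of order below 8 are conjugate\<close>

lemma prime_traces_isometric:
  fixes \<Gamma> \<Gamma>' :: "(real^'n^'n) set"
  assumes \<Gamma>: "finite_orthogonal_subgroup \<Gamma>" and \<Gamma>': "finite_orthogonal_subgroup \<Gamma>'"
    and n: "card \<Gamma> = n" "card \<Gamma>' = n" "prime n"
    and r: "r \<in> \<Gamma>" "r \<noteq> mat 1" and r': "r' \<in> \<Gamma>'" "r' \<noteq> mat 1"
    and c: "0 < c" "c < n"
    and tr: "\<And>i. 0 < i \<Longrightarrow> i < n \<Longrightarrow> pair_trace r (mat 1) (i, 0) = pair_trace r' (mat 1) ((c * i) mod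
        n, 0)"
  shows "isometric_orbifolds \<Gamma> \<Gamma>'"
proof (rule prime_isometric[OF \<Gamma> \<Gamma>' n r r' c])
  fix i assume "i < n"
  then show "power_traces r i = power_traces r' ((c * i) mod n)"
    using tr[of i] by (cases "i = 0") (simp_all add: pair_trace_def)
qed

lemma klein_presentation:
  assumes \<Gamma>: "finite_orthogonal_subgroup \<Gamma>" and c: "card \<Gamma> = 4" and sq: "\<forall>x\<in>\<Gamma>. x ** x = mat 1"
  obtains r s where "r \<in> \<Gamma>" "r \<noteq> mat 1" "s \<in> \<Gamma>" "s \<noteq> mat 1" "s \<noteq> r" "metacyclic \<Gamma> 2 2 1 r s"
proof -
  have "card \<Gamma> > 1" using c by simp
  then obtain r where r: "r \<in> \<Gamma>" "r \<noteq> mat 1" using exists_nontrivial by blast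
  have "\<not> \<Gamma> \<subseteq> {mat 1, r}"
    using card_mono[of "{mat 1, r}" \<Gamma>] c card_insert_le_m1[of 2 "{r}" "mat 1"] by fastforce
  then obtain s where s: "s \<in> \<Gamma>" "s \<noteq> mat 1" "s \<noteq> r" by blast
  show ?thesis using that r s klein_metacyclic[OF \<Gamma> c _ r s] sq by blast
qed

text \<open>Orders 4 and 6 admit two isomorphism types each, which the Molien series has to
  separate; after that the traces are matched along an automorphism.\<close>

theorem isospectral_imp_isometric_of_small_order:
  fixes \<Gamma> \<Gamma>' :: "(real^'n^'n) set"
  assumes N: "CARD('n) \<ge> 2" and \<Gamma>: "finite_orthogonal_subgroup \<Gamma>" and \<Gamma>':
      "finite_orthogonal_subgroup \<Gamma>'"
    and iso: "isospectral \<Gamma> \<Gamma>'" and small: "card \<Gamma> < 8"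
  shows "isometric_orbifolds \<Gamma> \<Gamma>'"
proof -
  define n where "n = card \<Gamma>"
  have n: "card \<Gamma> = n" "card \<Gamma>' = n"
    using isospectral_imp_card_eq[OF N \<Gamma> \<Gamma>' iso] by (simp_all add: n_def)
  have "n > 0" using card_pos[OF \<Gamma>] n by simp
  have H: "(\<Sum>g\<in>\<Gamma>. complete_symmetric (power_traces g) k) = (\<Sum>g\<in>\<Gamma>'. complete_symmetric
      (power_traces g) k)" for k
    using iso[unfolded isospectral_iff_complete_symmetric[OF N \<Gamma> \<Gamma>'], rule_format, of k] n \<open>n > 0\<close>
        by simp
  have prime: "\<exists>r r'. r \<in> \<Gamma> \<and> r \<noteq> mat 1 \<and> r' \<in> \<Gamma>' \<and> r' \<noteq> mat 1 \<and> metacyclic \<Gamma> n 1 1 r (mat 1) \<and>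
      metacyclic \<Gamma>' n 1 1 r' (mat 1)"
    if p: "prime n"
  proof -
    have "card \<Gamma> > 1" "card \<Gamma>' > 1" using p n by (simp_all add: prime_nat_iff)
    then obtain r r' where r: "r \<in> \<Gamma>" "r \<noteq> mat 1" and r': "r' \<in> \<Gamma>'" "r' \<noteq> mat 1" using
        exists_nontrivial by blast
    then show ?thesis
      using prime_metacyclic[OF \<Gamma> r] prime_metacyclic[OF \<Gamma>' r'] n p by auto
  qed
  have "n = 1 \<or> n = 2 \<or> n = 3 \<or> n = 4 \<or> n = 5 \<or> n = 6 \<or> n = 7" using small n(1) \<open>n > 0\<close> by linarith
  then show ?thesis
  proof (elim disjE)
    assume "n = 1"
    then show ?thesis using isometric_card_1[OF \<Gamma> \<Gamma>'] n by simp
  next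
    assume n2: "n = 2"
    then have p: "prime n" by simp
    obtain r r' where r: "r \<in> \<Gamma>" "r \<noteq> mat 1" and r': "r' \<in> \<Gamma>'" "r' \<noteq> mat 1"
      and mc: "metacyclic \<Gamma> 2 1 1 r (mat 1)" and mc': "metacyclic \<Gamma>' 2 1 1 r' (mat 1)" using
          prime[OF p] n2 by blast
    have "pair_trace r (mat 1) (1, 0) = pair_trace r' (mat 1) (1, 0)"
      using H[of 1] unfolding molien_211[OF \<Gamma> mc] molien_211[OF \<Gamma>' mc'] by (simp add:
          low_degree_simps cycle_seq_def)
    then have "pair_trace r (mat 1) (i, 0) = pair_trace r' (mat 1) ((1 * i) mod n, 0)" if "0 < i"
        "i < n" for i
      using that n2 by (cases "i = 1") auto
    then show ?thesis using prime_traces_isometric[OF \<Gamma> \<Gamma>' n p r r', of 1] n2 by simp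
  next
    assume n3: "n = 3"
    then have p: "prime n" by simp
    obtain r r' where r: "r \<in> \<Gamma>" "r \<noteq> mat 1" and r': "r' \<in> \<Gamma>'" "r' \<noteq> mat 1"
      and mc: "metacyclic \<Gamma> 3 1 1 r (mat 1)" and mc': "metacyclic \<Gamma>' 3 1 1 r' (mat 1)" using
          prime[OF p] n3 by blast
    have e: "pair_trace r (mat 1) (1, 0) = pair_trace r' (mat 1) (1, 0)"
      using H[of 1] unfolding molien_311[OF \<Gamma> mc] molien_311[OF \<Gamma>' mc'] by (simp add:
          low_degree_simps cycle_seq_def)
    have "pair_trace r (mat 1) (i, 0) = pair_trace r' (mat 1) ((1 * i) mod n, 0)" if "0 < i" "i <
        n" for i
    proof -
      have "i = 1 \<or> i = 2" using that n3 by linarith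
      then show ?thesis using n3 e pair_trace_symmetry_311[OF \<Gamma> mc] pair_trace_symmetry_311[OF \<Gamma>'
          mc'] by auto
    qed
    then show ?thesis using prime_traces_isometric[OF \<Gamma> \<Gamma>' n p r r', of 1] n3 by simp
  next
    assume n5: "n = 5"
    then have p: "prime n" by simp
    obtain r r' where r: "r \<in> \<Gamma>" "r \<noteq> mat 1" and r': "r' \<in> \<Gamma>'" "r' \<noteq> mat 1"
      and mc: "metacyclic \<Gamma> 5 1 1 r (mat 1)" and mc': "metacyclic \<Gamma>' 5 1 1 r' (mat 1)" using
          prime[OF p] n5 by blast
    let ?T = "\<lambda>i. pair_trace r (mat 1) (i, 0)" and ?T' = "\<lambda>i. pair_trace r' (mat 1) (i, 0)"
    note s = pair_trace_symmetry_511[OF \<Gamma> mc] and s' = pair_trace_symmetry_511[OF \<Gamma>' mc']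
    have "?T 1 = ?T' 1 \<and> ?T 2 = ?T' 2 \<or> ?T 1 = ?T' 2 \<and> ?T 2 = ?T' 1"
    proof (rule cyclic_5_traces[where N = "real CARD('n)"])
      fix k show "2 * molien_term [real CARD('n), ?T 1, ?T 2, ?T 2, ?T 1] k + 2 * molien_term
          [real CARD('n), ?T 2, ?T 1, ?T 1, ?T 2] k
      = 2 * molien_term [real CARD('n), ?T' 1, ?T' 2, ?T' 2, ?T' 1] k + 2 * molien_term [real
          CARD('n), ?T' 2, ?T' 1, ?T' 1, ?T' 2] k"
        using H[of k] unfolding molien_511[OF \<Gamma> mc] molien_511[OF \<Gamma>' mc'] by simp
    qed
    \<comment> \<open>Inverse elements have equal traces, so \<open>c\<close> matters only up to
      sign. Modulo 5 the representatives 1 and 2 realise the two possible matches.\<close>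
    then have "\<exists>c. 0 < c \<and> c < n \<and> (\<forall>i. 0 < i \<and> i < n \<longrightarrow> ?T i = ?T' ((c * i) mod n))"
    proof (elim disjE conjE)
      assume e: "?T 1 = ?T' 1" "?T 2 = ?T' 2"
      have "?T i = ?T' ((1 * i) mod n)" if "0 < i" "i < n" for i
      proof -
        have "i = 1 \<or> i = 2 \<or> i = 3 \<or> i = 4" using that n5 by linarith
        then show ?thesis using n5 e s s' by auto
      qed
      then show ?thesis using n5 by (intro exI[of _ 1]) simp
    next
      assume e: "?T 1 = ?T' 2" "?T 2 = ?T' 1"
      have "?T i = ?T' ((2 * i) mod n)" if "0 < i" "i < n" for i
      proof -
        have "i = 1 \<or> i = 2 \<or> i = 3 \<or> i = 4" using that n5 by linarith
        then show ?thesis using n5 e s s' by auto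
      qed
      then show ?thesis using n5 by (intro exI[of _ 2]) simp
    qed
    then show ?thesis using prime_traces_isometric[OF \<Gamma> \<Gamma>' n p r r'] by blast
  next
    assume n7: "n = 7"
    then have p: "prime n" by simp
    obtain r r' where r: "r \<in> \<Gamma>" "r \<noteq> mat 1" and r': "r' \<in> \<Gamma>'" "r' \<noteq> mat 1"
      and mc: "metacyclic \<Gamma> 7 1 1 r (mat 1)" and mc': "metacyclic \<Gamma>' 7 1 1 r' (mat 1)" using
          prime[OF p] n7 by blast
    let ?T = "\<lambda>i. pair_trace r (mat 1) (i, 0)" and ?T' = "\<lambda>i. pair_trace r' (mat 1) (i, 0)"
    note s = pair_trace_symmetry_711[OF \<Gamma> mc] and s' = pair_trace_symmetry_711[OF \<Gamma>' mc']
    have "?T 1 = ?T' 1 \<and> ?T 2 = ?T' 2 \<and> ?T 3 = ?T' 3 \<or> ?T 1 = ?T' 2 \<and> ?T 2 = ?T' 3 \<and> ?T 3 = ?T' 1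
        \<or> ?T 1 = ?T' 3 \<and> ?T 2 = ?T' 1 \<and> ?T 3 = ?T' 2"
    proof (rule cyclic_7_traces[where N = "real CARD('n)"])
      fix k show "2 * molien_term [real CARD('n), ?T 1, ?T 2, ?T 3, ?T 3, ?T 2, ?T 1] k + 2 *
          molien_term [real CARD('n), ?T 2, ?T 3, ?T 1, ?T 1, ?T 3, ?T 2] k + 2 * molien_term
          [real CARD('n), ?T 3, ?T 1, ?T 2, ?T 2, ?T 1, ?T 3] k
      = 2 * molien_term [real CARD('n), ?T' 1, ?T' 2, ?T' 3, ?T' 3, ?T' 2, ?T' 1] k + 2 *
          molien_term [real CARD('n), ?T' 2, ?T' 3, ?T' 1, ?T' 1, ?T' 3, ?T' 2] k + 2 *
          molien_term [real CARD('n), ?T' 3, ?T' 1, ?T' 2, ?T' 2, ?T' 1, ?T' 3] k"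
        using H[of k] unfolding molien_711[OF \<Gamma> mc] molien_711[OF \<Gamma>' mc'] by simp
    qed
    \<comment> \<open>Modulo 7 the units up to sign are 1, 2, 3; multiplication by 2 and by 3 gives
      the two nontrivial cyclic shifts of the traces.\<close>
    then have "\<exists>c. 0 < c \<and> c < n \<and> (\<forall>i. 0 < i \<and> i < n \<longrightarrow> ?T i = ?T' ((c * i) mod n))"
    proof (elim disjE conjE)
      assume e: "?T 1 = ?T' 1" "?T 2 = ?T' 2" "?T 3 = ?T' 3"
      have "?T i = ?T' ((1 * i) mod n)" if "0 < i" "i < n" for i
      proof -
        have "i = 1 \<or> i = 2 \<or> i = 3 \<or> i = 4 \<or> i = 5 \<or> i = 6" using that n7 by linarith
        then show ?thesis using n7 e s s' by auto
      qed
      then show ?thesis using n7 by (intro exI[of _ 1]) simp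
    next
      assume e: "?T 1 = ?T' 2" "?T 2 = ?T' 3" "?T 3 = ?T' 1"
      have "?T i = ?T' ((2 * i) mod n)" if "0 < i" "i < n" for i
      proof -
        have "i = 1 \<or> i = 2 \<or> i = 3 \<or> i = 4 \<or> i = 5 \<or> i = 6" using that n7 by linarith
        then show ?thesis using n7 e s s' by auto
      qed
      then show ?thesis using n7 by (intro exI[of _ 2]) simp
    next
      assume e: "?T 1 = ?T' 3" "?T 2 = ?T' 1" "?T 3 = ?T' 2"
      have "?T i = ?T' ((3 * i) mod n)" if "0 < i" "i < n" for i
      proof -
        have "i = 1 \<or> i = 2 \<or> i = 3 \<or> i = 4 \<or> i = 5 \<or> i = 6" using that n7 by linarith
        then show ?thesis using n7 e s s' by auto
      qed
      then show ?thesis using n7 by (intro exI[of _ 3]) simp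
    qed
    then show ?thesis using prime_traces_isometric[OF \<Gamma> \<Gamma>' n p r r'] by blast
  next
    assume n4: "n = 4"
    \<comment> \<open>Formulated for arbitrary groups because it is applied in both
      directions.\<close>
    have klein_cyclic: False
      if \<Delta>: "finite_orthogonal_subgroup \<Delta>" and \<Delta>': "finite_orthogonal_subgroup \<Delta>'" and c4: "card
          \<Delta>' = 4"
        and mc: "metacyclic \<Delta> 4 1 1 r (mat 1)" and sq: "\<forall>x\<in>\<Delta>'. x ** x = mat 1"
        and HH: "\<And>k. (\<Sum>g\<in>\<Delta>. complete_symmetric (power_traces g) k) = (\<Sum>g\<in>\<Delta>'. complete_symmetric
            (power_traces g) k)"
      for \<Delta> \<Delta>' :: "(real^'n^'n) set" and r
    proof -
      obtain u v where uv: "metacyclic \<Delta>' 2 2 1 u v" using klein_presentation[OF \<Delta>' c4 sq] by blast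
      show False
        by (rule cyclic_4_klein_traces[where N = "real CARD('n)" and x = "pair_trace r (mat 1) (1,
            0)" and y = "pair_trace r (mat 1) (2, 0)"
              and X = "pair_trace u v (1, 0)" and Y = "pair_trace u v (0, 1)" and Z = "pair_trace
                  u v (1, 1)"])
          (use HH[unfolded molien_411[OF \<Delta> mc] molien_221[OF \<Delta>' uv]] metacyclic_positive_411[OF \<Delta>
              mc] pair_trace_less[OF \<Delta> mc, of 2 0] in \<open>simp_all add: algebra_simps\<close>)
    qed
    have c: "card \<Gamma> = 4" "card \<Gamma>' = 4" using n n4 by simp_all
    show ?thesis
    proof (cases "\<forall>x\<in>\<Gamma>. x ** x = mat 1")
      case False
      then obtain r where mc: "metacyclic \<Gamma> 4 1 1 r (mat 1)" using order_4_cases[OF \<Gamma> c(1)] by blast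
      have "\<not> (\<forall>x\<in>\<Gamma>'. x ** x = mat 1)" using klein_cyclic[OF \<Gamma> \<Gamma>' c(2) mc _ H] by blast
      then obtain r' where mc': "metacyclic \<Gamma>' 4 1 1 r' (mat 1)" using order_4_cases[OF \<Gamma>' c(2)]
          by blast
      let ?T = "\<lambda>i. pair_trace r (mat 1) (i, 0)" and ?T' = "\<lambda>i. pair_trace r' (mat 1) (i, 0)"
      have HH: "2 * molien_term [real CARD('n), ?T 1, ?T 2, ?T 1] k + molien_term [real CARD('n),
          ?T 2, real CARD('n), ?T 2] k
        = 2 * molien_term [real CARD('n), ?T' 1, ?T' 2, ?T' 1] k + molien_term [real CARD('n), ?T'
            2, real CARD('n), ?T' 2] k" for k
        using H[of k] unfolding molien_411[OF \<Gamma> mc] molien_411[OF \<Gamma>' mc'] by simp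
      note e = cyclic_4_traces[OF HH metacyclic_positive_411[OF \<Gamma> mc] metacyclic_positive_411[OF
          \<Gamma>' mc']]
      show ?thesis
      proof (rule metacyclic_isometric[OF \<Gamma> \<Gamma>' mc mc'])
        fix i j :: nat assume ij: "i < 4" "j < 1"
        have "?T i = ?T' i"
        proof -
          have "i = 0 \<or> i = 1 \<or> i = 2 \<or> i = 3" using ij by linarith
          then show ?thesis using e pair_trace_symmetry_411[OF \<Gamma> mc] pair_trace_symmetry_411[OF \<Gamma>'
              mc'] by (auto simp: pair_trace_0)
        qed
        then show "trace (mpow r i ** mpow (mat 1) j) = trace (mpow r' i ** mpow (mat 1) j)" by
            (simp add: pair_trace_def)
      qed
    next
      case True
      have True': "\<forall>x\<in>\<Gamma>'. x ** x = mat 1"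
        using klein_cyclic[OF \<Gamma>' \<Gamma> c(1) _ True H[symmetric]] order_4_cases[OF \<Gamma>' c(2)] by blast
      obtain r s where mc: "metacyclic \<Gamma> 2 2 1 r s" using klein_presentation[OF \<Gamma> c(1) True] by
          blast
      obtain u v where u: "u \<in> \<Gamma>'" "u \<noteq> mat 1" and v: "v \<in> \<Gamma>'" "v \<noteq> mat 1" "v \<noteq> u"
        and mc': "metacyclic \<Gamma>' 2 2 1 u v" using klein_presentation[OF \<Gamma>' c(2) True'] by blast
      have tr: "pair_trace r s (1, 0) = trace r" "pair_trace r s (0, 1) = trace s" "pair_trace r s
          (1, 1) = trace (r ** s)"
        "pair_trace u v (1, 0) = trace u" "pair_trace u v (0, 1) = trace v" "pair_trace u v (1, 1)
            = trace (u ** v)"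
        by (simp_all add: pair_trace_def)
      have HH: "molien_term [real CARD('n), trace r, real CARD('n), trace r] k + molien_term [real
          CARD('n), trace s, real CARD('n), trace s] k + molien_term [real CARD('n), trace (r **
          s), real CARD('n), trace (r ** s)] k
        = molien_term [real CARD('n), trace u, real CARD('n), trace u] k + molien_term [real
            CARD('n), trace v, real CARD('n), trace v] k + molien_term [real CARD('n), trace (u **
            v), real CARD('n), trace (u ** v)] k" for k
        using H[of k] unfolding molien_221[OF \<Gamma> mc] molien_221[OF \<Gamma>' mc'] tr by simp
      define w where "w = u ** v"
      note G' = finite_orthogonal_subgroup_facts[OF \<Gamma>']
      have sq: "x ** x = mat 1" if "x \<in> \<Gamma>'" for x using True' that by blast
      have w: "w \<in> \<Gamma>'" "w \<noteq> mat 1" "w \<noteq> u" "w \<noteq> v"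
      proof -
        show wi: "w \<in> \<Gamma>'" unfolding w_def using G'(3) u v by blast
        show "w \<noteq> mat 1" unfolding w_def using sq[OF u(1)] orthogonal_left_cancel[OF G'(4)[OF
            u(1)], of v u] v by auto
        show "w \<noteq> u" unfolding w_def using orthogonal_left_cancel[OF G'(4)[OF u(1)], of v "mat 1"]
            v by auto
        show "w \<noteq> v" unfolding w_def using orthogonal_right_cancel[OF G'(4)[OF v(1)], of u "mat
            1"] u by auto
      qed
      have comm: "x ** y = y ** x" if "x \<in> \<Gamma>'" "y \<in> \<Gamma>'" for x y
      proof -
        have "x ** ((x ** y) ** (x ** y)) ** y = x ** y" using sq[OF G'(3)[OF that]] by simp
        then have "(x ** x) ** (y ** x) ** (y ** y) = x ** y" by (simp add: matrix_mul_assoc)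
        then show ?thesis using sq that by simp
      qed
      have uw: "u ** w = v" "v ** w = u" "w ** u = v" "w ** v = u" "v ** u = w"
      proof -
        have "u ** w = (u ** u) ** v" by (simp add: w_def matrix_mul_assoc)
        then show 1: "u ** w = v" using sq u by simp
        show 2: "v ** u = w" using comm u v by (simp add: w_def)
        have "v ** w = (v ** v) ** u" unfolding 2[symmetric] by (simp add: matrix_mul_assoc)
        then show 3: "v ** w = u" using sq v by simp
        show "w ** u = v" "w ** v = u" using 1 3 comm u v w by simp_all
      qed
      \<comment> \<open>Any two distinct nontrivial elements present the Klein group, so each of the
        six matches of traces corresponds to a choice of \<open>a\<close> and
        \<open>b\<close>.\<close>
      have final: ?thesis if a: "a \<in> \<Gamma>'" "a \<noteq> mat 1" and b: "b \<in> \<Gamma>'" "b \<noteq> mat 1" "b \<noteq> a"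
        and t: "trace r = trace a" "trace s = trace b" "trace (r ** s) = trace (a ** b)" for a b
      proof -
        have mc2: "metacyclic \<Gamma>' 2 2 1 a b" using klein_metacyclic[OF \<Gamma>' c(2) sq a b] .
        show ?thesis
          by (rule metacyclic_isometric[OF \<Gamma> \<Gamma>' mc mc2]) (use t in \<open>auto simp: less_2_cases_iff\<close>)
      qed
      from klein_traces[OF HH] show ?thesis
        unfolding w_def[symmetric]
      proof (elim disjE conjE)
        assume "trace r = trace u" "trace s = trace v" "trace (r ** s) = trace w"
        then show ?thesis using final[OF u v] by (simp add: w_def)
      next
        assume "trace r = trace u" "trace s = trace w" "trace (r ** s) = trace v"
        then show ?thesis using final[OF u w(1,2,3)] uw by simp
      next
        assume "trace r = trace v" "trace s = trace u" "trace (r ** s) = trace w"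
        then show ?thesis using final[OF v(1,2) u v(3)[symmetric]] uw by simp
      next
        assume "trace r = trace v" "trace s = trace w" "trace (r ** s) = trace u"
        then show ?thesis using final[OF v(1,2) w(1,2,4)] uw by simp
      next
        assume "trace r = trace w" "trace s = trace u" "trace (r ** s) = trace v"
        then show ?thesis using final[OF w(1,2) u w(3)[symmetric]] uw by simp
      next
        assume "trace r = trace w" "trace s = trace v" "trace (r ** s) = trace u"
        then show ?thesis using final[OF w(1,2) v(1,2) w(4)[symmetric]] uw by simp
      qed
    qed
  next
    assume n6: "n = 6"
    have c: "card \<Gamma> = 6" "card \<Gamma>' = 6" using n n6 by simp_all
    have mixed: False
      if \<Delta>: "finite_orthogonal_subgroup \<Delta>" and \<Delta>': "finite_orthogonal_subgroup \<Delta>'"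
        and mc: "metacyclic \<Delta> 3 2 1 r s" and mc': "metacyclic \<Delta>' 3 2 2 r' s'"
        and HH: "\<And>k. (\<Sum>g\<in>\<Delta>. complete_symmetric (power_traces g) k) = (\<Sum>g\<in>\<Delta>'. complete_symmetric
            (power_traces g) k)"
      for \<Delta> \<Delta>' :: "(real^'n^'n) set" and r s r' s'
    proof (rule cyclic_6_dihedral_traces[where N = "real CARD('n)" and y = "pair_trace r s (1, 0)"
        and z = "pair_trace r s (0, 1)" and x = "pair_trace r s (1, 1)"
            and Y = "pair_trace r' s' (1, 0)" and Z = "pair_trace r' s' (0, 1)"])
      fix k
      show "2 * molien_term [real CARD('n), pair_trace r s (1, 0), pair_trace r s (1, 0), real
          CARD('n), pair_trace r s (1, 0), pair_trace r s (1, 0)] k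
         + molien_term [real CARD('n), pair_trace r s (0, 1), real CARD('n), pair_trace r s (0,
             1), real CARD('n), pair_trace r s (0, 1)] k
         + 2 * molien_term [real CARD('n), pair_trace r s (1, 1), pair_trace r s (1, 0),
             pair_trace r s (0, 1), pair_trace r s (1, 0), pair_trace r s (1, 1)] k
         = 2 * molien_term [real CARD('n), pair_trace r' s' (1, 0), pair_trace r' s' (1, 0), real
             CARD('n), pair_trace r' s' (1, 0), pair_trace r' s' (1, 0)] k
         + 3 * molien_term [real CARD('n), pair_trace r' s' (0, 1), real CARD('n), pair_trace r'
             s' (0, 1), real CARD('n), pair_trace r' s' (0, 1)] k"
        using HH[of k] unfolding molien_321[OF \<Delta> mc] molien_322[OF \<Delta>' mc'] by simp
    qed (use metacyclic_positive_321[OF \<Delta> mc] pair_trace_less[OF \<Delta> mc] pair_trace_less[OF \<Delta>' mc']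
        in simp_all)
    obtain r s where rs: "metacyclic \<Gamma> 3 2 1 r s \<or> metacyclic \<Gamma> 3 2 2 r s" using
        order_6_metacyclic[OF \<Gamma> c(1)] by blast
    obtain r' s' where rs': "metacyclic \<Gamma>' 3 2 1 r' s' \<or> metacyclic \<Gamma>' 3 2 2 r' s'" using
        order_6_metacyclic[OF \<Gamma>' c(2)] by blast
    let ?T = "pair_trace r s" and ?T' = "pair_trace r' s'"
    have ij: "(i, j) = (0, 0) \<or> (i, j) = (1, 0) \<or> (i, j) = (2, 0) \<or> (i, j) = (0, 1) \<or> (i, j) = (1,
        1) \<or> (i, j) = (2, 1)"
      if "i < 3" "j < 2" for i j :: nat
      using that by (auto simp: less_Suc_eq numeral_3_eq_3 numeral_2_eq_2)
    from rs rs' consider (cyclic) "metacyclic \<Gamma> 3 2 1 r s" "metacyclic \<Gamma>' 3 2 1 r' s'"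
      | (dihedral) "metacyclic \<Gamma> 3 2 2 r s" "metacyclic \<Gamma>' 3 2 2 r' s'"
      using mixed[OF \<Gamma> \<Gamma>' _ _ H] mixed[OF \<Gamma>' \<Gamma> _ _ H[symmetric]] by blast
    then show ?thesis
    proof cases
      case cyclic
      have HH: "2 * molien_term [real CARD('n), ?T (1, 0), ?T (1, 0), real CARD('n), ?T (1, 0), ?T
          (1, 0)] k
         + molien_term [real CARD('n), ?T (0, 1), real CARD('n), ?T (0, 1), real CARD('n), ?T (0,
             1)] k
         + 2 * molien_term [real CARD('n), ?T (1, 1), ?T (1, 0), ?T (0, 1), ?T (1, 0), ?T (1, 1)] k
         = 2 * molien_term [real CARD('n), ?T' (1, 0), ?T' (1, 0), real CARD('n), ?T' (1, 0), ?T'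
             (1, 0)] k
         + molien_term [real CARD('n), ?T' (0, 1), real CARD('n), ?T' (0, 1), real CARD('n), ?T'
             (0, 1)] k
         + 2 * molien_term [real CARD('n), ?T' (1, 1), ?T' (1, 0), ?T' (0, 1), ?T' (1, 0), ?T' (1,
             1)] k" for k
        using H[of k] unfolding molien_321[OF \<Gamma> cyclic(1)] molien_321[OF \<Gamma>' cyclic(2)] by simp
      have lt: "?T (0, 1) < real CARD('n)" "?T' (0, 1) < real CARD('n)"
        using pair_trace_less[OF \<Gamma> cyclic(1)] pair_trace_less[OF \<Gamma>' cyclic(2)] by simp_all
      note e = cyclic_6_traces[OF HH metacyclic_positive_321[OF \<Gamma> cyclic(1)]
          metacyclic_positive_321[OF \<Gamma>' cyclic(2)] lt]
      have "?T (i, j) = ?T' (i, j)" if "i < 3" "j < 2" for i j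
        using ij[OF that] e pair_trace_symmetry_321[OF \<Gamma> cyclic(1)] pair_trace_symmetry_321[OF \<Gamma>'
            cyclic(2)]
        by (elim disjE) (simp_all only: pair_trace_0)
      then show ?thesis
        by (intro metacyclic_isometric[OF \<Gamma> \<Gamma>' cyclic]) (simp add: pair_trace_def)
    next
      case dihedral
      have HH: "2 * molien_term [real CARD('n), ?T (1, 0), ?T (1, 0), real CARD('n), ?T (1, 0), ?T
          (1, 0)] k
         + 3 * molien_term [real CARD('n), ?T (0, 1), real CARD('n), ?T (0, 1), real CARD('n), ?T
             (0, 1)] k
         = 2 * molien_term [real CARD('n), ?T' (1, 0), ?T' (1, 0), real CARD('n), ?T' (1, 0), ?T'
             (1, 0)] k
         + 3 * molien_term [real CARD('n), ?T' (0, 1), real CARD('n), ?T' (0, 1), real CARD('n),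
             ?T' (0, 1)] k" for k
        using H[of k] unfolding molien_322[OF \<Gamma> dihedral(1)] molien_322[OF \<Gamma>' dihedral(2)] by simp
      have lt: "?T (0, 1) < real CARD('n)" "?T' (0, 1) < real CARD('n)"
        using pair_trace_less[OF \<Gamma> dihedral(1)] pair_trace_less[OF \<Gamma>' dihedral(2)] by simp_all
      note e = dihedral_traces[OF HH lt]
      have "?T (i, j) = ?T' (i, j)" if "i < 3" "j < 2" for i j
        using ij[OF that] e pair_trace_symmetry_322[OF \<Gamma> dihedral(1)] pair_trace_symmetry_322[OF
            \<Gamma>' dihedral(2)]
        by (elim disjE) (simp_all only: pair_trace_0)
      then show ?thesis
        by (intro metacyclic_isometric[OF \<Gamma> \<Gamma>' dihedral]) (simp add: pair_trace_def)
    qed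
  qed
qed

subsection \<open>Two isospectral groups of order 8\<close>

definition sign_diag :: "('n \<Rightarrow> bool) \<Rightarrow> real^'n^'n" where
  "sign_diag \<sigma> = (\<chi> i j. if i = j then (if \<sigma> i then -1 else 1) else 0)"

lemma sign_diag_mult: "sign_diag \<sigma> ** sign_diag \<tau> = sign_diag (\<lambda>i. \<sigma> i \<noteq> \<tau> i)"
  by (auto simp: vec_eq_iff matrix_matrix_mult_def sign_diag_def if_distrib[of "\<lambda>x. x * _"] cong:
      if_cong)

lemma sign_diag_False: "sign_diag (\<lambda>i. False) = mat 1"
  by (simp add: sign_diag_def mat_def vec_eq_iff)

lemma transpose_sign_diag: "transpose (sign_diag \<sigma>) = sign_diag \<sigma>"
  by (auto simp: sign_diag_def transpose_def vec_eq_iff)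

lemma orthogonal_sign_diag: "orthogonal_matrix (sign_diag \<sigma>)"
  by (simp add: orthogonal_matrix_def transpose_sign_diag sign_diag_mult sign_diag_False)

lemma sign_diag_inj: "sign_diag \<sigma> = sign_diag \<tau> \<longleftrightarrow> \<sigma> = \<tau>"
proof
  assume "sign_diag \<sigma> = sign_diag \<tau>"
  show "\<sigma> = \<tau>"
  proof
    fix i
    have "sign_diag \<sigma> $ i $ i = sign_diag \<tau> $ i $ i" using \<open>sign_diag \<sigma> = sign_diag \<tau>\<close> by simp
    then show "\<sigma> i = \<tau> i" by (simp add: sign_diag_def split: if_splits)
  qed
qed simp

text \<open>A sign matrix squares to the identity, so its contribution to the Molien series depends
  on its trace alone.\<close>

lemma power_traces_sign_diag:
  "power_traces (sign_diag \<sigma> :: real^'n^'n) k = (if even k then real CARD('n) else trace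
      (sign_diag \<sigma>))"
proof -
  have sq: "sign_diag \<sigma> ** sign_diag \<sigma> = mat 1" by (simp add: sign_diag_mult sign_diag_False)
  have "mpow (sign_diag \<sigma>) k = (if even k then mat 1 else sign_diag \<sigma>)"
    by (induction k) (simp_all add: sq)
  then show ?thesis by (simp add: trace_I)
qed

text \<open>
  Two binary codes of length 6, acting by sign changes of six coordinates. Both have weight enumerator
  \<open>1 + 3x\<^sup>2 + 3x\<^sup>4 + x\<^sup>6\<close>, but only in the second one do two words of weight 2 have a sum of weight 2.
\<close>

context
  fixes a b c d e f :: "'n::finite"
  assumes dist: "distinct [a, b, c, d, e, f]"
begin

lemma positions_distinct:
  "a \<noteq> b" "a \<noteq> c" "a \<noteq> d" "a \<noteq> e" "a \<noteq> f" "b \<noteq> a" "b \<noteq> c" "b \<noteq> d" "b \<noteq> e" "b \<noteq> f" "c \<noteq> a" "c \<noteq> b"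
      "c \<noteq> d" "c \<noteq> e" "c \<noteq> f" "d \<noteq> a" "d \<noteq> b" "d \<noteq> c" "d \<noteq> e" "d \<noteq> f" "e \<noteq> a" "e \<noteq> b" "e \<noteq> c" "e \<noteq>
      d" "e \<noteq> f" "f \<noteq> a" "f \<noteq> b" "f \<noteq> c" "f \<noteq> d" "f \<noteq> e"
  using dist by auto

definition word :: "bool \<Rightarrow> bool \<Rightarrow> bool \<Rightarrow> bool \<Rightarrow> bool \<Rightarrow> bool \<Rightarrow> real^'n^'n" where
  "word p q r s t u = sign_diag (\<lambda>i. i = a \<and> p \<or> i = b \<and> q \<or> i = c \<and> r \<or> i = d \<and> s \<or> i = e \<and> t \<or> i
      = f \<and> u)"

lemma word_mult:
  "word p q r s t u ** word p' q' r' s' t' u' = word (p \<noteq> p') (q \<noteq> q') (r \<noteq> r') (s \<noteq> s') (t \<noteq> t')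
      (u \<noteq> u')"
proof -
  have "(\<lambda>i. (i = a \<and> p \<or> i = b \<and> q \<or> i = c \<and> r \<or> i = d \<and> s \<or> i = e \<and> t \<or> i = f \<and> u) \<noteq>
      (i = a \<and> p' \<or> i = b \<and> q' \<or> i = c \<and> r' \<or> i = d \<and> s' \<or> i = e \<and> t' \<or> i = f \<and> u'))
    = (\<lambda>i. i = a \<and> p \<noteq> p' \<or> i = b \<and> q \<noteq> q' \<or> i = c \<and> r \<noteq> r' \<or> i = d \<and> s \<noteq> s' \<or> i = e \<and> t \<noteq> t' \<or> i
        = f \<and> u \<noteq> u')"
  proof
    fix i
    consider "i = a" | "i = b" | "i = c" | "i = d" | "i = e" | "i = f" | "i \<notin> {a, b, c, d, e, f}"
        by blast
    then show "((i = a \<and> p \<or> i = b \<and> q \<or> i = c \<and> r \<or> i = d \<and> s \<or> i = e \<and> t \<or> i = f \<and> u) \<noteq>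
      (i = a \<and> p' \<or> i = b \<and> q' \<or> i = c \<and> r' \<or> i = d \<and> s' \<or> i = e \<and> t' \<or> i = f \<and> u'))
    = (i = a \<and> p \<noteq> p' \<or> i = b \<and> q \<noteq> q' \<or> i = c \<and> r \<noteq> r' \<or> i = d \<and> s \<noteq> s' \<or> i = e \<and> t \<noteq> t' \<or> i = f
        \<and> u \<noteq> u')"
      by cases (simp_all add: positions_distinct)
  qed
  then show ?thesis by (simp only: word_def sign_diag_mult)
qed

lemma word_eq_iff:
  "word p q r s t u = word p' q' r' s' t' u' \<longleftrightarrow> p = p' \<and> q = q' \<and> r = r' \<and> s = s' \<and> t = t' \<and> u = u'"
proof
  assume "word p q r s t u = word p' q' r' s' t' u'"
  then have *: "(i = a \<and> p \<or> i = b \<and> q \<or> i = c \<and> r \<or> i = d \<and> s \<or> i = e \<and> t \<or> i = f \<and> u)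
    = (i = a \<and> p' \<or> i = b \<and> q' \<or> i = c \<and> r' \<or> i = d \<and> s' \<or> i = e \<and> t' \<or> i = f \<and> u')" for i
    unfolding word_def sign_diag_inj by (rule fun_cong)
  show "p = p' \<and> q = q' \<and> r = r' \<and> s = s' \<and> t = t' \<and> u = u'"
    using *[of a] *[of b] *[of c] *[of d] *[of e] *[of f] by (simp add: positions_distinct)
qed simp

lemma word_False: "word False False False False False False = mat 1"
  by (simp add: word_def sign_diag_False)

lemma trace_word:
  "trace (word p q r s t u) = real CARD('n) - 2 * (of_bool p + of_bool q + of_bool r + of_bool s +
      of_bool t + of_bool u)"
proof -
  have "trace (word p q r s t u) = (\<Sum>i\<in>UNIV. 1 - 2 * ((if i = a then of_bool p else 0) + (if i = b
      then of_bool q else 0)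
      + (if i = c then of_bool r else 0) + (if i = d then of_bool s else 0) + (if i = e then
          of_bool t else 0) + (if i = f then of_bool u else 0)))"
    unfolding trace_def word_def sign_diag_def
  proof (rule sum.cong[OF refl])
    fix i
    consider "i = a" | "i = b" | "i = c" | "i = d" | "i = e" | "i = f" | "i \<notin> {a, b, c, d, e, f}"
        by blast
    then show "(\<chi> i j. if i = j then if i = a \<and> p \<or> i = b \<and> q \<or> i = c \<and> r \<or> i = d \<and> s \<or> i = e \<and> t
        \<or> i = f \<and> u then - 1 else 1 else 0) $ i $ i
      = 1 - 2 * ((if i = a then of_bool p else 0) + (if i = b then of_bool q else 0)
      + (if i = c then of_bool r else 0) + (if i = d then of_bool s else 0) + (if i = e then
          of_bool t else 0) + (if i = f then of_bool u else (0::real)))"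
      by cases (simp_all add: positions_distinct)
  qed
  also have "\<dots> = real CARD('n) - 2 * (of_bool p + of_bool q + of_bool r + of_bool s + of_bool t +
      of_bool u)"
    by (simp add: sum_subtractf sum.distrib flip: sum_distrib_left)
  finally show ?thesis .
qed

text \<open>Generated by 110000, 001100 and 000011.\<close>

definition word1 :: "bool \<times> bool \<times> bool \<Rightarrow> real^'n^'n" where
  "word1 = (\<lambda>(x, y, z). word x x y y z z)"

text \<open>Generated by 110000, 011000 and 111111: the words of even weight on the first three
  positions, together with their complements.\<close>

definition word2 :: "bool \<times> bool \<times> bool \<Rightarrow> real^'n^'n" where
  "word2 = (\<lambda>(x, y, z). word (x \<noteq> z) ((x \<noteq> y) \<noteq> z) (y \<noteq> z) z z z)"

text \<open>Addition in the parameter space shared by the two codes; both encodings are injective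
  homomorphisms for it.\<close>

definition xor3 :: "bool \<times> bool \<times> bool \<Rightarrow> bool \<times> bool \<times> bool \<Rightarrow> bool \<times> bool \<times> bool" where
  "xor3 = (\<lambda>(x, y, z) (x', y', z'). (x \<noteq> x', y \<noteq> y', z \<noteq> z'))"

lemma word1_mult: "word1 v ** word1 w = word1 (xor3 v w)"
  by (simp add: word1_def xor3_def word_mult split: prod.splits)

lemma word2_mult: "word2 v ** word2 w = word2 (xor3 v w)"
  by (auto simp: word2_def xor3_def word_mult word_eq_iff split: prod.splits)

lemma inj_word1: "inj word1"
  by (rule injI) (auto simp: word1_def word_eq_iff split: prod.splits)

lemma inj_word2: "inj word2"
  by (rule injI) (auto simp: word2_def word_eq_iff split: prod.splits)

lemma finite_orthogonal_subgroup_words: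
  "finite_orthogonal_subgroup (range word1)" "finite_orthogonal_subgroup (range word2)"
proof -
  have o: "orthogonal_matrix (word p q r s t u)" "transpose (word p q r s t u) = word p q r s t u"
      for p q r s t u
    by (simp_all add: word_def orthogonal_sign_diag transpose_sign_diag)
  have 1: "orthogonal_matrix (word1 v)" "transpose (word1 v) = word1 v" for v
    by (simp_all add: word1_def o split: prod.splits)
  have 2: "orthogonal_matrix (word2 v)" "transpose (word2 v) = word2 v" for v
    by (simp_all add: word2_def o split: prod.splits)
  have id: "mat 1 = word1 (False, False, False)" "mat 1 = word2 (False, False, False)"
    by (simp_all add: word1_def word2_def word_False)
  show "finite_orthogonal_subgroup (range word1)"
    by (rule finite_orthogonal_subgroupI) (auto simp: 1 id(1) word1_mult)
  show "finite_orthogonal_subgroup (range word2)"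
    by (rule finite_orthogonal_subgroupI) (auto simp: 2 id(2) word2_mult)
qed

lemma card_words: "card (range word1) = 8" "card (range word2) = 8"
  by (simp_all add: card_image inj_word1 inj_word2)

text \<open>A word of weight \<open>w\<close> has trace \<open>CARD('n) - 2 * w\<close>, so the
  Molien series is determined by the weight enumerator.\<close>

lemma isospectral_words:
  assumes "CARD('n) \<ge> 2"
  shows "isospectral (range word2) (range word1)"
proof -
  define \<Phi> where "\<Phi> = (\<lambda>k x. complete_symmetric (\<lambda>j. if even j then real CARD('n) else x) k)"
  have \<Phi>: "complete_symmetric (power_traces (word p q r s t u)) k = \<Phi> k (trace (word p q r s t
      u))" for p q r s t u k
    by (simp add: \<Phi>_def word_def power_traces_sign_diag)
  have U: "(\<Sum>v\<in>UNIV. g v) = (\<Sum>x\<in>UNIV. \<Sum>y\<in>UNIV. \<Sum>z\<in>UNIV. g (x, y, z))" for g :: "bool \<times> bool \<times> bool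
      \<Rightarrow> real"
    by (simp add: sum.cartesian_product flip: UNIV_Times_UNIV)
  have "(\<Sum>g\<in>range word2. complete_symmetric (power_traces g) k) = (\<Sum>g\<in>range word1.
      complete_symmetric (power_traces g) k)" for k
    unfolding sum.reindex[OF inj_word1] sum.reindex[OF inj_word2] comp_def U
    by (simp add: word1_def word2_def \<Phi> trace_word UNIV_bool)
  then show ?thesis
    unfolding isospectral_iff_complete_symmetric[OF assms finite_orthogonal_subgroup_words(2,1)]
        card_words by simp
qed

text \<open>The point \<open>axis d 1\<close> is chosen for its isotropy group, which contains the
  three words of weight 2 on the first three positions. Conjugation preserves traces, so they would
  correspond to two words of weight 2 of the first code with a sum of weight 2; there such sums have
  weight 0 or 4.\<close>

lemma not_isometric_words: "\<not> isometric_orbifolds (range word2) (range word1)"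
proof
  assume "isometric_orbifolds (range word2) (range word1)"
  then obtain \<phi> where iso: "orbifold_isometry (range word2) (range word1) \<phi>" by (auto simp:
      isometric_orbifolds_def)
  have "axis d 1 \<in> sphere (0::real^'n) 1" by simp
  from isotropy_conjugate[OF finite_orthogonal_subgroup_words(2,1) iso this]
  obtain A where A: "orthogonal_matrix A"
    and conj: "\<And>g. g \<in> range word2 \<Longrightarrow> g *v axis d 1 = axis d 1 \<Longrightarrow> \<exists>h\<in>range word1. A ** g = h ** A"
        by blast
  define g1 where "g1 = word2 (True, False, False)"
  define g2 where "g2 = word2 (False, True, False)"
  have stab: "word2 (x, y, False) *v axis d 1 = axis d 1" for x y
    unfolding matrix_vector_mult_basis
    by (auto simp: word2_def word_def sign_diag_def column_def vec_eq_iff axis_def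
        positions_distinct)
  obtain v w where v: "A ** g1 = word1 v ** A" and w: "A ** g2 = word1 w ** A"
    using conj[of g1] conj[of g2] stab unfolding g1_def g2_def by blast
  have vw: "A ** (g1 ** g2) = word1 (xor3 v w) ** A"
  proof -
    have "A ** (g1 ** g2) = (A ** g1) ** g2" by (simp add: matrix_mul_assoc)
    also have "\<dots> = word1 v ** (A ** g2)" by (simp add: v matrix_mul_assoc)
    also have "\<dots> = (word1 v ** word1 w) ** A" by (simp add: w matrix_mul_assoc)
    finally show ?thesis by (simp add: word1_mult)
  qed
  have tr: "trace h = trace g" if "A ** g = h ** A" for g h
  proof -
    have "trace (transpose A ** (h ** A)) = trace (transpose A ** (A ** g))" using that by simp
    also have "\<dots> = trace g" using A by (simp add: matrix_mul_assoc orthogonal_matrix_def)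
    finally have "trace ((h ** A) ** transpose A) = trace g" by (subst trace_mul_sym) simp
    then show ?thesis using A by (simp add: orthogonal_matrix_def flip: matrix_mul_assoc)
  qed
  have "trace g1 = real CARD('n) - 4" "trace g2 = real CARD('n) - 4" "trace (g1 ** g2) = real
      CARD('n) - 4"
    unfolding g1_def g2_def word2_mult by (simp_all add: word2_def xor3_def trace_word)
  then have t: "trace (word1 v) = real CARD('n) - 4" "trace (word1 w) = real CARD('n) - 4" "trace
      (word1 (xor3 v w)) = real CARD('n) - 4"
    using tr v w vw by metis+
  obtain x y z x' y' z' where "v = (x, y, z)" "w = (x', y', z')" by (metis prod_cases3)
  then show False using t
    by (cases x; cases y; cases z; cases x'; cases y'; cases z') (simp_all add: word1_def xor3_def
        trace_word)
qed

end

section \<open>The extremal pair and the volume bound\<close>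

lemma exists_isospectral_nonisometric:
  assumes "CARD('n::finite) \<ge> 6"
  shows "\<exists>\<Gamma> \<Gamma>' :: (real^'n^'n) set. finite_orthogonal_subgroup \<Gamma> \<and> finite_orthogonal_subgroup \<Gamma>' \<and>
    isospectral \<Gamma> \<Gamma>' \<and> \<not> isometric_orbifolds \<Gamma> \<Gamma>' \<and> card \<Gamma> = 8 \<and> card \<Gamma>' = 8"
proof -
  obtain S :: "'n set" where S: "card S = 6" "finite S" using obtain_subset_with_card_n[OF assms]
      by metis
  obtain xs where "set xs = S" "distinct xs" using finite_distinct_list[OF S(2)] by blast
  then have xs: "distinct xs" "length xs = 6" using S(1) distinct_card[of xs] by simp_all
  then have "length xs = Suc (Suc (Suc (Suc (Suc (Suc 0)))))" by simp
  then obtain a b c d e f where "xs = [a, b, c, d, e, f]"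
    unfolding length_Suc_conv length_0_conv by (elim exE conjE) (rule that, simp)
  with xs have dist: "distinct [a, b, c, d, e, f]" by simp
  show ?thesis
    using finite_orthogonal_subgroup_words[OF dist] card_words[OF dist] isospectral_words[OF dist]
        not_isometric_words[OF dist] assms
    by (intro exI[of _ "range (word2 a b c d e f)"] exI[of _ "range (word1 a b c d e f)"]) simp
qed

theorem theorem1p2:
  fixes d :: nat
  assumes "d \<ge> 5" and "CARD('n::finite) = d + 1"
  shows "(\<exists>\<Gamma> \<Gamma>' :: (real ^ 'n ^ 'n) set.
            finite_orthogonal_subgroup \<Gamma> \<and> finite_orthogonal_subgroup \<Gamma>' \<and>
            isospectral \<Gamma> \<Gamma>' \<and> \<not> isometric_orbifolds \<Gamma> \<Gamma>' \<and>
            orbifold_volume \<Gamma> = surface_measure (sphere 0 1 :: (real ^ 'n) set) / 8 \<and>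
            orbifold_volume \<Gamma>' = surface_measure (sphere 0 1 :: (real ^ 'n) set) / 8) \<and>
         (\<forall>\<Gamma> \<Gamma>' :: (real ^ 'n ^ 'n) set.
            finite_orthogonal_subgroup \<Gamma> \<and> finite_orthogonal_subgroup \<Gamma>' \<and>
            isospectral \<Gamma> \<Gamma>' \<and> \<not> isometric_orbifolds \<Gamma> \<Gamma>' \<longrightarrow>
            orbifold_volume \<Gamma> \<le> surface_measure (sphere 0 1 :: (real ^ 'n) set) / 8 \<and>
            orbifold_volume \<Gamma>' \<le> surface_measure (sphere 0 1 :: (real ^ 'n) set) / 8)"
proof -
  have N: "CARD('n) \<ge> 6" "CARD('n) \<ge> 2" using assms by simp_all
  have vol: "surface_measure (sphere 0 1 :: (real ^ 'n) set) \<ge> 0" by (simp add: surface_measure_def)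
  obtain \<Gamma> \<Gamma>' :: "(real ^ 'n ^ 'n) set" where "finite_orthogonal_subgroup \<Gamma>" "finite_orthogonal_subgroup \<Gamma>'"
    "isospectral \<Gamma> \<Gamma>'" "\<not> isometric_orbifolds \<Gamma> \<Gamma>'" "card \<Gamma> = 8" "card \<Gamma>' = 8"
    using exists_isospectral_nonisometric[OF N(1)] by blast
  moreover have "orbifold_volume \<Gamma> \<le> surface_measure (sphere 0 1 :: (real ^ 'n) set) / 8 \<and>
      orbifold_volume \<Gamma>' \<le> surface_measure (sphere 0 1 :: (real ^ 'n) set) / 8"
    if \<Gamma>: "finite_orthogonal_subgroup \<Gamma>" and \<Gamma>': "finite_orthogonal_subgroup \<Gamma>'"
      and iso: "isospectral \<Gamma> \<Gamma>'" and "\<not> isometric_orbifolds \<Gamma> \<Gamma>'" for \<Gamma> \<Gamma>' :: "(real ^ 'n ^ 'n) set"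
  proof -
    have "card \<Gamma> \<ge> 8"
      using isospectral_imp_isometric_of_small_order[OF N(2) \<Gamma> \<Gamma>' iso] that(4) by force
    moreover have "card \<Gamma>' = card \<Gamma>" using isospectral_imp_card_eq[OF N(2) \<Gamma> \<Gamma>' iso] by simp
    moreover have "surface_measure (sphere 0 1 :: (real ^ 'n) set) / real (card \<Gamma>)
        \<le> surface_measure (sphere 0 1 :: (real ^ 'n) set) / 8"
      using vol \<open>card \<Gamma> \<ge> 8\<close> by (intro divide_left_mono) auto
    ultimately show ?thesis by (simp only: orbifold_volume_def)
  qed
  ultimately show ?thesis
    by (intro conjI exI[of _ \<Gamma>] exI[of _ \<Gamma>'] allI impI) (auto simp: orbifold_volume_def)
qed

end
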